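(* For every $\ell\ge4$, \[T_\ell\le 10^{2^{\ell-4}}\beta_\ell\prod_{i=4}^{\ell-1}\beta_i^{2^{\ell-1-i}}\qquad\text{and}\qquad Z_\ell\le 10^{2^{\ell-4}}\gamma_\ell\prod_{i=4}^{\ell-1}\beta_i^{2^{\ell-1-i}},\] where \[\beta_\ell=A_\ell\binom{2^{\ell}-3}{\ell}\binom{2^{\ell}-3-\ell}{2^{\ell-1}-2,\,2^{\ell-2}-2,\,2^{\ell-3}-1,\,2^{\ell-4}-1,\dots,2^1-1},\] \[\gamma_\ell=A_\ell\binom{2^{\ell}-5}{\ell}\binom{2^{\ell}-5-\ell}{2^{\ell-1}-3,\,2^{\ell-2}-3,\,2^{\ell-3}-1,\,2^{\ell-4}-1,\dots,2^1-1}.\]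
   Context: The tree is the infinite rooted binary tree (every vertex has a left and a right child) with a self-loop at the root; the root is on layer $1$ and children of a layer-$k$ vertex are on layer $k+1$. Labeled chip-firing: initially $N$ chips labeled $1,\dots,N$ sit at the root; a vertex with at least $3$ chips may fire by choosing any $3$ of its chips $a<b<c$ and sending $a$ to its left child, $c$ to its right child, and $b$ to its parent (the root keeps $b$). A stable configuration is one reached by finitely many fires in which no vertex holds $\ge 3$ chips; starting from $2^m-1$ chips, a stable configuration has exactly one chip on each vertex of layers $1,\dots,m$ and none elsewhere. $Z_\ell$ is the number of distinct stable configurations obtainable from $2^{\ell}-1$ labeled chips at the root. For $\ell\ge1$, an order pattern of size $\ell$ is obtained as follows: take $m>\ell$, a stable configuration from $2^m-1$ labeled chips at the root, and a non-root vertex $v$ on layer $m-\ell+1$; on the $2^{\ell}-1$ vertices of the subtree of $v$ lying in layers $m-\ell+1,\dots,m$, replace each chip by its rank among these chips. $T_\ell$ is the number of distinct order patterns of size $\ell$ that arise. $A_n$ is the Euler zigzag number (OEIS A000111): the number of permutations $\sigma$ of $\{1,\dots,n\}$ with $\sigma_1<\sigma_2>\sigma_3<\cdots$. $\binom{M}{k_1,\dots,k_r}=M!/(k_1!\cdots k_r!)$ with $\sum k_j=M$. Empty products equal $1$. *)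

theory Defs
  imports "HOL-Combinatorics.Permutations"
begin

datatype side = L | R

text \<open>A vertex is the word of turns leading to it from the root \<^term>\<open>[]\<close>; the descendants of
  \<^term>\<open>v\<close> are the words \<^term>\<open>v @ u\<close>. Since \<^prop>\<open>butlast [] = []\<close>, taking \<^const>\<open>butlast\<close> as the
  parent map builds in the self-loop at the root.\<close>

type_synonym vertex = "side list"

definition layer :: "vertex \<Rightarrow> nat" where
  "layer v = length v + 1"

abbreviation left_child :: "vertex \<Rightarrow> vertex" where
  "left_child v \<equiv> v @ [L]"

abbreviation right_child :: "vertex \<Rightarrow> vertex" where
  "right_child v \<equiv> v @ [R]"

abbreviation parent :: "vertex \<Rightarrow> vertex" where
  "parent v \<equiv> butlast v"

type_synonym config = "vertex \<Rightarrow> nat set"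

definition initial :: "nat \<Rightarrow> config" where
  "initial N = (\<lambda>v. if v = [] then {1..N} else {})"

definition move :: "nat \<Rightarrow> vertex \<Rightarrow> config \<Rightarrow> config" where
  "move x w C = (\<lambda>u. if u = w then insert x (C u) else C u - {x})"

inductive fires :: "config \<Rightarrow> config \<Rightarrow> bool" where
  "\<lbrakk>a \<in> C v; b \<in> C v; c \<in> C v; a < b; b < c\<rbrakk> \<Longrightarrow>
   fires C (move a (left_child v) (move b (parent v) (move c (right_child v) C)))"

definition stable_configs :: "nat \<Rightarrow> config set" where
  "stable_configs N = {C. fires\<^sup>*\<^sup>* (initial N) C \<and> (\<forall>v. card (C v) < 3)}"

definition Z :: "nat \<Rightarrow> nat" where
  "Z l = card (stable_configs (2 ^ l - 1))"

definition chip_rank :: "nat set \<Rightarrow> nat \<Rightarrow> nat" where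
  "chip_rank S x = card {y \<in> S. y \<le> x}"

text \<open>The pattern is indexed by positions \<^term>\<open>u\<close> relative to \<^term>\<open>v\<close>, so that patterns read off
  below different vertices, and from different numbers of chips, are compared with each other.\<close>

definition order_pattern :: "nat \<Rightarrow> config \<Rightarrow> vertex \<Rightarrow> config" where
  "order_pattern l C v =
     (let S = (\<Union>u\<in>{u. length u < l}. C (v @ u))
      in (\<lambda>u. if length u < l then chip_rank S ` C (v @ u) else {}))"

definition order_patterns :: "nat \<Rightarrow> config set" where
  "order_patterns l =
     {order_pattern l C v | m C v.
        m > l \<and> C \<in> stable_configs (2 ^ m - 1) \<and> v \<noteq> [] \<and> layer v = m - l + 1}"

definition T :: "nat \<Rightarrow> nat" where
  "T l = card (order_patterns l)"

definition euler_zigzag :: "nat \<Rightarrow> nat" where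
  "euler_zigzag n = card {\<sigma>. \<sigma> permutes {1..n} \<and>
     (\<forall>i\<in>{1..<n}. if odd i then \<sigma> i < \<sigma> (i + 1) else \<sigma> i > \<sigma> (i + 1))}"

definition multinomial :: "nat \<Rightarrow> nat list \<Rightarrow> nat" where
  "multinomial M ks = fact M div (\<Prod>k\<leftarrow>ks. fact k)"

definition beta :: "nat \<Rightarrow> nat" where
  "beta l = euler_zigzag l * ((2 ^ l - 3) choose l) *
     multinomial (2 ^ l - 3 - l)
       ([2 ^ (l - 1) - 2, 2 ^ (l - 2) - 2] @ map (\<lambda>j. 2 ^ j - 1) (rev [1..<l - 2]))"

definition gamma :: "nat \<Rightarrow> nat" where
  "gamma l = euler_zigzag l * ((2 ^ l - 5) choose l) *
     multinomial (2 ^ l - 5 - l)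
       ([2 ^ (l - 1) - 3, 2 ^ (l - 2) - 3] @ map (\<lambda>j. 2 ^ j - 1) (rev [1..<l - 2]))"


text \<open>\<^const>\<open>multinomial\<close> is only used with lower entries summing to the upper one, where the
  division is exact.\<close>

lemma prod_list_fact_dvd: "(\<Prod>k\<leftarrow>ks. fact k :: nat) dvd fact (sum_list ks)"
proof (induction ks)
  case (Cons k ks)
  have "fact k * (\<Prod>k\<leftarrow>ks. fact k :: nat) dvd fact k * fact (sum_list ks)"
    using Cons.IH by simp
  also have "\<dots> dvd fact (k + sum_list ks)"
    by (rule fact_fact_dvd_fact)
  finally show ?case by simp
qed simp

lemma sum_list_mersenne: "sum_list (map (\<lambda>j. 2 ^ j - 1) (rev [1..<n + 1])) + n + 2 = (2::nat) ^ (n + 1)"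
proof (induction n)
  case (Suc n)
  have "(2::nat) ^ (n + 1) \<ge> 1" by simp
  with Suc show ?case by simp
qed simp

lemma beta_entries:
  assumes "l \<ge> 4"
  shows "sum_list ([2 ^ (l - 1) - 2, 2 ^ (l - 2) - 2] @ map (\<lambda>j. 2 ^ j - 1) (rev [1..<l - 2]))
    = 2 ^ l - 3 - (l::nat)"
proof -
  obtain k where l: "l = k + 4" using assms by (metis add.commute le_Suc_ex)
  have "l - 2 = (k + 1) + 1" using l by simp
  moreover have "(2::nat) ^ k \<ge> 1" by simp
  ultimately show ?thesis
    using sum_list_mersenne[of "k + 1"] by (simp add: l eval_nat_numeral)
qed

lemma gamma_entries:
  assumes "l \<ge> 4"
  shows "sum_list ([2 ^ (l - 1) - 3, 2 ^ (l - 2) - 3] @ map (\<lambda>j. 2 ^ j - 1) (rev [1..<l - 2]))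
    = 2 ^ l - 5 - (l::nat)"
proof -
  obtain k where l: "l = k + 4" using assms by (metis add.commute le_Suc_ex)
  have "l - 2 = (k + 1) + 1" using l by simp
  moreover have "(2::nat) ^ k \<ge> 1" by simp
  ultimately show ?thesis
    using sum_list_mersenne[of "k + 1"] by (simp add: l eval_nat_numeral)
qed


text \<open>The sets counted by \<^const>\<open>Z\<close> and \<^const>\<open>T\<close> are finite, so \<^const>\<open>card\<close> does count them.
  If the subtree below one child of a vertex is occupied then so is the one below the other child;
  hence an occupied vertex of depth \<open>d\<close> forces at least \<open>d\<close> chips.\<close>

definition occupied :: "config \<Rightarrow> vertex \<Rightarrow> bool" where
  "occupied C v \<longleftrightarrow> (\<exists>u. C (v @ u) \<noteq> {})"

definition balanced :: "nat \<Rightarrow> config \<Rightarrow> bool" where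
  "balanced N C \<longleftrightarrow> (\<forall>v. C v \<subseteq> {1..N}) \<and> (\<forall>v w x. x \<in> C v \<and> x \<in> C w \<longrightarrow> v = w) \<and>
     (\<forall>v s t. occupied C (v @ [s]) \<longrightarrow> occupied C (v @ [t]))"

lemma balanced_initial: "balanced N (initial N)"
  by (auto simp: balanced_def initial_def occupied_def)

lemma balanced_fires:
  assumes "fires C C'" "balanced N C"
  shows "balanced N C'"
  using assms(1)
proof cases
  case (1 a v b c)
  have sub: "\<And>u. C u \<subseteq> {1..N}" and disj: "\<And>u w x. x \<in> C u \<Longrightarrow> x \<in> C w \<Longrightarrow> u = w"
    and sib: "\<And>u s t. occupied C (u @ [s]) \<Longrightarrow> occupied C (u @ [t])"
    using assms(2) unfolding balanced_def by blast+
  have ne: "a \<noteq> b" "b \<noteq> c" "a \<noteq> c" using 1 by auto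
  have a: "a \<in> C' (v @ [L])" and c: "c \<in> C' (v @ [R])"
    using ne by (auto simp: 1(1) move_def)
  have unchanged: "C' u = C u" if "u \<noteq> v" "u \<noteq> v @ [L]" "u \<noteq> v @ [R]" "u \<noteq> butlast v" for u
    using that disj 1(2-4) by (fastforce simp: 1(1) move_def)
  have "occupied C' w \<longleftrightarrow> occupied C w \<or> w = v @ [L] \<or> w = v @ [R]" for w
  proof (cases "(\<exists>u. v = w @ u) \<or> w = v @ [L] \<or> w = v @ [R]")
    case True
    then have "occupied C' w"
    proof (elim disjE exE)
      fix u assume "v = w @ u"
      then have "a \<in> C' (w @ (u @ [L]))" using a by simp
      then show ?thesis unfolding occupied_def by blast
    next
      assume "w = v @ [L]"
      then have "a \<in> C' (w @ [])" using a by simp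
      then show ?thesis unfolding occupied_def by blast
    next
      assume "w = v @ [R]"
      then have "c \<in> C' (w @ [])" using c by simp
      then show ?thesis unfolding occupied_def by blast
    qed
    moreover have "occupied C w" if "v = w @ u" for u
      using that 1(2) unfolding occupied_def by blast
    ultimately show ?thesis using True by auto
  next
    case False
    have "C' (w @ u) = C (w @ u)" for u
    proof (rule unchanged)
      show "w @ u \<noteq> v" using False by auto
      have "w @ u \<noteq> v @ [s]" if "w \<noteq> v @ [s]" for s
      proof
        assume eq: "w @ u = v @ [s]"
        with that have "u \<noteq> []" by auto
        then have "v = w @ butlast u" using eq by (metis butlast_append butlast_snoc)
        with False show False by blast
      qed
      with False show "w @ u \<noteq> v @ [L]" "w @ u \<noteq> v @ [R]" by auto
      show "w @ u \<noteq> butlast v"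
      proof
        assume eq: "w @ u = butlast v"
        show False
        proof (cases "v = []")
          case True
          with eq have "v = w @ []" by simp
          with False show ?thesis by blast
        next
          case ne: False
          then have "v = w @ (u @ [last v])" using eq
            by (metis append.assoc append_butlast_last_id)
          with False show ?thesis by blast
        qed
      qed
    qed
    then show ?thesis using False by (auto simp: occupied_def)
  qed
  then have "occupied C' (u @ [s]) \<Longrightarrow> occupied C' (u @ [t])" for u s t
    using sib by (metis (full_types) append1_eq_conv side.exhaust)
  moreover have "C' u \<subseteq> {1..N}" for u
  proof -
    have "C' u \<subseteq> C u \<union> C v" using 1(2-4) by (auto simp: 1(1) move_def)
    then show ?thesis using sub by blast
  qed
  moreover have "x \<in> C' u \<Longrightarrow> x \<in> C' w \<Longrightarrow> u = w" for u w x
    using disj by (auto simp: 1(1) move_def split: if_splits)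
  ultimately show ?thesis unfolding balanced_def by blast
qed

lemma balanced_reachable: "fires\<^sup>*\<^sup>* (initial N) C \<Longrightarrow> balanced N C"
  by (induction rule: rtranclp_induct) (auto intro: balanced_initial balanced_fires)

lemma balanced_depth:
  assumes "balanced N C" "occupied C v"
  shows "card (\<Union>u. C (v @ u)) + length v \<le> N"
  using assms(2)
proof (induction v rule: rev_induct)
  case Nil
  have "(\<Union>u. C u) \<subseteq> {1..N}" using assms(1) by (auto simp: balanced_def)
  then show ?case using card_mono[of "{1..N}"] by fastforce
next
  case (snoc s v)
  obtain t where t: "t \<noteq> s" by (metis side.distinct(1))
  let ?S = "\<lambda>v. \<Union>u. C (v @ u)"
  have fin: "finite (?S w)" for w
    by (rule finite_subset[of _ "{1..N}"]) (use assms(1) in \<open>auto simp: balanced_def\<close>)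
  have "occupied C (v @ [t])" using assms(1) snoc.prems by (auto simp: balanced_def)
  then have "?S (v @ [t]) \<noteq> {}" by (auto simp: occupied_def)
  then have "card (?S (v @ [t])) > 0" using fin card_gt_0_iff by blast
  moreover have "?S (v @ [s]) \<inter> ?S (v @ [t]) = {}"
    using assms(1) t unfolding balanced_def by fastforce
  then have "card (?S (v @ [s]) \<union> ?S (v @ [t])) = card (?S (v @ [s])) + card (?S (v @ [t]))"
    using fin by (intro card_Un_disjoint)
  moreover have "card (?S (v @ [s]) \<union> ?S (v @ [t])) \<le> card (?S v)"
    by (rule card_mono[OF fin]) auto
  moreover have "occupied C v"
    using snoc.prems by (auto simp: occupied_def)
  then have "card (?S v) + length v \<le> N" by (rule snoc.IH)
  ultimately show ?case by simp
qed

lemma finite_words: "finite {v :: vertex. length v \<le> n}"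
proof -
  have "(UNIV :: side set) = {L, R}" by (auto intro: side.exhaust)
  then have "finite (UNIV :: side set)" by (metis finite.emptyI finite_insert)
  then show ?thesis using finite_lists_length_le[of UNIV n] by simp
qed

lemma finite_configs:
  assumes "finite A" "finite B"
  shows "finite {C :: config. (\<forall>v. C v \<subseteq> B) \<and> (\<forall>v. v \<notin> A \<longrightarrow> C v = {})}"
proof (rule finite_subset)
  show "finite {C. \<forall>v. (v \<in> A \<longrightarrow> C v \<in> Pow B) \<and> (v \<notin> A \<longrightarrow> C v = {})}"
    using assms by (intro finite_set_of_finite_funs) auto
qed auto

lemma finite_stable_configs: "finite (stable_configs N)"
proof (rule finite_subset[OF _ finite_configs[OF finite_words[of N] finite_atLeastAtMost[of 1 N]]], safe)
  fix C v x assume C: "C \<in> stable_configs N" and x: "x \<in> C v"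
  then have "balanced N C" by (auto simp: stable_configs_def intro: balanced_reachable)
  then show "x \<in> {1..N}" using x unfolding balanced_def by blast
next
  fix C v x assume C: "C \<in> stable_configs N" and x: "x \<in> C v" and "\<not> length v \<le> N"
  then have "balanced N C" by (auto simp: stable_configs_def intro: balanced_reachable)
  moreover have "occupied C v" unfolding occupied_def using x by (metis append_Nil2 empty_iff)
  ultimately have "length v \<le> N" using balanced_depth by fastforce
  with \<open>\<not> length v \<le> N\<close> show "x \<in> {}" by simp
qed

lemma finite_order_patterns: "finite (order_patterns l)"
proof -
  let ?W = "{u :: vertex. length u < l}"
  have W: "finite ?W" by (rule finite_subset[OF _ finite_words[of l]]) auto
  have "order_pattern l C v u \<subseteq> {0..card ?W * 2}" if "C \<in> stable_configs N" for C v u N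
  proof -
    let ?S = "\<Union>u\<in>?W. C (v @ u)"
    have "card ?S \<le> (\<Sum>u\<in>?W. card (C (v @ u)))" by (rule card_UN_le[OF W])
    also have "\<dots> \<le> (\<Sum>u\<in>?W. 2)"
      using that by (intro sum_mono) (auto simp: stable_configs_def less_Suc_eq_le eval_nat_numeral)
    finally have "card ?S \<le> card ?W * 2" by simp
    moreover have "balanced N C" using that by (auto simp: stable_configs_def intro: balanced_reachable)
    then have "?S \<subseteq> {1..N}" by (auto simp: balanced_def)
    then have "finite ?S" by (rule finite_subset) simp
    then have "chip_rank ?S x \<le> card ?S" for x
      unfolding chip_rank_def by (intro card_mono) auto
    ultimately have "chip_rank ?S x \<le> card ?W * 2" for x by (meson le_trans)
    then show ?thesis by (auto simp: order_pattern_def Let_def)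
  qed
  moreover have "order_pattern l C v u = {}" if "u \<notin> ?W" for C v u
    using that by (simp add: order_pattern_def Let_def)
  ultimately have "order_patterns l \<subseteq>
      {P. (\<forall>u. P u \<subseteq> {0..card ?W * 2}) \<and> (\<forall>u. u \<notin> ?W \<longrightarrow> P u = {})}"
    unfolding order_patterns_def by blast
  then show ?thesis
    by (rule finite_subset) (rule finite_configs[OF W finite_atLeastAtMost])
qed

end

theory Submission
  imports Defs "HOL-Combinatorics.Multiset_Permutations"
begin

text \<open>Let \<open>c v\<close> be the chip that ends at \<open>v\<close>. All firing counts are forced, and so is the order of the last
  fires: near the end of a run a vertex fires exactly when it holds three chips, one returned by each
  child and one received from the parent, and the last fire of the parent delivers the final chip of
  the vertex. Hence \<open>c v < c (v R)\<close> if \<open>v\<close> is the root or a left child, and \<open>c (v L) < c v\<close> if \<open>v\<close> is the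
  root or a right child. So the chips alternate along the zigzag path \<open>v, vR, vRL, vRLR, \<dots>\<close> below a left
  child \<open>v\<close>; following thresholds upwards along right children also shows that the smallest chip below
  \<open>v\<close> lies below \<open>vL\<close>, and the largest one below \<open>vRR\<close>.

  A labelling of a subtree is determined by the distribution of its labels over the zigzag path
  and the subtrees hanging off it, the alternating order on the path, and the patterns of these
  subtrees. Counting these data gives \<open>T\<^sub>l \<le> \<beta>\<^sub>l T\<^sub>1 \<cdots> T\<^sub>l\<^sub>-\<^sub>1\<close> and, since the two smallest and the two
  largest chips have a known place in the whole tree, \<open>Z\<^sub>l \<le> \<gamma>\<^sub>l T\<^sub>1 \<cdots> T\<^sub>l\<^sub>-\<^sub>1\<close>. With
  \<open>T\<^sub>1 T\<^sub>2 T\<^sub>3 \<le> 10\<close> the claim follows by induction.\<close>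

section \<open>Firing counts\<close>

text \<open>Only the last \<open>m - length v - 1\<close> fires of \<open>v\<close> are treated as
  rigid; the order of the earlier ones depends on the run. Maxima of subtrees therefore need a
  separate argument, which counts how often chips above a threshold are passed on during the
  uncontrolled part. Minima follow by the symmetry that exchanges left with right and
  \<open>x\<close> with \<open>2 ^ m - x\<close>.

  The path that starts to the right is used only below left children and the root, whereas the
  subtrees hanging off it are rooted at children of both kinds. So \<open>T l\<close> can be twice
  the number of patterns below left children. This factor 2 is regained because the counted
  conditions ignore one forced comparison at the lower end of the path.

  Once the \<open>c\<close> smallest and \<open>c\<close> largest chips are placed,
  \<open>2 ^ l - 1 - 2 * c\<close> remain: \<open>c = 1\<close> below a left child and
  \<open>c = 2\<close> in the whole tree, whence the 3 in \<open>beta\<close> and the 5 in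
  \<open>gamma\<close>. The 10 is 11 - 1: a poset on five vertices has eleven linear extensions, one
  of which cannot occur.\<close>

text \<open>The number of fires of a vertex of height \<open>h\<close>, where the bottom occupied layer has height 1. It solves
  \<open>f (h + 1) + 2 f (h - 1) - 3 f h = 1\<close>: one chip is left on the vertex.\<close>

definition height_fires :: "nat \<Rightarrow> nat" where
  "height_fires h = 2 ^ h - 1 - h"

lemma height_fires_eq: "int (height_fires h) = 2 ^ h - 1 - int h"
proof -
  have "h < 2 ^ h" by (rule less_exp)
  then have "Suc h \<le> 2 ^ h" by (rule Suc_leI)
  then have "int (2 ^ h - Suc h) = int (2 ^ h) - int (Suc h)" by (rule of_nat_diff)
  then show ?thesis by (simp add: height_fires_def)
qed

text \<open>Ensures that the \<open>k\<close>-th last fire of a vertex exists for every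
  \<open>k\<close> below its height, the range in which the end of a run is rigid.\<close>

lemma height_fires_ge: "k < h \<Longrightarrow> k \<le> height_fires h"
proof (induction h)
  case (Suc h)
  have "int k \<le> 2 ^ Suc h - 1 - int (Suc h)"
  proof (cases "k = h")
    case True
    have "h < 2 ^ h" by (rule less_exp)
    then have "int h < int (2 ^ h)" by (simp only: of_nat_less_iff)
    then have "int h + 1 \<le> 2 ^ h" unfolding of_nat_power of_nat_numeral by linarith
    then show ?thesis using True by simp
  next
    case False
    then have "int k \<le> 2 ^ h - 1 - int h" using Suc height_fires_eq[of h] by simp
    moreover have "(1::int) \<le> 2 ^ h" by simp
    ultimately show ?thesis unfolding power_Suc of_nat_Suc by linarith
  qed
  then show ?case using height_fires_eq[of "Suc h"] by linarith
qed simp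

text \<open>A run with explicit times, since the arguments compare when individual fires happen. At
  time \<open>t\<close> the vertex \<open>V t\<close> sends \<open>A t\<close> left,
  \<open>B t\<close> up and \<open>D t\<close> right.\<close>

locale firing_run =
  fixes m n :: nat and X :: "nat \<Rightarrow> config" and V :: "nat \<Rightarrow> vertex" and A B D :: "nat \<Rightarrow> nat"
  assumes start: "X 0 = initial (2 ^ m - 1)"
    and fired_in: "\<And>t. t < n \<Longrightarrow> A t \<in> X t (V t) \<and> B t \<in> X t (V t) \<and> D t \<in> X t (V t)"
    and fired_less: "\<And>t. t < n \<Longrightarrow> A t < B t \<and> B t < D t"
    and step: "\<And>t. t < n \<Longrightarrow>
      X (Suc t) = move (A t) (left_child (V t)) (move (B t) (parent (V t)) (move (D t) (right_child (V t)) (X t)))"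
    and stable: "\<And>v. card (X n v) < 3"
begin

lemma fires_step: "t < n \<Longrightarrow> fires (X t) (X (Suc t))"
  using fired_in[of t] fired_less[of t] step[of t] by (auto intro: fires.intros)

lemma reachable: "t \<le> n \<Longrightarrow> fires\<^sup>*\<^sup>* (initial (2 ^ m - 1)) (X t)"
proof (induction t)
  case (Suc t)
  then show ?case using fires_step[of t] by (auto intro: rtranclp.rtrancl_into_rtrancl)
qed (simp add: start)

lemma balanced: "t \<le> n \<Longrightarrow> balanced (2 ^ m - 1) (X t)"
  by (rule balanced_reachable[OF reachable])

lemma same_place: "\<lbrakk>t \<le> n; x \<in> X t u; x \<in> X t w\<rbrakk> \<Longrightarrow> u = w"
  using balanced[of t] unfolding balanced_def by blast

lemma chip_range: "t \<le> n \<Longrightarrow> X t u \<subseteq> {1..2 ^ m - 1}"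
  using balanced[of t] unfolding balanced_def by blast

lemma finite_place: "t \<le> n \<Longrightarrow> finite (X t u)"
  using chip_range finite_subset by blast

lemma in_step_iff: "t < n \<Longrightarrow> x \<in> X (Suc t) u \<longleftrightarrow>
    (if x = A t then u = left_child (V t) else if x = B t then u = parent (V t)
     else if x = D t then u = right_child (V t) else x \<in> X t u)"
  using fired_less[of t] by (auto simp: step move_def)

text \<open>At the root the self-loop makes \<open>u = parent (V t)\<close> and
  \<open>u = V t\<close> hold together, so a root fire costs only two chips.\<close>

lemma card_step:
  assumes t: "t < n"
  shows "int (card (X (Suc t) u)) = int (card (X t u)) + of_bool (u = left_child (V t))
    + of_bool (u = right_child (V t)) + of_bool (u = parent (V t)) - 3 * of_bool (u = V t)"
proof -
  have ne: "A t \<noteq> B t" "B t \<noteq> D t" "A t \<noteq> D t" using fired_less[OF t] by auto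
  have fin: "finite (X t u)" using t by (simp add: finite_place)
  have pl: "u = V t" if "A t \<in> X t u \<or> B t \<in> X t u \<or> D t \<in> X t u"
    using that fired_in[OF t] same_place[of t _ u "V t"] t by auto
  show ?thesis
  proof (cases "u = V t")
    case True
    have sub: "{A t, B t, D t} \<subseteq> X t u" using fired_in[OF t] True by simp
    have c3: "card {A t, B t, D t} = 3" using ne by simp
    have card_diff: "card (X t u - {A t, B t, D t}) + 3 = card (X t u)"
      using card_Diff_subset[OF _ sub] card_mono[OF fin sub] c3 by simp
    show ?thesis
    proof (cases "V t = []")
      case root: True
      have "X (Suc t) u = insert (B t) (X t u - {A t, B t, D t})"
        using True root ne by (auto simp: in_step_iff[OF t] split: if_splits)
      then show ?thesis using True root fin card_diff by simp
    next
      case False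
      then have "parent (V t) \<noteq> V t" by (cases "V t" rule: rev_cases) auto
      moreover from this have "X (Suc t) u = X t u - {A t, B t, D t}"
        using True ne by (auto simp: in_step_iff[OF t] split: if_splits)
      ultimately show ?thesis using True card_diff by simp
    qed
  next
    case False
    then have nin: "A t \<notin> X t u" "B t \<notin> X t u" "D t \<notin> X t u" using pl by auto
    have d: "parent (V t) \<noteq> left_child (V t)" "parent (V t) \<noteq> right_child (V t)"
      by (cases "V t" rule: rev_cases; simp)+
    have X': "X (Suc t) u = X t u \<union> {x. x = A t \<and> u = left_child (V t)}
       \<union> {x. x = D t \<and> u = right_child (V t)} \<union> {x. x = B t \<and> u = parent (V t)}" (is "_ = ?Y")
    proof (rule set_eqI)
      fix x show "x \<in> X (Suc t) u \<longleftrightarrow> x \<in> ?Y"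
        unfolding in_step_iff[OF t] using nin ne by (cases "x = A t"; cases "x = B t"; cases "x = D t") simp_all
    qed
    consider "u = left_child (V t)" | "u = right_child (V t)" | "u = parent (V t)"
      | "u \<noteq> left_child (V t)" "u \<noteq> right_child (V t)" "u \<noteq> parent (V t)" by blast
    then show ?thesis
      by cases (use False nin fin d d[symmetric] X' in simp_all)
  qed
qed

definition dones :: "nat \<Rightarrow> vertex \<Rightarrow> nat" where
  "dones t v = card {s. s < t \<and> V s = v}"

text \<open>The fire at time \<open>t\<close> itself still counts, so at its \<open>k\<close>-th
  last fire a vertex sees the value \<open>k\<close>, and \<open>k - 1\<close> one step
  later.\<close>

definition rem :: "nat \<Rightarrow> vertex \<Rightarrow> nat" where
  "rem t v = card {s. t \<le> s \<and> s < n \<and> V s = v}"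

lemma dones_0: "dones 0 v = 0"
  by (simp add: dones_def)

lemma dones_Suc: "dones (Suc t) v = dones t v + of_bool (V t = v)"
proof -
  have "{s. s < Suc t \<and> V s = v} = {s. s < t \<and> V s = v} \<union> (if V t = v then {t} else {})"
    by (auto simp: less_Suc_eq)
  then show ?thesis by (simp add: dones_def)
qed

lemma dones_rem: "t \<le> n \<Longrightarrow> dones t v + rem t v = dones n v"
proof -
  assume "t \<le> n"
  then have eq: "{s. s < n \<and> V s = v} = {s. s < t \<and> V s = v} \<union> {s. t \<le> s \<and> s < n \<and> V s = v}" by auto
  show ?thesis unfolding dones_def rem_def eq by (rule card_Un_disjoint[symmetric]) auto
qed

lemma rem_Suc: "t < n \<Longrightarrow> rem t v = rem (Suc t) v + of_bool (V t = v)"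
  using dones_rem[of t v] dones_rem[of "Suc t" v] dones_Suc[of t v] by simp

lemma rem_antimono: "s \<le> t \<Longrightarrow> rem t v \<le> rem s v"
  unfolding rem_def by (rule card_mono) auto

lemma rem_n: "rem n v = 0"
  by (simp add: rem_def)

lemma rem_fire: "\<lbrakk>s < n; V s = v; s < t\<rbrakk> \<Longrightarrow> rem t v < rem s v"
  using rem_antimono[of "Suc s" t v] rem_Suc[of s v] by simp

text \<open>The self-loop needs no term of its own: for \<open>v = []\<close> the parent is again
  \<open>[]\<close>, and the root is credited once with its own fires.\<close>

lemma chips_dones: "t \<le> n \<Longrightarrow> int (card (X t v)) = (if v = [] then 2 ^ m - 1 else 0)
    + int (dones t (parent v)) + int (dones t (left_child v)) + int (dones t (right_child v)) - 3 * int (dones t v)"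
proof (induction t)
  case 0
  then show ?case by (auto simp: start initial_def dones_0 of_nat_diff)
next
  case (Suc t)
  have l: "v = left_child (V t) \<longleftrightarrow> V t = parent v \<and> v \<noteq> [] \<and> last v = L" for v
    by (cases v rule: rev_cases) auto
  have r: "v = right_child (V t) \<longleftrightarrow> V t = parent v \<and> v \<noteq> [] \<and> last v = R" for v
    by (cases v rule: rev_cases) auto
  have p: "of_bool (v = parent (V t)) =
     (of_bool (V t = left_child v) + of_bool (V t = right_child v) + of_bool (v = [] \<and> V t = []) :: int)"
  proof (cases "V t = []")
    case False
    then have "v = parent (V t) \<longleftrightarrow> V t = left_child v \<or> V t = right_child v"
      by (cases "V t" rule: rev_cases) (auto intro: side.exhaust)
    then show ?thesis using False by auto
  qed auto
  have q: "of_bool (v = left_child (V t)) + of_bool (v = right_child (V t))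
      = (of_bool (V t = parent v) - of_bool (v = [] \<and> V t = []) :: int)"
    unfolding l r by (cases "last v") auto
  have e: "v = V t \<longleftrightarrow> V t = v" by auto
  show ?case
    using Suc card_step[of t v] p q unfolding dones_Suc e by (simp split: if_splits)
qed

definition tot :: "vertex \<Rightarrow> nat" where
  "tot v = height_fires (m - length v)"

lemma tot_balance:
  "(if v = [] then 2 ^ m - 1 else 0) + int (tot (parent v)) + int (tot (left_child v))
    + int (tot (right_child v)) - 3 * int (tot v) = of_bool (length v < m)"
proof (cases "length v < m")
  case True
  define h where "h = m - length v - 1"
  have h: "m - length v = Suc h" "m - Suc (length v) = h" using True by (auto simp: h_def)
  show ?thesis
  proof (cases "v = []")
    case True
    have "int (tot []) = 2 ^ Suc h - 1 - int (Suc h)" "int (tot [d]) = 2 ^ h - 1 - int h"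
      "(2::int) ^ m = 2 ^ Suc h" for d
      using True h unfolding tot_def by (simp_all add: height_fires_eq del: power_Suc of_nat_Suc)
    then show ?thesis using True \<open>length v < m\<close> by simp
  next
    case False
    then have "length v \<noteq> 0" by simp
    then have "m - length (parent v) = Suc (Suc h)" using h \<open>length v < m\<close> unfolding length_butlast by linarith
    then show ?thesis using False True h by (simp add: tot_def height_fires_eq)
  qed
next
  case False
  have "m - length (parent v) = 0 \<or> m - length (parent v) = 1"
    using False by (cases "v = []") auto
  then show ?thesis using False by (auto simp: tot_def height_fires_def)
qed

text \<open>Least action: the first vertex to exceed \<^const>\<open>tot\<close> would have to fire with at most one chip.\<close>

lemma dones_le: "t \<le> n \<Longrightarrow> dones t v \<le> tot v"
proof (induction t arbitrary: v)
  case (Suc t)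
  have IH: "dones t u \<le> tot u" for u using Suc by simp
  show ?case
  proof (cases "V t = v")
    case True
    have "dones t v \<noteq> tot v"
    proof
      assume eq: "dones t v = tot v"
      have "{A t, B t, D t} \<subseteq> X t v" using fired_in[of t] True Suc.prems by auto
      moreover have "card {A t, B t, D t} = 3" using fired_less[of t] Suc.prems by simp
      ultimately have "3 \<le> card (X t v)"
        using card_mono[OF finite_place] Suc.prems by (metis Suc_leD)
      moreover have "int (card (X t v)) \<le> of_bool (length v < m)"
        using chips_dones[of t v] Suc.prems IH[of "parent v"] IH[of "left_child v"] IH[of "right_child v"]
          tot_balance[of v] eq by simp
      ultimately show False by (cases "length v < m") auto
    qed
    then show ?thesis using IH[of v] by (simp add: dones_Suc)
  qed (use IH in \<open>simp add: dones_Suc\<close>)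
qed (simp add: dones_0)

text \<open>At a deepest vertex with the largest deficit from \<^const>\<open>tot\<close> the configuration is unstable.\<close>

lemma dones_n: "dones n v = tot v"
proof (rule ccontr)
  assume ne: "dones n v \<noteq> tot v"
  define r where "r = (\<lambda>v. tot v - dones n v)"
  have rpos: "length u < m" if "r u > 0" for u
    using that by (cases "length u < m") (auto simp: r_def tot_def height_fires_def)
  define W where "W = {u :: vertex. length u \<le> m}"
  have finW: "finite W" unfolding W_def by (rule finite_words)
  have pos: "r v > 0" using ne dones_le[of n v] by (simp add: r_def)
  then have vW: "v \<in> W" using rpos[of v] by (simp add: W_def)
  define M where "M = Max (r ` W)"
  have leM: "r u \<le> M" for u
  proof (cases "u \<in> W")
    case True then show ?thesis unfolding M_def using finW by simp
  next
    case False then show ?thesis using rpos[of u] by (cases "r u = 0") (auto simp: W_def)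
  qed
  have Mpos: "M > 0" using pos leM[of v] by linarith
  define Y where "Y = {u \<in> W. r u = M}"
  have "M \<in> r ` W" unfolding M_def using finW vW by (intro Max_in) auto
  then have "Y \<noteq> {}" "finite Y" using finW by (auto simp: Y_def)
  then obtain u where "is_arg_min (\<lambda>u. m - length u) (\<lambda>u. u \<in> Y) u"
    using ex_is_arg_min_if_finite[of Y "\<lambda>u. m - length u"]
    by blast
  then have uY: "u \<in> Y" and min: "\<And>w. w \<in> Y \<Longrightarrow> \<not> m - length w < m - length u"
    unfolding is_arg_min_def by blast+
  have u: "u \<in> Y" "\<And>w. w \<in> Y \<Longrightarrow> length w \<le> length u"
  proof -
    fix w assume "w \<in> Y"
    then show "length w \<le> length u" using min[of w] uY by (simp add: Y_def W_def) linarith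
  qed (rule uY)
  have ru: "r u = M" "length u < m" using u Mpos rpos[of u] by (auto simp: Y_def)
  have "r (u @ [s]) < M" for s
  proof (rule ccontr)
    assume "\<not> ?thesis"
    then have "r (u @ [s]) = M" using leM[of "u @ [s]"] by simp
    moreover from this have "u @ [s] \<in> W" using rpos[of "u @ [s]"] Mpos by (simp add: W_def)
    ultimately show False using u(2)[of "u @ [s]"] by (simp add: Y_def)
  qed
  from this[of L] this[of R] have ch: "r (left_child u) + 1 \<le> M" "r (right_child u) + 1 \<le> M" by simp_all
  have rr: "int (r w) = int (tot w) - int (dones n w)" for w
    using dones_le[of n w] by (simp add: r_def of_nat_diff)
  \<comment> \<open>The parent has deficit at most \<open>M\<close>, the children, being deeper, at
    most \<open>M - 1\<close>; so at least \<open>1 + 3 * M - M - 2 * (M - 1) = 3\<close> chips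
    remain.\<close>
  have "int (card (X n u)) = 1 + 3 * int (r u) - int (r (parent u)) - int (r (left_child u)) - int (r (right_child u))"
    using chips_dones[of n u] tot_balance[of u] ru unfolding rr by simp
  then have "int (card (X n u)) \<ge> 3" using ru ch leM[of "parent u"] by linarith
  then show False using stable[of u] by simp
qed

lemma final_card: "card (X n v) = of_bool (length v < m)"
proof -
  have "int (card (X n v)) = of_bool (length v < m)"
    using chips_dones[of n v] tot_balance[of v] dones_n by simp
  then show ?thesis by (cases "length v < m") auto
qed

lemma rem_0: "rem 0 v = tot v"
  using dones_rem[of 0 v] by (simp add: dones_0 dones_n)

text \<open>The balance read backwards from the final configuration. In this form the end of a run
  can be studied without knowing its beginning.\<close>

lemma chips_rem: "t \<le> n \<Longrightarrow> int (card (X t v)) = of_bool (length v < m) + 3 * int (rem t v)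
    - int (rem t (parent v)) - int (rem t (left_child v)) - int (rem t (right_child v))"
proof -
  assume t: "t \<le> n"
  have "int (dones t u) = int (tot u) - int (rem t u)" for u
    using dones_rem[OF t, of u] dones_n[of u] by simp
  then show ?thesis using chips_dones[OF t, of v] tot_balance[of v] by simp
qed

section \<open>The endgame\<close>

text \<open>The time of the \<open>k\<close>-th last fire of \<open>v\<close>, meaningful for
  \<open>k\<close> between 1 and \<open>tot v\<close>. Counting from the end is what makes the
  stages of neighbours interlock.\<close>

definition stage :: "vertex \<Rightarrow> nat \<Rightarrow> nat" where
  "stage v k = (THE s. s < n \<and> V s = v \<and> rem s v = k)"

lemma ex_stage:
  assumes "1 \<le> k" "k \<le> tot v"
  shows "\<exists>!s. s < n \<and> V s = v \<and> rem s v = k"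
proof (rule ex_ex1I)
  define s where "s = (GREATEST s. k \<le> rem s v \<and> s \<le> n)"
  have ex: "k \<le> rem 0 v \<and> 0 \<le> n" using assms rem_0 by simp
  have s: "k \<le> rem s v \<and> s \<le> n"
    unfolding s_def by (rule GreatestI_nat[where b = n and k = 0 and P = "\<lambda>s. k \<le> rem s v \<and> s \<le> n", OF ex]) simp
  have "s \<noteq> n" using s rem_n assms(1) by auto
  then have sn: "s < n" using s by simp
  have "\<not> (k \<le> rem (Suc s) v)"
  proof
    assume "k \<le> rem (Suc s) v"
    then have "Suc s \<le> s" unfolding s_def by (intro Greatest_le_nat[where b = n]) (use sn s_def in auto)
    then show False by simp
  qed
  then have "V s = v \<and> rem s v = k" using rem_Suc[OF sn, of v] s by (cases "V s = v") auto
  then show "\<exists>s. s < n \<and> V s = v \<and> rem s v = k" using sn by blast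
next
  fix s s' assume "s < n \<and> V s = v \<and> rem s v = k" "s' < n \<and> V s' = v \<and> rem s' v = k"
  then show "s = s'" using rem_fire[of s v s'] rem_fire[of s' v s] by (cases s s' rule: linorder_cases) auto
qed

lemma stage:
  assumes "1 \<le> k" "k \<le> tot v"
  shows "stage v k < n" "V (stage v k) = v" "rem (stage v k) v = k"
  using theI'[OF ex_stage[OF assms]] unfolding stage_def[symmetric] by simp_all

lemma stage_unique: "\<lbrakk>s < n; V s = v\<rbrakk> \<Longrightarrow> s = stage v (rem s v)"
proof -
  assume s: "s < n" "V s = v"
  have "1 \<le> rem s v" using rem_Suc[OF s(1), of v] s by simp
  moreover have "rem s v \<le> tot v" using rem_antimono[of 0 s v] by (simp add: rem_0)
  ultimately show ?thesis unfolding stage_def by (intro the1_equality[OF ex_stage, symmetric]) (use s in simp_all)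
qed

abbreviation "endgame v k \<equiv> 1 \<le> k \<and> k < m - length v"

lemma endgame_tot: "endgame v k \<Longrightarrow> k \<le> tot v"
  unfolding tot_def by (rule height_fires_ge) simp

lemma stage_lt: "endgame v k \<Longrightarrow> stage v k < n"
  and V_stage: "endgame v k \<Longrightarrow> V (stage v k) = v"
  and rem_stage: "endgame v k \<Longrightarrow> rem (stage v k) v = k"
  by (simp_all add: stage endgame_tot)

lemma before_stage:
  assumes "endgame v k" "k < rem t v"
  shows "t < stage v k"
proof (rule ccontr)
  assume "\<not> ?thesis"
  then show False using rem_antimono[of "stage v k" t v] rem_stage[OF assms(1)] assms(2) by simp
qed

lemma until_stage:
  assumes "endgame v k" "k \<le> rem t v"
  shows "t \<le> stage v k"
proof (rule ccontr)
  assume "\<not> ?thesis"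
  then show False
    using rem_fire[OF stage_lt[OF assms(1)] V_stage[OF assms(1)], of t] rem_stage[OF assms(1)] assms(2) by simp
qed

lemma after_stage:
  assumes "endgame v k" "rem t v < k"
  shows "stage v k < t"
proof (rule ccontr)
  assume "\<not> ?thesis"
  then show False using rem_antimono[of t "stage v k" v] rem_stage[OF assms(1)] assms(2) by simp
qed

text \<open>The last fires form a rigid pattern: just before the fire of \<open>v\<close> with \<open>k\<close> fires to go, its
  parent has \<open>k\<close> and its children \<open>k - 1\<close> fires to go, and \<open>v\<close> holds no further chip.\<close>

lemma stage_rem:
  assumes "endgame v k"
  shows "rem (stage v k) (parent v) = k \<and> rem (stage v k) (left_child v) = k - 1 \<and>
    rem (stage v k) (right_child v) = k - 1 \<and> card (X (stage v k) v) = 3"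
  using assms
proof (induction k arbitrary: v)
  case (Suc k)
  note IHk = Suc.IH
  \<comment> \<open>Otherwise the \<open>k\<close>-th last fire of the child is already over. By
    induction \<open>v\<close> had only \<open>k\<close> fires to go at that time, hence no more
    than \<open>k\<close> now.\<close>
  have child: "k \<le> rem t (v @ [d])" if "Suc k < m - length v" "Suc k \<le> rem t v" for t v d
  proof (cases "k = 0")
    case False
    show ?thesis
    proof (rule ccontr)
      assume lt: "\<not> ?thesis"
      have e: "endgame (v @ [d]) k" using False that by auto
      then have "rem (stage (v @ [d]) k) v = k" using IHk[of "v @ [d]"] by simp
      moreover have "stage (v @ [d]) k < t" using after_stage[OF e] lt by simp
      ultimately show False using rem_antimono[of "stage (v @ [d]) k" t v] that by simp
    qed
  qed simp
  \<comment> \<open>A squeeze: the vertex holds \<open>1 + 3 * (k + 1)\<close> chips minus the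
    remaining fires of its neighbours. These are at least \<open>k\<close> for each child and
    \<open>k + 1\<close> for the parent, which leaves at most 3, the number needed to fire; so all
    bounds are equalities. The bound for the parent comes from the parent's own stage, whence the
    induction from the root downwards; the root is its own parent.\<close>
  show ?case using Suc.prems
  proof (induction v rule: rev_induct)
    case Nil
    let ?s = "stage [] (Suc k)"
    note st = stage_lt[OF Nil] V_stage[OF Nil] rem_stage[OF Nil]
    have "{A ?s, B ?s, D ?s} \<subseteq> X ?s []" using fired_in[OF st(1)] st(2) by auto
    then have "3 \<le> card (X ?s [])"
      using card_mono[OF finite_place[of ?s "[]"], of "{A ?s, B ?s, D ?s}"] fired_less[OF st(1)] st(1) by simp
    moreover have "k \<le> rem ?s [L]" "k \<le> rem ?s [R]"
      using child[of "[]" ?s L] child[of "[]" ?s R] Nil st(3) by auto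
    moreover have "length ([] :: vertex) < m" using Nil by simp
    ultimately show ?case using chips_rem[of ?s "[]"] st by simp
  next
    case (snoc d p)
    let ?v = "p @ [d]" let ?s = "stage (p @ [d]) (Suc k)"
    note st = stage_lt[OF snoc.prems] V_stage[OF snoc.prems] rem_stage[OF snoc.prems]
    have "{A ?s, B ?s, D ?s} \<subseteq> X ?s ?v" using fired_in[OF st(1)] st(2) by auto
    then have three: "3 \<le> card (X ?s ?v)"
      using card_mono[OF finite_place[of ?s ?v], of "{A ?s, B ?s, D ?s}"] fired_less[OF st(1)] st(1) by simp
    have ch: "k \<le> rem ?s (left_child ?v)" "k \<le> rem ?s (right_child ?v)"
      using child[of ?v ?s L] child[of ?v ?s R] snoc.prems st(3) by auto
    have ep: "endgame p (Suc k)" using snoc.prems by auto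
    have "rem (stage p (Suc k)) ?v = k" using snoc.IH[OF ep] by (cases d) auto
    then have "?s < stage p (Suc k)"
      using rem_antimono[of "stage p (Suc k)" ?s ?v] st(3) by (cases "?s < stage p (Suc k)") auto
    then have "Suc k \<le> rem ?s p" using rem_antimono[of ?s "stage p (Suc k)" p] rem_stage[OF ep] by simp
    moreover have "length ?v < m" using snoc.prems by simp
    ultimately show ?case using three ch chips_rem[of ?s ?v] st by simp
  qed
qed simp

lemma stage_child_rem: "endgame v k \<Longrightarrow> rem (stage v k) (v @ [d]) = k - 1"
  using stage_rem[of k v] by (cases d) auto

lemma stage_chips:
  assumes "endgame v k"
  shows "X (stage v k) v = {A (stage v k), B (stage v k), D (stage v k)}"
proof (rule sym, rule card_subset_eq)
  note st = stage_lt[OF assms] V_stage[OF assms]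
  show "finite (X (stage v k) v)" using st finite_place by simp
  show "{A (stage v k), B (stage v k), D (stage v k)} \<subseteq> X (stage v k) v" using fired_in[OF st(1)] st(2) by auto
  show "card {A (stage v k), B (stage v k), D (stage v k)} = card (X (stage v k) v)"
    using stage_rem[OF assms] fired_less[OF st(1)] by simp
qed

lemma stage_bounds: "\<lbrakk>endgame v k; x \<in> X (stage v k) v\<rbrakk> \<Longrightarrow> A (stage v k) \<le> x \<and> x \<le> D (stage v k)"
  using stage_chips[of k v] fired_less[OF stage_lt[of k v]] by auto

text \<open>The vertex held nothing but the three fired chips; only the root would keep one of
  them.\<close>

lemma empty_after_stage:
  assumes "endgame v k" "v \<noteq> []"
  shows "X (Suc (stage v k)) v = {}"
proof -
  note st = stage_lt[OF assms(1)] V_stage[OF assms(1)]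
  have "parent v \<noteq> v" using assms(2) by (cases v rule: rev_cases) auto
  then show ?thesis
    using stage_chips[OF assms(1)] by (auto simp: in_step_iff[OF st(1)] st(2) split: if_splits)
qed

section \<open>Tracking chips\<close>

lemma stays:
  assumes "x \<in> X s v" "s \<le> t" "t \<le> n" "\<And>r. \<lbrakk>s \<le> r; r < t; V r = v\<rbrakk> \<Longrightarrow> x \<notin> {A r, B r, D r}"
  shows "x \<in> X t v"
  using assms(2,3,4)
proof (induction t rule: dec_induct)
  case (step t)
  then have x: "x \<in> X t v" by simp
  have "x \<notin> {A t, B t, D t}" using step same_place[of t x v "V t"] x fired_in[of t] by auto
  then show ?case using x step by (simp add: in_step_iff)
qed (use assms in simp)

lemma stays_rem: "\<lbrakk>x \<in> X s v; s \<le> t; t \<le> n; rem t v = rem s v\<rbrakk> \<Longrightarrow> x \<in> X t v"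
proof (rule stays)
  fix r assume "x \<in> X s v" "s \<le> t" "t \<le> n" "rem t v = rem s v" "s \<le> r" "r < t" "V r = v"
  then show "x \<notin> {A r, B r, D r}" using rem_fire[of r v t] rem_antimono[of s r v] by simp
qed

lemma leaves:
  assumes "x \<in> X s v" "x \<notin> X t v" "s \<le> t" "t \<le> n"
  obtains r where "s \<le> r" "r < t" "V r = v" "x \<in> {A r, B r, D r}"
  using stays[of x s v t] assms by blast

lemma arrives:
  assumes "x \<in> X t v" "x \<notin> X s v" "s \<le> t" "t \<le> n"
  obtains r where "s \<le> r" "r < t"
    "(parent (V r) = v \<and> V r \<noteq> [] \<and> B r = x) \<or> (v = left_child (V r) \<and> A r = x) \<or> (v = right_child (V r) \<and> D r = x)"
proof -
  have "\<exists>r. s \<le> r \<and> r < t \<and> x \<notin> X r v \<and> x \<in> X (Suc r) v"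
    using assms(3,4,1)
  proof (induction t rule: dec_induct)
    case (step t)
    then show ?case by (cases "x \<in> X t v") (auto intro: less_SucI)
  qed (use assms in simp)
  then obtain r where r: "s \<le> r" "r < t" "x \<notin> X r v" "x \<in> X (Suc r) v" by blast
  have rn: "r < n" using r assms by simp
  show thesis
  proof (rule that[OF r(1,2)])
    have ne: "V r \<noteq> v" if "x \<in> {A r, B r, D r}" using that r(3) fired_in[OF rn] by auto
    show "(parent (V r) = v \<and> V r \<noteq> [] \<and> B r = x) \<or> (v = left_child (V r) \<and> A r = x) \<or> (v = right_child (V r) \<and> D r = x)"
      using r(3,4) ne by (auto simp: in_step_iff[OF rn] split: if_splits)
  qed
qed

lemma sent: "t < n \<Longrightarrow> A t \<in> X (Suc t) (left_child (V t)) \<and> B t \<in> X (Suc t) (parent (V t)) \<and>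
    D t \<in> X (Suc t) (right_child (V t))"
  using fired_less[of t] by (simp add: in_step_iff)

text \<open>The stages of \<open>p\<close> and its children interlock. From the child's fire until
  its own next fire \<open>p\<close> sends nothing away, so the chip returned to it is among the
  three chips of that next fire.\<close>

lemma stage_parent:
  assumes "endgame (p @ [d]) k"
  shows "B (stage (p @ [d]) k) \<in> X (stage p k) p" "stage (p @ [d]) k < stage p k" "stage p (Suc k) < stage (p @ [d]) k"
proof -
  let ?v = "p @ [d]" let ?s = "stage ?v k"
  have ep: "endgame p k" "endgame p (Suc k)" using assms by auto
  note st = stage_lt[OF assms] V_stage[OF assms]
  have rp: "rem ?s p = k" using stage_rem[OF assms] by simp
  have "rem (stage p k) ?v = k - 1" by (rule stage_child_rem[OF ep(1)])
  then show lt: "?s < stage p k"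
    using rem_antimono[of "stage p k" ?s ?v] rem_stage[OF assms] assms by (cases "?s < stage p k") auto
  show "stage p (Suc k) < ?s" using after_stage[OF ep(2)] rp by simp
  have "rem (Suc ?s) p = k" using rem_Suc[OF st(1), of p] rp st by auto
  moreover have "B ?s \<in> X (Suc ?s) p" using sent[OF st(1)] st(2) by simp
  ultimately show "B ?s \<in> X (stage p k) p"
    using stays_rem[of "B ?s" "Suc ?s" p "stage p k"] lt stage_lt[OF ep(1)] rem_stage[OF ep(1)] by simp
qed

text \<open>Conversely, what \<open>p\<close> sends down with \<open>k + 1\<close> fires to go waits
  at the child, which then has \<open>k\<close> fires to go, until the first of these.\<close>

lemma stage_child:
  assumes "endgame (p @ [d]) k"
  shows "(if d = L then A (stage p (Suc k)) else D (stage p (Suc k))) \<in> X (stage (p @ [d]) k) (p @ [d])"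
proof -
  let ?v = "p @ [d]" let ?s = "stage p (Suc k)"
  have ep: "endgame p (Suc k)" using assms by auto
  note st = stage_lt[OF ep] V_stage[OF ep]
  have r: "rem ?s ?v = k" using stage_child_rem[OF ep] by simp
  have lt: "?s < stage ?v k" by (rule stage_parent(3)[OF assms])
  have r': "rem (Suc ?s) ?v = k" using rem_Suc[OF st(1), of ?v] r st by auto
  have "(if d = L then A ?s else D ?s) \<in> X (Suc ?s) ?v" using sent[OF st(1)] st(2) by (cases d) auto
  then show ?thesis
    using stays_rem[of _ "Suc ?s" ?v "stage ?v k"] lt stage_lt[OF assms] rem_stage[OF assms] r' by simp
qed

end

lemma card_le_1_eq: "\<lbrakk>finite S; card S \<le> 1; a \<in> S; b \<in> S\<rbrakk> \<Longrightarrow> a = b"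
  using card_le_Suc0_iff_eq[of S] by simp

lemma card_gt_1_less:
  fixes S :: "nat set"
  assumes "finite S" "\<not> card S \<le> 1"
  obtains a b where "a \<in> S" "b \<in> S" "a < b"
proof -
  obtain a b where ab: "a \<in> S" "b \<in> S" "a \<noteq> b"
    using card_le_Suc0_iff_eq[of S] assms by auto
  then show thesis using that[of a b] that[of b a] by (cases a b rule: linorder_cases) auto
qed

context firing_run begin

section \<open>Upper thresholds travel up along right children\<close>

text \<open>Between two consecutive late fires of a vertex each neighbour fires only at one known
  stage. This and the next lemma identify the senders of the chips that a vertex is about to
  fire.\<close>

lemma between_child:
  assumes "endgame p (Suc k)" "1 \<le> k" "stage p (Suc k) < t" "t < stage p k" "V t = p @ [d]"
  shows "t = stage (p @ [d]) k"
proof -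
  have e: "endgame p k" using assms by auto
  have tn: "t < n" using assms(4) stage_lt[OF e] by simp
  have "rem t (p @ [d]) \<le> k" using rem_antimono[of "stage p (Suc k)" t "p @ [d]"] stage_child_rem[OF assms(1), of d] assms by simp
  moreover have "rem t (p @ [d]) > k - 1" using rem_fire[OF tn assms(5,4)] stage_child_rem[OF e, of d] by simp
  ultimately have "rem t (p @ [d]) = k" using assms by simp
  then show ?thesis using stage_unique[OF tn assms(5)] by simp
qed

lemma between_parent:
  assumes "endgame (q @ [e]) (Suc k)" "1 \<le> k" "stage (q @ [e]) (Suc k) < t" "t < stage (q @ [e]) k" "V t = q"
  shows "t = stage q (Suc k)"
proof -
  have e: "endgame (q @ [e]) k" using assms by auto
  have tn: "t < n" using assms(4) stage_lt[OF e] by simp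
  have "rem t q \<le> Suc k" using rem_antimono[of "stage (q @ [e]) (Suc k)" t q] stage_rem[OF assms(1)] assms by simp
  moreover have "rem t q > k" using rem_fire[OF tn assms(5,4)] stage_rem[OF e] by simp
  ultimately have "rem t q = Suc k" by simp
  then show ?thesis using stage_unique[OF tn assms(5)] by simp
qed

text \<open>The chips of \<open>stage p k\<close> arrived after the previous fire of
  \<open>p\<close>, one from each child and one from the parent; the root instead keeps its previous
  middle chip. All chips of that previous fire are below \<open>x\<close>, because its largest one
  took part in the fire of the right child. A parent for which \<open>p\<close> is the left child
  needs no hypothesis: its fire used the middle chip of that previous fire, so the smallest chip,
  which \<open>p\<close> receives, is below \<open>x\<close> too.\<close>

lemma threshold_up:
  assumes e: "endgame (p @ [R]) k" and x: "D (stage (p @ [R]) k) < x"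
    and left: "B (stage (p @ [L]) k) < x"
    and up: "\<And>q. p = q @ [R] \<Longrightarrow> D (stage q (Suc k)) < x"
  shows "D (stage p k) < x"
proof (rule ccontr)
  let ?y = "D (stage p k)" let ?s = "stage p (Suc k)"
  assume "\<not> ?y < x"
  then have y: "x \<le> ?y" by simp
  have e1: "endgame p k" "endgame p (Suc k)" "1 \<le> k" using e by auto
  have "D ?s \<in> X (stage (p @ [R]) k) (p @ [R])" using stage_child[OF e] by simp
  then have Ds: "D ?s < x" using stage_bounds[OF e] x by fastforce
  have lt: "?s < stage p k"
    using before_stage[OF e1(1), of ?s] rem_stage[OF e1(2)] by simp
  note sn = stage_lt[OF e1(2)] V_stage[OF e1(2)]
  have small: "z < x" if "z \<in> X ?s p" for z using stage_bounds[OF e1(2) that] Ds by simp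
  have "?y \<notin> X (Suc ?s) p"
  proof (cases "p = []")
    case True
    have "?y \<noteq> A ?s" "?y \<noteq> B ?s" "?y \<noteq> D ?s" using y fired_less[OF sn(1)] Ds by auto
    then show ?thesis using small[of ?y] y in_step_iff[OF sn(1), of ?y p] by auto
  next
    case False
    then show ?thesis using empty_after_stage[OF e1(2)] by simp
  qed
  moreover have "?y \<in> X (stage p k) p" using stage_chips[OF e1(1)] by simp
  ultimately obtain r where r: "Suc ?s \<le> r" "r < stage p k"
    and cs: "(parent (V r) = p \<and> V r \<noteq> [] \<and> B r = ?y) \<or> (p = left_child (V r) \<and> A r = ?y) \<or> (p = right_child (V r) \<and> D r = ?y)"
    using arrives[of ?y "stage p k" p "Suc ?s"] lt stage_lt[OF e1(1)] by auto
  have r': "?s < r" using r by simp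
  from cs show False
  proof (elim disjE conjE)
    assume "parent (V r) = p" "V r \<noteq> []" and b: "B r = ?y"
    then obtain d where d: "V r = p @ [d]" by (metis append_butlast_last_id)
    have "r = stage (p @ [d]) k" by (rule between_child[OF e1(2,3) r' r(2) d])
    moreover have "B (stage (p @ [R]) k) < x" using x fired_less[OF stage_lt[OF e]] by simp
    ultimately show False using left b y by (cases d) auto
  next
    assume p: "p = left_child (V r)" and a: "A r = ?y"
    have "r = stage (V r) (Suc k)"
      by (rule between_parent[where q = "V r" and e = L and k = k]) (use e1 r r' p in auto)
    moreover have "B ?s \<in> X (stage (V r) (Suc k)) (V r)"
      using stage_parent(1)[of "Suc k" "V r" L] e1 p by simp
    ultimately have "A r \<le> B ?s" using stage_bounds[of "Suc k" "V r" "B ?s"] e1 p by auto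
    then show False using a y Ds fired_less[OF sn(1)] by simp
  next
    assume p: "p = right_child (V r)" and d: "D r = ?y"
    have "r = stage (V r) (Suc k)"
      by (rule between_parent[where q = "V r" and e = R and k = k]) (use e1 r r' p in auto)
    then show False using up[OF p] d y by simp
  qed
qed

text \<open>The only entrance to this subtree is the edge from \<open>p\<close>, and only the
  smallest chips of fires of \<open>p\<close> cross it downwards.\<close>

lemma enters_left:
  assumes "y \<in> X t (p @ L # z)" "t \<le> n"
  shows "\<exists>r<t. V r = p \<and> A r = y"
  using assms
proof (induction t arbitrary: z)
  case 0
  then show ?case by (simp add: start initial_def)
next
  case (Suc t)
  have t: "t < n" using Suc.prems by simp
  have "(\<exists>z. y \<in> X t (p @ L # z)) \<or> (V t = p \<and> A t = y)"
  proof (cases "y \<in> {A t, B t, D t}")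
    case False
    then show ?thesis using Suc.prems by (auto simp: in_step_iff[OF t])
  next
    case True
    then have yV: "y \<in> X t (V t)" using fired_in[OF t] by auto
    consider "y = A t" "p @ L # z = V t @ [L]" | "y = B t" "p @ L # z = parent (V t)" | "y = D t" "p @ L # z = V t @ [R]"
      using True Suc.prems(1) by (auto simp: in_step_iff[OF t] split: if_splits)
    then show ?thesis
    proof cases
      case 1
      then show ?thesis
      proof (cases z rule: rev_cases)
        case (snoc z' d)
        then have "V t = p @ L # z'" using 1 by simp
        then show ?thesis using yV by auto
      qed simp
    next
      case 2
      have "V t \<noteq> []" using 2 by auto
      then have "V t = p @ L # (z @ [last (V t)])" using 2 by (metis append.assoc append_Cons append_butlast_last_id)
      then show ?thesis using yV by metis
    next
      case 3
      then show ?thesis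
      proof (cases z rule: rev_cases)
        case (snoc z' d)
        then have "V t = p @ L # z'" using 3 by simp
        then show ?thesis using yV by auto
      qed simp
    qed
  qed
  then show ?case
  proof
    assume "\<exists>z. y \<in> X t (p @ L # z)"
    then show ?thesis using Suc.IH t by (meson less_SucI less_or_eq_imp_le)
  qed auto
qed

text \<open>If \<open>p\<close> sends a chip \<open>\<ge> x\<close> to its right child \<open>u\<close>, then \<open>u\<close> has to pass on a chip \<open>\<ge> x\<close> later.
  So if \<open>u\<close> does this only once, it does so after \<open>p\<close> did so for the last time, and it returns a
  smaller chip to \<open>p\<close>; hence \<open>p\<close> did so at most once as well.\<close>

lemma threshold_chain:
  assumes "endgame (p @ [R]) k" "D (stage (p @ [R]) k) < x"
    "card {t. t < stage (p @ [R]) k \<and> V t = p @ [R] \<and> x \<le> D t} \<le> 1"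
  shows "D (stage p k) < x"
  using assms
proof (induction "length p" arbitrary: p k rule: less_induct)
  case less
  let ?u = "p @ [R]" let ?s = "stage ?u k" let ?s1 = "stage p (Suc k)" let ?s2 = "stage p k"
  let ?Ou = "{t. t < ?s \<and> V t = ?u \<and> x \<le> D t}" let ?Op = "{t. t < ?s1 \<and> V t = p \<and> x \<le> D t}"
  note e = less.prems(1) and Dx = less.prems(2)
  have e1: "endgame p k" "endgame p (Suc k)" "1 \<le> k" using e by auto
  have ew: "endgame (p @ [L]) k" using e by simp
  note sn = stage_lt[OF e] V_stage[OF e] and s1n = stage_lt[OF e1(2)] V_stage[OF e1(2)]
  have s1s: "?s1 < ?s" by (rule stage_parent(3)[OF e])
  have "D ?s1 \<in> X ?s ?u" using stage_child[OF e] by simp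
  then have D1: "D ?s1 < x" using stage_bounds[OF e] Dx by fastforce
  have finO: "finite ?Ou" "finite ?Op" by auto
  have Ou1: "t = t'" if "t \<in> ?Ou" "t' \<in> ?Ou" for t t'
    by (rule card_le_1_eq[OF finO(1) less.prems(3) that])
  have pass: "\<exists>r. t < r \<and> r \<in> ?Ou \<and> D t \<in> {A r, B r, D r}" if "t \<in> ?Op" for t
  proof -
    have t: "t < ?s1" "V t = p" "x \<le> D t" "t < n" using that s1n by auto
    have "D t \<in> X (Suc t) ?u" using sent[OF t(4)] t by simp
    moreover have "D t \<notin> X ?s ?u" using stage_bounds[OF e, of "D t"] t Dx by auto
    ultimately obtain r where r: "Suc t \<le> r" "r < ?s" "V r = ?u" "D t \<in> {A r, B r, D r}"
      using leaves[of "D t" "Suc t" ?u ?s] t s1s sn by auto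
    moreover have "D t \<le> D r" using r fired_less[of r] sn by auto
    ultimately show ?thesis using t by (intro exI[of _ r]) auto
  qed
  have Op: "card ?Op \<le> 1"
  proof (rule ccontr)
    assume "\<not> ?thesis"
    then obtain t1 t2 where t: "t1 \<in> ?Op" "t2 \<in> ?Op" "t1 < t2"
      by (rule card_gt_1_less[OF finO(2)])
    obtain r where r: "t2 < r" "r \<in> ?Ou" "D t2 \<in> {A r, B r, D r}" using pass[OF t(2)] by blast
    obtain r1 where r1: "r1 \<in> ?Ou" "D t1 \<in> {A r1, B r1, D r1}" using pass[OF t(1)] by blast
    have "r1 = r" using Ou1 r r1 by blast
    have tn: "t1 < n" "t2 < n" "r < n" using t r s1n sn by auto
    \<comment> \<open>To be sent twice, the chip must leave \<open>u\<close> in between, in a fire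
      of \<open>u\<close> that counts for \<open>?Ou\<close>. The only such fire is
      \<open>r\<close>, which comes after \<open>t2\<close>.\<close>
    have "D t1 \<noteq> D t2"
    proof
      assume eq: "D t1 = D t2"
      have "D t1 \<in> X (Suc t1) ?u" using sent[OF tn(1)] t by simp
      moreover have "D t1 \<notin> X t2 ?u"
        using same_place[of t2 "D t2" ?u p] fired_in[OF tn(2)] t tn eq by auto
      ultimately obtain r' where r': "Suc t1 \<le> r'" "r' < t2" "V r' = ?u" "D t1 \<in> {A r', B r', D r'}"
        using leaves[of "D t1" "Suc t1" ?u t2] t tn by auto
      have "D t1 \<le> D r'" using r' fired_less[of r'] tn by auto
      then have "r' \<in> ?Ou" using r' t r by auto
      then have "r' = r" using Ou1 r by blast
      then show False using r r' by simp
    qed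
    \<comment> \<open>Two different chips above the threshold meet in the fire \<open>r\<close>, so
      its middle chip is above it too and returns to \<open>p\<close>. There it must be fired before
      \<open>?s1\<close>, which sends another large chip to \<open>u\<close> and requires a second
      fire in \<open>?Ou\<close>.\<close>
    then have Bx: "x \<le> B r" using r r1 \<open>r1 = r\<close> t fired_less[OF tn(3)] by auto
    have rs: "rem r ?u > k" using rem_fire[of r ?u ?s] rem_stage[OF e] r tn by auto
    have rs1: "r < ?s1"
    proof (rule ccontr)
      assume "\<not> ?thesis"
      then show False using rem_antimono[of ?s1 r ?u] stage_child_rem[OF e1(2), of R] rs by simp
    qed
    have "B r \<in> X (Suc r) p" using sent[OF tn(3)] r by simp
    moreover have "B r \<notin> X ?s1 p" using stage_bounds[OF e1(2), of "B r"] D1 Bx by auto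
    ultimately obtain r' where r': "Suc r \<le> r'" "r' < ?s1" "V r' = p" "B r \<in> {A r', B r', D r'}"
      using leaves[of "B r" "Suc r" p ?s1] rs1 s1n by auto
    have "B r \<le> D r'" using r' fired_less[of r'] s1n by auto
    then have "r' \<in> ?Op" using r' Bx by auto
    then obtain r3 where "r' < r3" "r3 \<in> ?Ou" using pass by blast
    then show False using Ou1[of r3 r] r r' by simp
  qed
  show ?case
  proof (rule threshold_up[OF e Dx])
    show "B (stage (p @ [L]) k) < x"
    proof (rule ccontr)
      let ?w = "stage (p @ [L]) k"
      assume "\<not> ?thesis"
      then have Bw: "x \<le> B ?w" by simp
      note wn = stage_lt[OF ew] V_stage[OF ew]
      \<comment> \<open>If \<open>B ?w\<close> were at least \<open>x\<close>, then
        \<open>B ?w\<close> and \<open>D ?w\<close> would both have entered the left child as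
        smallest chips of fires of \<open>p\<close>. These are two different fires that also send a
        chip at least \<open>x\<close> to the right, one more than \<open>Op\<close> allows.\<close>
      have early: "r \<in> ?Op" if "r < ?w" "V r = p" "x \<le> A r" for r
      proof -
        have rn: "r < n" using that wn by simp
        have "r < ?s2" using that stage_parent(2)[OF ew] by simp
        then have "Suc k \<le> rem r p" using rem_fire[OF rn that(2), of ?s2] rem_stage[OF e1(1)] by simp
        then have "r \<le> ?s1" by (rule until_stage[OF e1(2)])
        moreover have "r \<noteq> ?s1" using that D1 fired_less[OF s1n(1)] by auto
        moreover have "x \<le> D r" using that fired_less[OF rn] by simp
        ultimately show ?thesis using that by simp
      qed
      have "\<exists>r<?w. V r = p \<and> A r = y" if "y \<in> {B ?w, D ?w}" for y
        using enters_left[of y ?w p "[]"] that fired_in[OF wn(1)] wn by auto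
      then obtain r1 r2 where "r1 < ?w" "V r1 = p" "A r1 = B ?w" "r2 < ?w" "V r2 = p" "A r2 = D ?w" by blast
      moreover have "B ?w < D ?w" using fired_less[OF wn(1)] by simp
      ultimately have "r1 \<in> ?Op" "r2 \<in> ?Op" "r1 \<noteq> r2" using early[of r1] early[of r2] Bw by auto
      then show False using card_le_1_eq[OF finO(2) Op] by blast
    qed
  next
    fix q assume p: "p = q @ [R]"
    show "D (stage q (Suc k)) < x"
      by (rule less.hyps[of q "Suc k"]) (use p e1 D1 Op in auto)
  qed
qed

section \<open>The final configuration\<close>

definition fin :: "vertex \<Rightarrow> nat" where
  "fin v = the_elem (X n v)"

lemma final_singleton: "length v < m \<Longrightarrow> X n v = {fin v}"
proof -
  assume "length v < m"
  then have "card (X n v) = 1" by (simp add: final_card)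
  then obtain y where "X n v = {y}" by (rule card_1_singletonE)
  then show ?thesis by (simp add: fin_def)
qed

lemma final_empty: "m \<le> length v \<Longrightarrow> X n v = {}"
  using final_card[of v] finite_place[of n v] by simp

lemma final_mem: "x \<in> X n v \<longleftrightarrow> length v < m \<and> fin v = x"
  using final_singleton[of v] final_empty[of v] by (cases "length v < m") auto

lemma fin_inj: "\<lbrakk>length u < m; length v < m; fin u = fin v\<rbrakk> \<Longrightarrow> u = v"
  using same_place[of n "fin u" u v] final_mem[of "fin u" u] final_mem[of "fin u" v] by simp

lemma fin_range: "length v < m \<Longrightarrow> fin v \<in> {1..2 ^ m - 1}"
  using chip_range[of n v] final_singleton[of v] by auto

text \<open>When \<open>v\<close> fires for the last time its children have no fires left, so what
  they receive stays.\<close>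

lemma fin_child:
  assumes "endgame v 1"
  shows "fin (left_child v) = A (stage v 1)" "fin (right_child v) = D (stage v 1)"
proof -
  let ?s = "stage v 1"
  note sn = stage_lt[OF assms] V_stage[OF assms]
  have "rem (Suc ?s) (v @ [d]) = 0" for d
    using rem_antimono[of ?s "Suc ?s" "v @ [d]"] stage_child_rem[OF assms, of d] by simp
  then have "A ?s \<in> X n (left_child v)" "D ?s \<in> X n (right_child v)"
    using stays_rem[of "A ?s" "Suc ?s" "left_child v" n] stays_rem[of "D ?s" "Suc ?s" "right_child v" n]
      sent[OF sn(1)] sn rem_n by simp_all
  then show "fin (left_child v) = A ?s" "fin (right_child v) = D ?s" by (simp_all add: final_mem)
qed

lemma fin_root:
  assumes "1 < m"
  shows "fin [] = B (stage [] 1)"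
proof -
  have e: "endgame [] 1" using assms by simp
  let ?s = "stage [] 1"
  note sn = stage_lt[OF e] V_stage[OF e] rem_stage[OF e]
  have "rem (Suc ?s) [] = 0" using rem_Suc[OF sn(1), of "[]"] sn by simp
  moreover have "B ?s \<in> X (Suc ?s) []" using sent[OF sn(1)] sn by simp
  ultimately have "B ?s \<in> X n []" using stays_rem[of "B ?s" "Suc ?s" "[]" n] sn rem_n by simp
  then show ?thesis by (simp add: final_mem)
qed

text \<open>The middle chip of the left child's last fire takes part in the last fire of
  \<open>v\<close>, so it is at least the smallest chip there, which is the final chip of the left
  child.\<close>

lemma fin_left_lt:
  assumes e: "endgame (left_child v) 1"
  shows "fin (left_child v) < fin (right_child (left_child v))"
proof -
  have ev: "endgame v 1" using e by auto
  have "A (stage v 1) \<le> B (stage (left_child v) 1)" using stage_bounds[OF ev stage_parent(1)[OF e]] by simp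
  also have "\<dots> < D (stage (left_child v) 1)" using fired_less[OF stage_lt[OF e]] by simp
  finally show ?thesis using fin_child[OF ev] fin_child[OF e] by simp
qed

lemma fin_root_lt: "1 < m \<Longrightarrow> fin [] < fin [R]"
  using fin_root fin_child(2)[of "[]"] fired_less[OF stage_lt[of 1 "[]"]] by simp

section \<open>The place of the largest chip of a subtree\<close>

lemma keeps_large:
  assumes "y \<in> X s (w @ z)" "s \<le> t" "t \<le> n"
  shows "\<exists>y' z'. y \<le> y' \<and> y' \<in> X t (w @ z')"
  using assms(2,3)
proof (induction t rule: dec_induct)
  case base
  then show ?case using assms(1) by blast
next
  case (step t)
  then obtain y' z' where y': "y \<le> y'" "y' \<in> X t (w @ z')" by auto
  have t: "t < n" using step by simp
  show ?case
  proof (cases "y' \<in> {A t, B t, D t}")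
    case False
    then show ?thesis using y' by (auto simp: in_step_iff[OF t])
  next
    case True
    then have V: "V t = w @ z'" using same_place[of t y' "V t" "w @ z'"] fired_in[OF t] y' t by auto
    \<comment> \<open>If the witness itself is fired, the largest chip of the same fire replaces it:
      it moves down and so stays in the subtree.\<close>
    have "D t \<in> X (Suc t) (w @ z' @ [R])" using sent[OF t] V by simp
    moreover have "y' \<le> D t" using True fired_less[OF t] by auto
    ultimately show ?thesis using y'(1) le_trans by blast
  qed
qed

lemma sent_right_below:
  assumes "r < n" "V r = v"
  obtains z where "length (v @ R # z) < m" "D r \<le> fin (v @ R # z)"
proof -
  have "D r \<in> X (Suc r) ((v @ [R]) @ [])" using sent[OF assms(1)] assms(2) by simp
  then obtain y z where "D r \<le> y" "y \<in> X n ((v @ [R]) @ z)"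
    using keeps_large[of "D r" "Suc r" "v @ [R]" "[]" n] assms by auto
  then show thesis using that[of z] by (simp add: final_mem)
qed

text \<open>The hard case is a right child \<open>v\<close> of \<open>p\<close>, whose final chip is
  the \<open>D\<close> of the last fire of \<open>p\<close>. If all final chips below the right
  child of \<open>v\<close> were smaller, so would be every chip that \<open>v\<close> ever sent
  right. Then \<open>threshold_chain\<close>, with no exceptional fire at all, would make this
  \<open>D\<close> smaller than itself.\<close>

lemma below_right:
  assumes e: "endgame v 1"
  shows "\<exists>z. length (v @ R # z) < m \<and> fin v < fin (v @ R # z)"
proof (cases v rule: rev_cases)
  case Nil
  then show ?thesis using fin_root_lt e by (intro exI[of _ "[]"]) auto
next
  case (snoc p d)
  show ?thesis
  proof (cases d)
    case L
    then show ?thesis using snoc fin_left_lt[of p] e by (intro exI[of _ "[]"]) auto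
  next
    case R
    let ?x = "fin v"
    have lv: "length v < m" using e by simp
    have ep: "endgame p 1" using e snoc by auto
    have x: "D (stage p 1) = ?x" using fin_child(2)[OF ep] snoc R by simp
    show ?thesis
    proof (rule ccontr)
      assume none: "\<not> ?thesis"
      have small: "D r < ?x" if r: "r < n" "V r = v" for r
      proof -
        obtain z where z: "length (v @ R # z) < m" "D r \<le> fin (v @ R # z)"
          using sent_right_below[OF r] by blast
        have "fin (v @ R # z) \<noteq> fin v" using fin_inj[OF z(1) lv] by auto
        moreover have "\<not> fin v < fin (v @ R # z)" using none z(1) by blast
        ultimately show ?thesis using z(2) by linarith
      qed
      have v: "v = p @ [R]" using snoc R by simp
      have none': "\<not> (t < stage v 1 \<and> V t = v \<and> ?x \<le> D t)" for t
        using small[of t] stage_lt[OF e] by auto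
      have emp: "{t. t < stage (p @ [R]) 1 \<and> V t = p @ [R] \<and> ?x \<le> D t} = {}"
        unfolding v[symmetric] using none' by blast
      have card0: "card {t. t < stage (p @ [R]) 1 \<and> V t = p @ [R] \<and> ?x \<le> D t} \<le> 1"
        unfolding emp by simp
      have "D (stage p 1) < ?x"
        by (rule threshold_chain[OF _ _ card0]) (use e snoc R small[OF stage_lt[OF e] V_stage[OF e]] in auto)
      then show False using x by simp
    qed
  qed
qed

text \<open>A chip that ends below the left child was the smallest of some fire of \<open>v\<close>,
  and the largest chip of that fire leaves one at least as large below the right child.\<close>

lemma max_below_right:
  assumes e: "endgame v 1" and u: "length (v @ u) < m" "\<And>z. u \<noteq> R # z"
  shows "\<exists>z. length (v @ R # z) < m \<and> fin (v @ u) < fin (v @ R # z)"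
proof (cases u)
  case Nil
  then show ?thesis using below_right[OF e] by simp
next
  case (Cons d z)
  then have d: "d = L" using u(2)[of z] by (cases d) auto
  have "fin (v @ u) \<in> X n (v @ L # z)" using u(1) Cons d by (simp add: final_mem)
  then obtain r where r: "r < n" "V r = v" "A r = fin (v @ u)" using enters_left by blast
  then obtain z' where "length (v @ R # z') < m" "D r \<le> fin (v @ R # z')" using sent_right_below by blast
  moreover have "A r < D r" using fired_less[OF r(1)] by simp
  ultimately show ?thesis using r(3) by (intro exI[of _ z']) simp
qed

section \<open>Forced comparisons in the bottom three layers\<close>

lemma tot_leaf: "length v + 3 = m \<Longrightarrow> tot (v @ [d]) = 1"
  by (auto simp: tot_def height_fires_def)

text \<open>The vertex \<open>v\<close> has height 3, so a child fires exactly once. Whatever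
  \<open>v\<close> sends to it, except in the last fire of \<open>v\<close>, waits for that single
  fire.\<close>

lemma leaf_target:
  assumes l: "length v + 3 = m" and t: "t < n" "V t = v" "2 \<le> rem t v"
  shows "(if d = L then A t else D t) \<in> X (stage (v @ [d]) 1) (v @ [d])" "t < stage (v @ [d]) 1"
proof -
  let ?w = "v @ [d]" let ?q = "stage ?w 1"
  have ew: "endgame ?w 1" using l by auto
  note wn = stage_lt[OF ew] rem_stage[OF ew]
  have "rem ?q v = 1" using stage_rem[OF ew] by simp
  then show lt: "t < ?q" using t rem_antimono[of ?q t v] by (cases "t < ?q") auto
  have "rem (Suc t) ?w = rem ?q ?w"
  proof (rule antisym)
    show "rem (Suc t) ?w \<le> rem ?q ?w" using rem_antimono[of 0 "Suc t" ?w] rem_0[of ?w] tot_leaf[OF l] wn by simp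
    show "rem ?q ?w \<le> rem (Suc t) ?w" using lt by (intro rem_antimono) simp
  qed
  moreover have "(if d = L then A t else D t) \<in> X (Suc t) ?w" using sent[OF t(1)] t(2) by (cases d) auto
  ultimately show "(if d = L then A t else D t) \<in> X ?q ?w"
    using stays_rem[of "if d = L then A t else D t" "Suc t" ?w ?q] lt wn by simp
qed

text \<open>To be sent again, the chip would have to return to \<open>v\<close>; but the only fire
  of the child comes after \<open>t2\<close>.\<close>

lemma leaf_distinct:
  assumes l: "length v + 3 = m" and t: "t2 < n" "t1 < t2" "V t1 = v" "V t2 = v" "2 \<le> rem t2 v"
  shows "(if d = L then A t1 else D t1) \<noteq> (if d = L then A t2 else D t2)"
proof
  let ?w = "v @ [d]" let ?q = "stage ?w 1" let ?y = "if d = L then A t1 else D t1"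
  assume eq: "?y = (if d = L then A t2 else D t2)"
  have ew: "endgame ?w 1" using l by auto
  have t1: "t1 < n" using t by simp
  have "?y \<in> X (Suc t1) ?w" using sent[OF t1] t by (cases d) auto
  moreover have "?y \<notin> X t2 ?w"
  proof
    assume "?y \<in> X t2 ?w"
    moreover have "?y \<in> X t2 v" using fired_in[OF t(1)] t eq by (cases d) auto
    ultimately show False using same_place[of t2 ?y ?w v] t by simp
  qed
  ultimately obtain r where r: "Suc t1 \<le> r" "r < t2" "V r = ?w"
    using leaves[of ?y "Suc t1" ?w t2] t by auto
  have "rem t2 ?w < rem r ?w" using rem_fire[of r ?w t2] r t by simp
  moreover have "rem r ?w \<le> 1" using rem_antimono[of 0 r ?w] rem_0[of ?w] tot_leaf[OF l] by simp
  moreover have "t2 < ?q" by (rule leaf_target(2)[OF l t(1,4,5)])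
  ultimately show False using rem_antimono[of t2 ?q ?w] rem_stage[OF ew] by simp
qed

text \<open>The vertices below the child lie on the bottom layer and never fire, so the child
  receives chips from \<open>v\<close> only.\<close>

lemma leaf_source:
  assumes l: "length v + 3 = m" and y: "y \<in> X (stage (v @ [d]) 1) (v @ [d])"
  obtains r where "r < n" "V r = v" "(if d = L then A r else D r) = y" "2 \<le> rem r v"
proof -
  let ?w = "v @ [d]" let ?q = "stage ?w 1"
  have ew: "endgame ?w 1" using l by auto
  have "y \<notin> X 0 ?w" by (simp add: start initial_def)
  then obtain r where r: "r < ?q" "(parent (V r) = ?w \<and> V r \<noteq> [] \<and> B r = y) \<or>
      (?w = left_child (V r) \<and> A r = y) \<or> (?w = right_child (V r) \<and> D r = y)"
    using arrives[OF y, of 0] stage_lt[OF ew] by auto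
  have rn: "r < n" using r stage_lt[OF ew] by simp
  have no: "parent (V r) \<noteq> ?w"
  proof
    assume "parent (V r) = ?w"
    then have "length (V r) + 1 = m" using l by (cases "V r" rule: rev_cases) auto
    then have "m - length (V r) = 1" by simp
    then have "tot (V r) = 0" by (simp add: tot_def height_fires_def)
    then show False using rem_fire[OF rn refl, of n] rem_antimono[of 0 r "V r"] rem_0[of "V r"] rn by simp
  qed
  have V: "V r = v" using r(2) no by auto
  show thesis
  proof (rule that[OF rn V])
    show "(if d = L then A r else D r) = y" using r(2) no by (cases d) auto
    show "2 \<le> rem r v" using rem_fire[OF rn V r(1)] stage_rem[OF ew] by simp
  qed
qed

text \<open>The smallest chip fired by the right child is \<open>D r\<close> for some fire
  \<open>r\<close> of \<open>v\<close>. The companion \<open>A r\<close> takes part in the fire of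
  the left child and bounds its smallest chip from above.\<close>

lemma fin_outer_leaves:
  assumes l: "length v + 3 = m"
  shows "fin (v @ [L, L]) < fin (v @ [R, L])"
proof -
  have eL: "endgame (v @ [L]) 1" and eR: "endgame (v @ [R]) 1" using l by auto
  have "A (stage (v @ [R]) 1) \<in> X (stage (v @ [R]) 1) (v @ [R])" using stage_chips[OF eR] by simp
  then obtain r where r: "r < n" "V r = v" "D r = A (stage (v @ [R]) 1)" "2 \<le> rem r v"
    using leaf_source[OF l] by (metis side.distinct(1))
  have "A (stage (v @ [L]) 1) \<le> A r"
    using leaf_target(1)[OF l r(1,2,4), of L] stage_bounds[OF eL, of "A r"] by simp
  then show ?thesis using fired_less[OF r(1)] r(3) fin_child(1)[OF eL] fin_child(1)[OF eR] by simp
qed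

text \<open>Together with its mirror image this excludes one of the eleven orders that the other
  comparisons leave for subtrees with three layers.\<close>

lemma fin_left_inner:
  assumes l: "length v + 3 = m" and v: "v = p @ [L]"
  shows "fin (v @ [L]) < fin (v @ [R, L])"
proof -
  have eL: "endgame (v @ [L]) 1" and eR: "endgame (v @ [R]) 1" and e1: "endgame v 1" and e2: "endgame v 2"
    and ep: "endgame p 2" "endgame p 3" using l v by auto
  let ?z = "A (stage (v @ [R]) 1)" let ?qL = "stage (v @ [L]) 1"
  have "?z \<in> X (stage (v @ [R]) 1) (v @ [R])" using stage_chips[OF eR] by simp
  then obtain r where r: "r < n" "V r = v" "D r = ?z" "2 \<le> rem r v"
    using leaf_source[OF l] by (metis side.distinct(1))
  have "A (stage v 1) < ?z"
  proof (cases "rem r v = 2")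
    case True
    then have rs: "r = stage v 2" using stage_unique[OF r(1,2)] by simp
    have "A (stage p (Suc 1)) \<in> X (stage v 1) v" using stage_child[of 1 p L] e1 v by simp
    then have "A (stage v 1) \<le> A (stage p 2)" using stage_bounds[OF e1] by (simp add: numeral_2_eq_2)
    also have "\<dots> \<le> B r" using stage_bounds[OF ep(1)] stage_parent(1)[of 2 p L] e2 v rs by simp
    also have "\<dots> < ?z" using fired_less[OF r(1)] r(3) by simp
    finally show ?thesis .
  next
    case False
    \<comment> \<open>There is time for a detour before \<open>stage v 2\<close>: \<open>B r\<close>
      goes up to \<open>p\<close>, the fire of \<open>p\<close> that uses it sends a chip no larger
      down to \<open>v\<close>, and \<open>v\<close> then sends a chip \<open>A r''\<close> no
      larger to the left. So the left child fires two different chips below \<open>?z\<close>, its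
      middle chip is below \<open>?z\<close>, and this one returns in time to bound
      \<open>A (stage v 1)\<close>.\<close>
    then have r3: "3 \<le> rem r v" using r(4) by simp
    let ?s3 = "stage p 3" let ?s2 = "stage v 2"
    have r_s3: "r < ?s3"
      using stage_child_rem[OF ep(2), of L] v r3 rem_antimono[of ?s3 r v] by (cases "r < ?s3") auto
    have s3n: "?s3 < n" "V ?s3 = p" by (rule stage_lt[OF ep(2)], rule V_stage[OF ep(2)])
    have s2n: "?s2 < n" "V ?s2 = v" by (rule stage_lt[OF e2], rule V_stage[OF e2])
    have Bp: "B r \<in> X (Suc r) p" using sent[OF r(1)] r(2) v by simp
    obtain r' where r': "r < r'" "r' \<le> ?s3" "V r' = p" "B r \<in> {A r', B r', D r'}"
    proof (cases "B r \<in> X ?s3 p")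
      case True
      then show thesis using that[of ?s3] stage_chips[OF ep(2)] r_s3 s3n by auto
    next
      case False
      then obtain r' where "Suc r \<le> r'" "r' < ?s3" "V r' = p" "B r \<in> {A r', B r', D r'}"
        using leaves[OF Bp False] r_s3 s3n by auto
      then show thesis using that[of r'] by simp
    qed
    have r'n: "r' < n" using r' s3n by simp
    have A1: "A r' \<le> B r" using r'(4) fired_less[OF r'n] by auto
    have s32: "?s3 < ?s2" using stage_parent(3)[of 2 p L] e2 v by (simp add: numeral_3_eq_3 numeral_2_eq_2)
    have Av: "A r' \<in> X (Suc r') v" using sent[OF r'n] r'(3) v by simp
    obtain r'' where r'': "r' < r''" "r'' \<le> ?s2" "V r'' = v" "A r' \<in> {A r'', B r'', D r''}"
    proof (cases "A r' \<in> X ?s2 v")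
      case True
      then show thesis using that[of ?s2] stage_chips[OF e2] r' s32 s2n by auto
    next
      case False
      then obtain r'' where "Suc r' \<le> r''" "r'' < ?s2" "V r'' = v" "A r' \<in> {A r'', B r'', D r''}"
        using leaves[OF Av False] r' s32 s2n by auto
      then show thesis using that[of r''] by simp
    qed
    have r''n: "r'' < n" using r'' s2n by simp
    have A2: "A r'' \<le> A r'" using r''(4) fired_less[OF r''n] by auto
    have rem2: "2 \<le> rem r'' v" using rem_antimono[OF r''(2), of v] rem_stage[OF e2] by simp
    have less: "r < r''" using r' r'' by simp
    have "A r \<in> X ?qL (v @ [L])" "A r'' \<in> X ?qL (v @ [L])"
      using leaf_target(1)[OF l r(1,2,4), of L] leaf_target(1)[OF l r''n r''(3) rem2, of L] by simp_all
    moreover have "A r \<noteq> A r''" using leaf_distinct[OF l r''n less r(2) r''(3) rem2, of L] by simp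
    moreover have "A r < ?z" "A r'' < ?z" using A1 A2 fired_less[OF r(1)] r(3) by simp_all
    ultimately have "B ?qL < ?z" using stage_chips[OF eL] fired_less[OF stage_lt[OF eL]] by auto
    moreover have "A (stage v 1) \<le> B ?qL" using stage_bounds[OF e1 stage_parent(1)[OF eL]] by simp
    ultimately show ?thesis by simp
  qed
  then show ?thesis using fin_child(1)[OF e1] fin_child(1)[OF eR] by simp
qed

text \<open>For a right child this is \<open>threshold_chain\<close> at the last stage. Two
  exceptional fires need height 3; they would put two large chips into the only fire of
  \<open>right_child v\<close>, whose middle chip would then take part in the last fire of
  \<open>v\<close>.\<close>

lemma fin_lt_right_bottom:
  assumes "length v + 2 = m \<or> length v + 3 = m" "v \<noteq> []"
  shows "fin v < fin (right_child v)"
proof (cases v rule: rev_cases)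
  case Nil
  then show ?thesis using assms by simp
next
  case (snoc p d)
  have e: "endgame v 1" using assms(1) by auto
  show ?thesis
  proof (cases d)
    case L
    then show ?thesis using snoc fin_left_lt[of p] e by auto
  next
    case R
    let ?x = "fin v" let ?s = "stage v 1"
    have ep: "endgame p 1" using e snoc by auto
    note sn = stage_lt[OF e] V_stage[OF e] rem_stage[OF e]
    show ?thesis
    proof (rule ccontr)
      assume "\<not> ?thesis"
      moreover have "Suc (length v) < m" using e by linarith
      then have "fin v \<noteq> fin (right_child v)" using fin_inj[of v "right_child v"] by auto
      ultimately have Dx: "D ?s < ?x" using fin_child(2)[OF e] by simp
      have "card {t. t < ?s \<and> V t = v \<and> ?x \<le> D t} \<le> 1"
      proof (rule ccontr)
        assume many: "\<not> ?thesis"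
        have "finite {t. t < ?s \<and> V t = v \<and> ?x \<le> D t}" by simp
        from card_gt_1_less[OF this many] obtain t1 t2
          where t: "t1 < ?s" "t2 < ?s" "V t1 = v" "V t2 = v" "?x \<le> D t1" "?x \<le> D t2" "t1 < t2" by blast
        have tn: "t1 < n" "t2 < n" using t sn by auto
        have r2: "2 \<le> rem t2 v" using rem_fire[OF tn(2) t(4,2)] sn by simp
        have r1: "3 \<le> rem t1 v" using rem_fire[OF tn(1) t(3,7)] r2 by simp
        have tot3: "3 \<le> tot v" using r1 rem_antimono[of 0 t1 v] rem_0 by simp
        have l3: "length v + 3 = m"
        proof (rule ccontr)
          assume "\<not> ?thesis"
          then have "m - length v = 2" using assms by simp
          then have "tot v = 1" by (simp add: tot_def height_fires_def)
          then show False using tot3 by simp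
        qed
        let ?w = "right_child v" let ?q = "stage ?w 1"
        have ew: "endgame ?w 1" using l3 by simp
        note wn = stage_lt[OF ew] V_stage[OF ew] rem_stage[OF ew]
        have in_q: "D t1 \<in> X ?q ?w" "D t2 \<in> X ?q ?w"
          using leaf_target[OF l3 tn(1) t(3), of R] leaf_target[OF l3 tn(2) t(4), of R] r1 r2 by auto
        have "D t1 \<noteq> D t2" using leaf_distinct[OF l3 tn(2) t(7,3,4) r2, of R] by simp
        then have "?x \<le> B ?q" using in_q t stage_chips[OF ew] fired_less[OF wn(1)] by auto
        moreover have "B ?q \<in> X ?s v" using stage_parent(1)[OF ew] by simp
        ultimately show False using stage_bounds[OF e, of "B ?q"] Dx by auto
      qed
      then have "D (stage p 1) < ?x" using threshold_chain[where p = p and k = 1 and x = ?x] e snoc R Dx by auto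
      then show False using fin_child(2)[OF ep] snoc R by simp
    qed
  qed
qed

section \<open>The two largest chips of the whole tree\<close>

lemma top_on_spine:
  assumes "2 ^ m - 2 \<le> x" "x \<in> X t v" "t \<le> n"
  shows "\<exists>j. v = replicate j R"
  using assms(2,3)
proof (induction t arbitrary: v)
  case 0
  then have "v = replicate 0 R" by (auto simp: start initial_def split: if_splits)
  then show ?case by blast
next
  case (Suc t)
  have t: "t < n" using Suc.prems by simp
  show ?case
  proof (cases "x \<in> {A t, B t, D t}")
    case False
    then have "x \<in> X t v" using Suc.prems by (simp add: in_step_iff[OF t])
    then show ?thesis using Suc.IH t by simp
  next
    case True
    then have "x \<in> X t (V t)" using fired_in[OF t] by auto
    then obtain j where j: "V t = replicate j R" using Suc.IH t by (meson less_imp_le)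
    have "D t \<le> 2 ^ m - 1" using chip_range[of t "V t"] fired_in[OF t] t by auto
    \<comment> \<open>The smallest chip of a fire has two larger ones beside it, so the two largest
      chips never turn left.\<close>
    then have "x \<noteq> A t" using fired_less[OF t] assms(1) by linarith
    then have "v = parent (V t) \<or> v = right_child (V t)"
      using True Suc.prems by (auto simp: in_step_iff[OF t] split: if_splits)
    then show ?thesis
    proof
      assume "v = parent (V t)"
      then have "v = replicate (j - 1) R" using j by (simp add: butlast_conv_take)
      then show ?thesis by blast
    next
      assume "v = right_child (V t)"
      then have "v = replicate (Suc j) R" using j by (simp add: replicate_append_same)
      then show ?thesis by blast
    qed
  qed
qed

end

lemma card_tree: "card {u :: vertex. length u < l} = 2 ^ l - 1"
proof (induction l)
  case (Suc l)
  have fin: "finite {u :: vertex. length u < l}" by (rule finite_subset[OF _ finite_words[of l]]) auto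
  have "{u :: vertex. length u < Suc l} = insert [] ((#) L ` {u. length u < l} \<union> (#) R ` {u. length u < l})"
    (is "?A = insert [] (?B \<union> ?C)")
  proof (intro equalityI subsetI)
    fix u :: vertex assume "u \<in> ?A"
    then show "u \<in> insert [] (?B \<union> ?C)"
    proof (cases u)
      case (Cons d z)
      then show ?thesis using \<open>u \<in> ?A\<close> by (cases d) auto
    qed simp
  qed auto
  moreover have "card (?B \<union> ?C) = card ?B + card ?C" using fin by (intro card_Un_disjoint) auto
  moreover have "card ?B = 2 ^ l - 1" "card ?C = 2 ^ l - 1" using Suc by (simp_all add: card_image)
  moreover have "[] \<notin> ?B \<union> ?C" "finite (?B \<union> ?C)" using fin by auto
  ultimately have "card ?A = Suc ((2 ^ l - 1) + (2 ^ l - 1))" by simp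
  moreover have "(1::nat) \<le> 2 ^ l" by simp
  ultimately show ?case unfolding power_Suc by linarith
qed simp

context firing_run begin

lemma fin_bij: "bij_betw fin {u. length u < m} {1..2 ^ m - 1}"
proof -
  have inj: "inj_on fin {u. length u < m}" using fin_inj by (auto simp: inj_on_def)
  have "fin ` {u. length u < m} = {1..2 ^ m - 1}"
    by (rule card_subset_eq) (use fin_range card_image[OF inj] card_tree[of m] in auto)
  then show ?thesis using inj by (simp add: bij_betw_def)
qed

lemma fin_surj: "x \<in> {1..2 ^ m - 1} \<Longrightarrow> \<exists>v. length v < m \<and> fin v = x"
  using fin_bij unfolding bij_betw_def by (metis (no_types, lifting) imageE mem_Collect_eq)

lemma top_two_right:
  assumes m: "4 \<le> m" and x: "x \<in> {2 ^ m - 2, 2 ^ m - 1}"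
  shows "\<exists>z. length (R # R # z) < m \<and> fin (R # R # z) = x"
proof -
  have pow: "(2::nat) ^ m \<ge> 16" using power_increasing[OF m, of "2::nat"] by simp
  have "(2::nat) ^ m - 1 \<in> {1..2 ^ m - 1}" "(2::nat) ^ m - 2 \<in> {1..2 ^ m - 1}"
    unfolding atLeastAtMost_iff using pow by linarith+
  note ex = this[THEN fin_surj]
  obtain v where v: "length v < m" "fin v = 2 ^ m - 1" using ex(1) by blast
  have le: "fin u \<le> fin v" if "length u < m" for u using fin_range[OF that] v by simp
  have right: "\<exists>z'. z = R # z'" if "v = w @ z" "endgame w 1" for w z
  proof (rule ccontr)
    assume "\<not> ?thesis"
    then show False using max_below_right[OF that(2), of z] that(1) v(1) le by fastforce
  qed
  have eg: "endgame [] 1" "endgame [R] 1" "endgame [R, R] 1" using m by (simp_all add: less_diff_conv)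
  obtain z1 where z1: "v = R # z1" using right[of "[]" v] eg by auto
  obtain z2 where z2: "z1 = R # z2" using right[of "[R]" z1, OF _ eg(2)] z1 by auto
  obtain z3 where z3: "z2 = R # z3" using right[of "[R, R]" z2, OF _ eg(3)] z1 z2 by auto
  show ?thesis
  proof (cases "x = 2 ^ m - 1")
    case True
    then show ?thesis using v z1 z2 by (intro exI[of _ z2]) simp
  next
    case False
    then have x: "x = 2 ^ m - 2" using x by simp
    obtain u where u: "length u < m" "fin u = x" using ex(2) x by blast
    obtain j where j: "u = replicate j R" using top_on_spine[of x n u] x final_mem[of x u] u by auto
    have "j \<noteq> 0"
    proof
      assume "j = 0"
      then have "x < fin [R]" using fin_root_lt m u j by simp
      moreover have "fin [R] \<le> 2 ^ m - 1" using fin_range[of "[R]"] m by simp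
      ultimately have "fin [R] = fin v" using x v by simp
      then show False using fin_inj[of "[R]" v] v m z1 z2 by simp
    qed
    \<comment> \<open>Ending at \<open>[R]\<close>, the chip \<open>x\<close> would be the
      \<open>D\<close> of the last root fire. But the last fire of \<open>[R]\<close> has only
      smaller chips, and \<open>[L]\<close>, off the rightmost path, never holds \<open>x\<close> or
      the maximum; so \<open>threshold_up\<close> at the root gives a contradiction.\<close>
    moreover have "j \<noteq> 1"
    proof
      assume "j = 1"
      then have uR: "fin [R] = x" using u j by simp
      have "fin [R, R] \<noteq> x" using fin_inj[of "[R, R]" "[R]"] uR m by auto
      moreover have "fin [R, R] \<noteq> fin v" using fin_inj[of "[R, R]" v] v m z1 z2 z3 by auto
      moreover have "fin [R, R] \<le> fin v" using le[of "[R, R]"] m by simp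
      ultimately have "fin [R, R] < x" using v x by simp
      then have Dx: "D (stage ([] @ [R]) 1) < x" using fin_child(2)[OF eg(2)] by simp
      have e: "endgame ([] @ [R]) 1" and eL: "endgame ([] @ [L]) 1" using eg(2) by simp_all
      have "B (stage ([] @ [L]) 1) < x"
      proof (rule ccontr)
        assume "\<not> ?thesis"
        moreover have "B (stage ([] @ [L]) 1) \<in> X (stage ([] @ [L]) 1) ([] @ [L])" using stage_chips[OF eL] by simp
        ultimately obtain i where "[L] = replicate i R"
          using top_on_spine[of "B (stage ([] @ [L]) 1)" "stage ([] @ [L]) 1" "[L]"] stage_lt[OF eL] x by auto
        then show False by (cases i) auto
      qed
      then have "D (stage [] 1) < x" using threshold_up[OF e Dx] by simp
      then show False using fin_child(2)[of "[]"] m uR by simp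
    qed
    ultimately have "u = R # R # replicate (j - 2) R" using j by (cases j; cases "j - 1") auto
    then show ?thesis using u by (intro exI[of _ "replicate (j - 2) R"]) simp
  qed
qed

end

section \<open>Stable configurations and their mirror images\<close>

definition chip :: "config \<Rightarrow> vertex \<Rightarrow> nat" where
  "chip C v = the_elem (C v)"

lemma stable_run:
  assumes "C \<in> stable_configs (2 ^ m - 1)"
  obtains n X V A B D where "firing_run m n X V A B D" "X n = C"
proof -
  have st: "fires\<^sup>*\<^sup>* (initial (2 ^ m - 1)) C" "\<And>v. card (C v) < 3"
    using assms by (auto simp: stable_configs_def)
  obtain n where "(fires ^^ n) (initial (2 ^ m - 1)) C" using rtranclp_imp_relpowp[OF st(1)] by blast
  then obtain X where X: "X 0 = initial (2 ^ m - 1)" "X n = C" "\<And>t. t < n \<Longrightarrow> fires (X t) (X (Suc t))"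
    unfolding relpowp_fun_conv by blast
  have "\<exists>v a b c. a \<in> X t v \<and> b \<in> X t v \<and> c \<in> X t v \<and> a < b \<and> b < c \<and>
      X (Suc t) = move a (left_child v) (move b (parent v) (move c (right_child v) (X t)))" if "t < n" for t
    using X(3)[OF that] by cases blast
  then obtain V A B D where "\<And>t. t < n \<Longrightarrow> A t \<in> X t (V t) \<and> B t \<in> X t (V t) \<and> D t \<in> X t (V t) \<and>
      A t < B t \<and> B t < D t \<and>
      X (Suc t) = move (A t) (left_child (V t)) (move (B t) (parent (V t)) (move (D t) (right_child (V t)) (X t)))"
    by metis
  then have "firing_run m n X V A B D" using X st(2) by unfold_locales auto
  then show thesis using that X(2) by blast
qed

fun flip :: "side \<Rightarrow> side" where
  "flip L = R" | "flip R = L"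

lemma flip_flip [simp]: "flip (flip d) = d"
  by (cases d) auto

lemma flip_comp [simp]: "flip \<circ> flip = id"
  by (simp add: fun_eq_iff)

lemma map_flip_flip: "map flip (map flip v) = v"
  by simp

definition mirror :: "nat \<Rightarrow> config \<Rightarrow> config" where
  "mirror N C v = (\<lambda>x. N + 1 - x) ` C (map flip v)"

lemma mirror_move:
  assumes "\<And>u. C u \<subseteq> {1..N}" "x \<in> {1..N}"
  shows "mirror N (move x w C) = move (N + 1 - x) (map flip w) (mirror N C)"
proof (rule ext)
  fix v
  have inj: "inj_on (\<lambda>x. N + 1 - x) {1..N}" by (auto simp: inj_on_def)
  have "(\<lambda>x. N + 1 - x) ` (C u - {x}) = (\<lambda>x. N + 1 - x) ` C u - {N + 1 - x}" for u
    using inj_on_image_set_diff[OF inj, of "C u" "{x}"] assms by auto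
  moreover have "map flip v = w \<longleftrightarrow> v = map flip w" by (metis map_flip_flip)
  ultimately show "mirror N (move x w C) v = move (N + 1 - x) (map flip w) (mirror N C) v"
    by (simp add: mirror_def move_def)
qed

lemma move_commute: "x \<noteq> y \<Longrightarrow> move x v (move y w C) = move y w (move x v C)"
  by (rule ext) (auto simp: move_def)

lemma move_range: "\<lbrakk>\<And>u. C u \<subseteq> S; x \<in> S\<rbrakk> \<Longrightarrow> move x w C u \<subseteq> S"
  by (auto simp: move_def)

text \<open>Reversing the labels exchanges smallest and largest chip, flipping exchanges the
  children. The three moves come out in the opposite order, but moves of distinct chips
  commute.\<close>

lemma mirror_fires:
  assumes "fires C C'" "\<And>u. C u \<subseteq> {1..N}"
  shows "fires (mirror N C) (mirror N C')"
  using assms(1)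
proof cases
  case (1 a v b c)
  let ?f = "\<lambda>x. N + 1 - x" let ?v = "map flip v" let ?C = "mirror N C"
  have abc: "a \<in> {1..N}" "b \<in> {1..N}" "c \<in> {1..N}" using 1 assms(2)[of v] by auto
  have fabc: "?f c < ?f b" "?f b < ?f a" using 1 abc by auto
  note r1 = move_range[of C "{1..N}", OF assms(2) abc(3)]
  note r2 = move_range[of "move c (right_child v) C" "{1..N}", OF r1 abc(2)]
  have "mirror N C' = move (?f a) (right_child ?v) (move (?f b) (parent ?v) (move (?f c) (left_child ?v) ?C))"
    unfolding 1(1) using assms(2) abc r1 r2 by (simp add: mirror_move map_butlast)
  also have "\<dots> = move (?f b) (parent ?v) (move (?f a) (right_child ?v) (move (?f c) (left_child ?v) ?C))"
    using fabc by (subst move_commute) auto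
  also have "\<dots> = move (?f b) (parent ?v) (move (?f c) (left_child ?v) (move (?f a) (right_child ?v) ?C))"
    using fabc by (subst move_commute[of "?f a" "?f c"]) auto
  also have "\<dots> = move (?f c) (left_child ?v) (move (?f b) (parent ?v) (move (?f a) (right_child ?v) ?C))"
    using fabc by (subst move_commute[of "?f b" "?f c"]) auto
  finally show ?thesis
    using fires.intros[of "?f c" ?C ?v "?f b" "?f a"] fabc 1 by (simp add: mirror_def)
qed

lemma mirror_stable:
  assumes "C \<in> stable_configs N"
  shows "mirror N C \<in> stable_configs N"
proof -
  have st: "fires\<^sup>*\<^sup>* (initial N) C" "\<And>v. card (C v) < 3" using assms by (auto simp: stable_configs_def)
  have inv: "(\<lambda>x. N + 1 - x) ` {1..N} = {1..N}"
  proof (intro equalityI subsetI)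
    fix x assume "x \<in> {1..N}"
    then show "x \<in> (\<lambda>x. N + 1 - x) ` {1..N}" by (intro image_eqI[of _ _ "N + 1 - x"]) auto
  qed auto
  have "fires\<^sup>*\<^sup>* (initial N) (mirror N C)" using st(1)
  proof (induction rule: rtranclp_induct)
    case base
    have "mirror N (initial N) = initial N" using inv by (auto simp: mirror_def initial_def fun_eq_iff)
    then show ?case by simp
  next
    case (step C C')
    have "balanced N C" using step by (auto intro: balanced_reachable)
    then have "\<And>u. C u \<subseteq> {1..N}" unfolding balanced_def by blast
    then show ?case using step mirror_fires by (metis rtranclp.rtrancl_into_rtrancl)
  qed
  moreover have "card (mirror N C v) < 3" for v
  proof -
    have "balanced N C" using st(1) by (rule balanced_reachable)
    then have "finite (C (map flip v))" by (meson balanced_def finite_atLeastAtMost finite_subset)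
    then show ?thesis using card_image_le[of "C (map flip v)" "\<lambda>x. N + 1 - x"] st(2)[of "map flip v"]
      unfolding mirror_def by (metis le_less_trans)
  qed
  ultimately show ?thesis by (simp add: stable_configs_def)
qed

abbreviation "tree l \<equiv> {u :: vertex. length u < l}"

definition conf :: "nat \<Rightarrow> (vertex \<Rightarrow> nat) \<Rightarrow> config" where
  "conf l f = (\<lambda>u. if length u < l then {f u} else {})"

lemma conf_cong: "(\<And>u. length u < l \<Longrightarrow> f u = g u) \<Longrightarrow> conf l f = conf l g"
  by (auto simp: conf_def fun_eq_iff)

lemma chip_conf: "length u < l \<Longrightarrow> chip (conf l f) u = f u"
  by (simp add: conf_def chip_def)

lemma finite_tree: "finite (tree l)"
  by (rule finite_subset[OF _ finite_words[of l]]) auto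

context firing_run begin

lemma chip_fin: "chip (X n) v = fin v"
  by (simp add: chip_def fin_def)

end

lemma stable_conf:
  assumes "C \<in> stable_configs (2 ^ m - 1)"
  shows "C = conf m (chip C)" "bij_betw (chip C) (tree m) {1..2 ^ m - 1}"
proof -
  obtain n X V A B D where "firing_run m n X V A B D" and C: "X n = C" using stable_run[OF assms] by blast
  then interpret firing_run m n X V A B D by simp
  have f: "chip C = fin" using chip_fin C by auto
  show "C = conf m (chip C)"
    unfolding f conf_def using final_singleton final_empty C by (auto simp: fun_eq_iff)
  show "bij_betw (chip C) (tree m) {1..2 ^ m - 1}" unfolding f by (rule fin_bij)
qed

text \<open>With \<open>stable_conf\<close> and the mirror symmetry, these are all the facts about
  runs that the counting uses.\<close>

lemma stable_right:
  assumes "C \<in> stable_configs (2 ^ m - 1)"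
  shows "\<lbrakk>length v + 1 < m; v = [] \<or> last v = L\<rbrakk> \<Longrightarrow> chip C v < chip C (v @ [R])"
    and "\<lbrakk>length v + 1 < m; length (v @ u) < m; \<And>z. u \<noteq> R # z\<rbrakk> \<Longrightarrow>
      \<exists>z. length (v @ R # z) < m \<and> chip C (v @ u) < chip C (v @ R # z)"
    and "\<lbrakk>length v + 2 = m \<or> length v + 3 = m; v \<noteq> []\<rbrakk> \<Longrightarrow> chip C v < chip C (v @ [R])"
    and "length v + 3 = m \<Longrightarrow> chip C (v @ [L, L]) < chip C (v @ [R, L])"
    and "\<lbrakk>length v + 3 = m; v \<noteq> []; last v = L\<rbrakk> \<Longrightarrow> chip C (v @ [L]) < chip C (v @ [R, L])"
    and "\<lbrakk>4 \<le> m; x \<in> {2 ^ m - 2, 2 ^ m - 1}\<rbrakk> \<Longrightarrow> \<exists>z. length (R # R # z) < m \<and> chip C (R # R # z) = x"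
proof -
  obtain n X V A B D where "firing_run m n X V A B D" and C: "X n = C" using stable_run[OF assms] by blast
  then interpret firing_run m n X V A B D by simp
  have f: "chip C v = fin v" for v using chip_fin C by auto
  show "\<lbrakk>length v + 1 < m; v = [] \<or> last v = L\<rbrakk> \<Longrightarrow> chip C v < chip C (v @ [R])"
    unfolding f using fin_root_lt fin_left_lt[of "butlast v"]
    by (cases v rule: rev_cases) (auto simp: less_diff_conv)
  show "\<lbrakk>length v + 1 < m; length (v @ u) < m; \<And>z. u \<noteq> R # z\<rbrakk> \<Longrightarrow>
      \<exists>z. length (v @ R # z) < m \<and> chip C (v @ u) < chip C (v @ R # z)"
    unfolding f by (rule max_below_right) (auto simp: less_diff_conv)
  show "\<lbrakk>length v + 2 = m \<or> length v + 3 = m; v \<noteq> []\<rbrakk> \<Longrightarrow> chip C v < chip C (v @ [R])"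
    unfolding f by (rule fin_lt_right_bottom)
  show "length v + 3 = m \<Longrightarrow> chip C (v @ [L, L]) < chip C (v @ [R, L])"
    unfolding f by (rule fin_outer_leaves)
  show "\<lbrakk>length v + 3 = m; v \<noteq> []; last v = L\<rbrakk> \<Longrightarrow> chip C (v @ [L]) < chip C (v @ [R, L])"
    unfolding f by (rule fin_left_inner[of v "butlast v"]) (metis append_butlast_last_id)+
  show "\<lbrakk>4 \<le> m; x \<in> {2 ^ m - 2, 2 ^ m - 1}\<rbrakk> \<Longrightarrow> \<exists>z. length (R # R # z) < m \<and> chip C (R # R # z) = x"
    unfolding f by (rule top_two_right)
qed

lemma chip_mirror:
  assumes "C \<in> stable_configs (2 ^ m - 1)" "length v < m"
  shows "chip (mirror (2 ^ m - 1) C) v = 2 ^ m - chip C (map flip v)" "chip C v \<in> {1..2 ^ m - 1}"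
proof -
  have "C (map flip v) = {chip C (map flip v)}"
    using stable_conf(1)[OF assms(1)] assms(2) by (metis conf_def length_map)
  then have "mirror (2 ^ m - 1) C v = {2 ^ m - chip C (map flip v)}" by (simp add: mirror_def)
  then show "chip (mirror (2 ^ m - 1) C) v = 2 ^ m - chip C (map flip v)" by (simp add: chip_def)
  show "chip C v \<in> {1..2 ^ m - 1}" using stable_conf(2)[OF assms(1)] assms(2) by (auto simp: bij_betw_def)
qed

lemma stable_left:
  assumes C: "C \<in> stable_configs (2 ^ m - 1)"
  shows "\<lbrakk>length v + 1 < m; v = [] \<or> last v = R\<rbrakk> \<Longrightarrow> chip C (v @ [L]) < chip C v"
    and "\<lbrakk>length v + 1 < m; length (v @ u) < m; \<And>z. u \<noteq> L # z\<rbrakk> \<Longrightarrow>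
      \<exists>z. length (v @ L # z) < m \<and> chip C (v @ L # z) < chip C (v @ u)"
    and "\<lbrakk>length v + 2 = m \<or> length v + 3 = m; v \<noteq> []\<rbrakk> \<Longrightarrow> chip C (v @ [L]) < chip C v"
    and "length v + 3 = m \<Longrightarrow> chip C (v @ [L, R]) < chip C (v @ [R, R])"
    and "\<lbrakk>length v + 3 = m; v \<noteq> []; last v = R\<rbrakk> \<Longrightarrow> chip C (v @ [L, R]) < chip C (v @ [R])"
    and "\<lbrakk>4 \<le> m; x \<in> {1, 2}\<rbrakk> \<Longrightarrow> \<exists>z. length (L # L # z) < m \<and> chip C (L # L # z) = x"
proof -
  let ?M = "mirror (2 ^ m - 1) C"
  note M = mirror_stable[OF C]
  note right = stable_right[OF M]
  have less: "chip C y < chip C x" if "chip ?M (map flip x) < chip ?M (map flip y)" "length x < m" "length y < m" for x y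
    using that chip_mirror(1)[OF C, of "map flip x"] chip_mirror(1)[OF C, of "map flip y"] by simp
  have lastf: "last (map flip v) = flip (last v)" if "v \<noteq> []" for v using that by (simp add: last_map)
  show "\<lbrakk>length v + 1 < m; v = [] \<or> last v = R\<rbrakk> \<Longrightarrow> chip C (v @ [L]) < chip C v"
    using less[of v "v @ [L]"] right(1)[of "map flip v"] lastf by (cases "v = []") auto
  show "\<exists>z. length (v @ L # z) < m \<and> chip C (v @ L # z) < chip C (v @ u)"
    if h: "length v + 1 < m" "length (v @ u) < m" "\<And>z. u \<noteq> L # z"
  proof -
    have "map flip u \<noteq> R # z" for z
    proof
      assume "map flip u = R # z"
      then have "map flip (map flip u) = L # map flip z" by simp
      then show False using h(3) by simp
    qed
    then obtain z where z: "length (map flip v @ R # z) < m"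
        "chip ?M (map flip v @ map flip u) < chip ?M (map flip v @ R # z)"
      using right(2)[of "map flip v" "map flip u"] h by auto
    then have "chip C (v @ L # map flip z) < chip C (v @ u)"
      using less[of "v @ u" "v @ L # map flip z"] h(2) by simp
    then show ?thesis using z(1) by (intro exI[of _ "map flip z"]) simp
  qed
  show "\<lbrakk>length v + 2 = m \<or> length v + 3 = m; v \<noteq> []\<rbrakk> \<Longrightarrow> chip C (v @ [L]) < chip C v"
    using less[of v "v @ [L]"] right(3)[of "map flip v"] by auto
  show "length v + 3 = m \<Longrightarrow> chip C (v @ [L, R]) < chip C (v @ [R, R])"
    using less[of "v @ [R, R]" "v @ [L, R]"] right(4)[of "map flip v"] by simp
  show "\<lbrakk>length v + 3 = m; v \<noteq> []; last v = R\<rbrakk> \<Longrightarrow> chip C (v @ [L, R]) < chip C (v @ [R])"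
    using less[of "v @ [R]" "v @ [L, R]"] right(5)[of "map flip v"] lastf by simp
  show "\<exists>z. length (L # L # z) < m \<and> chip C (L # L # z) = x" if m: "4 \<le> m" and x: "x \<in> {1, 2}"
  proof -
    have pow: "(2::nat) ^ m \<ge> 16" using power_increasing[OF m, of "2::nat"] by simp
    have "2 ^ m - x \<in> {2 ^ m - 2, 2 ^ m - 1}" using x by auto
    then obtain z where z: "length (R # R # z) < m" "chip ?M (R # R # z) = 2 ^ m - x" using right(6)[OF m] by blast
    have "chip ?M (R # R # z) = 2 ^ m - chip C (L # L # map flip z)"
      using chip_mirror(1)[OF C, of "R # R # z"] z(1) by simp
    moreover have "chip C (L # L # map flip z) \<in> {1..2 ^ m - 1}"
      using chip_mirror(2)[OF C, of "L # L # map flip z"] z(1) by simp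
    ultimately have "chip C (L # L # map flip z) = x" using z(2) x pow by auto
    then show ?thesis using z(1) by (intro exI[of _ "map flip z"]) simp
  qed
qed

section \<open>Order patterns as labellings\<close>

lemma chip_rank_less:
  assumes "finite S" "x \<in> S" "y \<in> S"
  shows "chip_rank S x < chip_rank S y \<longleftrightarrow> x < y"
proof -
  have mono: "chip_rank S a < chip_rank S b" if "a < b" "b \<in> S" for a b
  proof -
    have "b \<in> {y \<in> S. y \<le> b} - {y \<in> S. y \<le> a}" using that by simp
    then have "{y \<in> S. y \<le> a} \<subset> {y \<in> S. y \<le> b}" using that by fastforce
    then show ?thesis unfolding chip_rank_def using assms by (intro psubset_card_mono) auto
  qed
  show ?thesis using mono[of x y] mono[of y x] assms by (cases x y rule: linorder_cases) auto
qed

lemma chip_rank_inj: "finite S \<Longrightarrow> inj_on (chip_rank S) S"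
  using chip_rank_less[of S] by (metis inj_onI less_irrefl linorder_neqE_nat)

lemma chip_rank_bij:
  assumes "finite S"
  shows "bij_betw (chip_rank S) S {1..card S}"
proof -
  have "chip_rank S x \<in> {1..card S}" if "x \<in> S" for x
  proof -
    have "{y \<in> S. y \<le> x} \<noteq> {}" using that by auto
    then have "0 < chip_rank S x" unfolding chip_rank_def using assms by (simp add: card_gt_0_iff)
    moreover have "chip_rank S x \<le> card S" unfolding chip_rank_def using assms by (intro card_mono) auto
    ultimately show ?thesis by simp
  qed
  then have "chip_rank S ` S = {1..card S}"
    by (intro card_subset_eq) (use card_image[OF chip_rank_inj[OF assms]] in auto)
  then show ?thesis using chip_rank_inj[OF assms] by (simp add: bij_betw_def)
qed

text \<open>Ranks depend only on the relative order, so ranking first in a larger set does not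
  change the pattern of a smaller one.\<close>

lemma chip_rank_rank:
  assumes "finite S" "S' \<subseteq> S" "x \<in> S'"
  shows "chip_rank (chip_rank S ` S') (chip_rank S x) = chip_rank S' x"
proof -
  have inj: "inj_on (chip_rank S) {y \<in> S'. y \<le> x}"
    using chip_rank_inj[OF assms(1)] assms(2) by (auto intro: inj_on_subset)
  have le: "chip_rank S y \<le> chip_rank S x \<longleftrightarrow> y \<le> x" if "y \<in> S'" for y
    using chip_rank_less[OF assms(1), of x y] that assms by (auto simp: not_less[symmetric])
  have "{y \<in> chip_rank S ` S'. y \<le> chip_rank S x} = chip_rank S ` {y \<in> S'. y \<le> x}"
    using le by auto
  then show ?thesis unfolding chip_rank_def[of "chip_rank S ` S'"] using card_image[OF inj]
    by (simp add: chip_rank_def)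
qed

lemma order_pattern_conf:
  assumes "length v + l \<le> k"
  shows "order_pattern l (conf k f) v = conf l (\<lambda>u. chip_rank ((\<lambda>u. f (v @ u)) ` tree l) (f (v @ u)))"
proof -
  have "(\<Union>u\<in>tree l. conf k f (v @ u)) = (\<lambda>u. f (v @ u)) ` tree l"
    using assms by (auto simp: conf_def)
  then show ?thesis unfolding order_pattern_def Let_def using assms by (auto simp: conf_def fun_eq_iff)
qed

definition sub_label :: "(vertex \<Rightarrow> nat) \<Rightarrow> nat \<Rightarrow> vertex \<Rightarrow> vertex \<Rightarrow> nat" where
  "sub_label f l v u = chip_rank ((\<lambda>u. f (v @ u)) ` tree l) (f (v @ u))"

lemma sub_label:
  assumes "inj_on f (tree k)" "length v + l \<le> k"
  shows "bij_betw (sub_label f l v) (tree l) {1..2 ^ l - 1}"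
    and "\<And>u w. \<lbrakk>length u < l; length w < l\<rbrakk> \<Longrightarrow> sub_label f l v u < sub_label f l v w \<longleftrightarrow> f (v @ u) < f (v @ w)"
    and "\<And>j u. length u + j \<le> l \<Longrightarrow>
      order_pattern j (conf l (sub_label f l v)) u = order_pattern j (conf k f) (v @ u)"
proof -
  let ?g = "\<lambda>u. f (v @ u)" let ?S = "?g ` tree l"
  have fin: "finite ?S" using finite_tree by simp
  have inj: "inj_on ?g (tree l)"
  proof (rule inj_onI)
    fix x y assume xy: "x \<in> tree l" "y \<in> tree l" "?g x = ?g y"
    then have "v @ x = v @ y" by (intro inj_onD[OF assms(1)]) (use assms(2) in auto)
    then show "x = y" by simp
  qed
  have "card ?S = 2 ^ l - 1" using card_image[OF inj] card_tree by simp
  then have "bij_betw (chip_rank ?S \<circ> ?g) (tree l) {1..2 ^ l - 1}"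
    using bij_betw_trans[of ?g "tree l" ?S "chip_rank ?S"] inj chip_rank_bij[OF fin] by (simp add: bij_betw_def)
  then show "bij_betw (sub_label f l v) (tree l) {1..2 ^ l - 1}" unfolding sub_label_def comp_def .
  show "sub_label f l v u < sub_label f l v w \<longleftrightarrow> f (v @ u) < f (v @ w)" if "length u < l" "length w < l" for u w
    unfolding sub_label_def by (rule chip_rank_less[OF fin]) (use that in auto)
  show "order_pattern j (conf l (sub_label f l v)) u = order_pattern j (conf k f) (v @ u)"
    if uj: "length u + j \<le> l" for j u
  proof -
    have sub: "(\<lambda>w. ?g (u @ w)) ` tree j \<subseteq> ?S" using that by auto
    have "(\<lambda>w. sub_label f l v (u @ w)) ` tree j = chip_rank ?S ` ((\<lambda>w. ?g (u @ w)) ` tree j)"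
      by (auto simp: sub_label_def image_image)
    then have "chip_rank ((\<lambda>w. sub_label f l v (u @ w)) ` tree j) (sub_label f l v (u @ w))
        = chip_rank ((\<lambda>w. ?g (u @ w)) ` tree j) (?g (u @ w))" if "length w < j" for w
      using chip_rank_rank[OF fin sub, of "?g (u @ w)"] that by (simp add: sub_label_def)
    then have "conf j (\<lambda>w. chip_rank ((\<lambda>w. sub_label f l v (u @ w)) ` tree j) (sub_label f l v (u @ w)))
        = conf j (\<lambda>w. chip_rank ((\<lambda>w. f ((v @ u) @ w)) ` tree j) (f ((v @ u) @ w)))"
      by (intro conf_cong) simp
    then show ?thesis
      using order_pattern_conf[OF uj, of "sub_label f l v"] order_pattern_conf[of "v @ u" j k f] uj assms(2) by simp
  qed
qed

section \<open>The zigzag path and its off-path subtrees\<close>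

definition turn :: "nat \<Rightarrow> side" where
  "turn i = (if even i then R else L)"

definition zig :: "nat \<Rightarrow> vertex" where
  "zig i = map turn [0..<i]"

definition off :: "nat \<Rightarrow> vertex" where
  "off i = zig i @ [flip (turn i)]"

text \<open>The class of a vertex: 0 on the path, otherwise the number of layers of the hanging
  subtree that contains it. The heights \<open>l - 1\<close>, ..., 1 occur once each, so a height
  names its subtree.\<close>

definition which :: "nat \<Rightarrow> vertex \<Rightarrow> nat" where
  "which l u = (if \<exists>k<length u. u ! k \<noteq> turn k then l - 1 - (LEAST k. k < length u \<and> u ! k \<noteq> turn k) else 0)"

definition blk :: "nat \<Rightarrow> nat \<Rightarrow> vertex" where
  "blk l j = off (l - 1 - j)"

lemma length_zig [simp]: "length (zig i) = i"
  by (simp add: zig_def)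

lemma length_off [simp]: "length (off i) = Suc i"
  by (simp add: off_def)

lemma zig_0: "zig 0 = []"
  by (simp add: zig_def)

lemma zig_Suc: "zig (Suc i) = zig i @ [turn i]"
  by (simp add: zig_def)

lemma zig_nth: "k < i \<Longrightarrow> zig i ! k = turn k"
  by (simp add: zig_def)

lemma flip_neq: "flip d \<noteq> d"
  by (cases d) auto

lemma which_zig: "which l (zig i) = 0"
  by (auto simp: which_def zig_nth)

lemma which_off: "which l (off i @ w) = l - 1 - i"
proof -
  have nth: "(off i @ w) ! k = turn k" if "k < i" for k
    using that by (simp add: off_def nth_append zig_nth)
  have i: "(off i @ w) ! i \<noteq> turn i" by (simp add: off_def nth_append flip_neq)
  have "(LEAST k. k < length (off i @ w) \<and> (off i @ w) ! k \<noteq> turn k) = i"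
  proof (rule Least_equality)
    show "i < length (off i @ w) \<and> (off i @ w) ! i \<noteq> turn i" using i by simp
    show "i \<le> k" if "k < length (off i @ w) \<and> (off i @ w) ! k \<noteq> turn k" for k
      using that nth[of k] by (metis linorder_not_less)
  qed
  moreover have "\<exists>k<length (off i @ w). (off i @ w) ! k \<noteq> turn k" using i by (intro exI[of _ i]) simp
  ultimately show ?thesis unfolding which_def by simp
qed

lemma zig_off_cases:
  obtains "u = zig (length u)" | i w where "u = off i @ w"
proof -
  have "u = zig (length u) \<or> (\<exists>i w. u = off i @ w)"
  proof (induction u rule: rev_induct)
    case (snoc d u)
    then show ?case
    proof
      assume u: "u = zig (length u)"
      show ?thesis
      proof (cases "d = turn (length u)")
        case True
        then show ?thesis using u by (simp add: zig_Suc)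
      next
        case False
        then have "d = flip (turn (length u))" by (cases d; cases "turn (length u)") auto
        then have "u @ [d] = off (length u) @ []" using u unfolding off_def by simp
        then show ?thesis by blast
      qed
    next
      assume "\<exists>i w. u = off i @ w"
      then obtain i w where "u @ [d] = off i @ (w @ [d])" by auto
      then show ?thesis by blast
    qed
  qed (simp add: zig_0)
  then show thesis using that by blast
qed

lemma which_tree_cases:
  assumes "length u < l"
  obtains i where "i < l" "u = zig i" "which l u = 0"
  | j w where "1 \<le> j" "j < l" "length w < j" "u = blk l j @ w" "which l u = j"
proof (cases u rule: zig_off_cases)
  case 1
  then show ?thesis using that(1)[of "length u"] which_zig[of l "length u"] assms by simp
next
  case (2 i w)
  then have "i + 1 + length w < l" using assms by simp
  then show ?thesis using that(2)[of "l - 1 - i" w] 2 which_off[of l i w] by (simp add: blk_def)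
qed

lemma which_blk: "\<lbrakk>1 \<le> j; j < l\<rbrakk> \<Longrightarrow> which l (blk l j @ w) = j"
  by (simp add: blk_def which_off)

lemma which_less: "\<lbrakk>length u < l\<rbrakk> \<Longrightarrow> which l u < l"
  by (cases u l rule: which_tree_cases) auto

lemma length_blk: "\<lbrakk>1 \<le> j; j < l\<rbrakk> \<Longrightarrow> length (blk l j) + j = l"
  by (simp add: blk_def)

lemma path_positions: "{u \<in> tree l. which l u = 0} = zig ` {..<l}"
proof (intro equalityI subsetI)
  fix u assume "u \<in> {u \<in> tree l. which l u = 0}"
  then have u: "length u < l" "which l u = 0" by auto
  from u(1) show "u \<in> zig ` {..<l}" by (cases u l rule: which_tree_cases) (use u in auto)
qed (auto simp: which_zig)

lemma block_positions:
  assumes "1 \<le> j" "j < l"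
  shows "{u \<in> tree l. which l u = j} = (@) (blk l j) ` tree j"
proof (intro equalityI subsetI)
  fix u assume "u \<in> {u \<in> tree l. which l u = j}"
  then have u: "length u < l" "which l u = j" by auto
  from u(1) show "u \<in> (@) (blk l j) ` tree j" by (cases u l rule: which_tree_cases) (use u assms in auto)
qed (use assms length_blk[OF assms] which_blk[OF assms] in auto)

lemma card_path: "card {u \<in> tree l. which l u = 0} = l"
proof -
  have "inj_on zig {..<l}" by (metis inj_onI length_zig)
  then show ?thesis unfolding path_positions by (simp add: card_image)
qed

lemma card_block:
  assumes "1 \<le> j" "j < l"
  shows "card {u \<in> tree l. which l u = j} = 2 ^ j - 1"
  unfolding block_positions[OF assms] by (subst card_image) (auto simp: inj_on_def card_tree)

section \<open>Counting admissible labellings\<close>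

text \<open>Here \<open>c\<close> counts the smallest labels forced into the first hanging subtree
  and the largest ones forced into the second. The values 1 and 2 give the lower entries of
  \<open>beta\<close> and \<open>gamma\<close>.\<close>

definition entries :: "nat \<Rightarrow> nat \<Rightarrow> nat list" where
  "entries l c = [2 ^ (l - 1) - 1 - c, 2 ^ (l - 2) - 1 - c] @ map (\<lambda>j. 2 ^ j - 1) (rev [1..<l - 2])"

definition class_size :: "nat \<Rightarrow> nat \<Rightarrow> nat \<Rightarrow> nat" where
  "class_size l c j = (if j = 0 then l else if j = l - 1 \<or> j = l - 2 then 2 ^ j - 1 - c else 2 ^ j - 1)"

definition letters :: "nat \<Rightarrow> nat \<Rightarrow> nat multiset" where
  "letters l c = (\<Sum>j<l. replicate_mset (class_size l c j) j)"

definition zigzags :: "nat \<Rightarrow> (nat \<Rightarrow> nat) set" where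
  "zigzags l = {\<sigma>. \<sigma> permutes {1..l} \<and>
     (\<forall>i\<in>{1..<l}. if odd i then \<sigma> i < \<sigma> (i + 1) else \<sigma> i > \<sigma> (i + 1))}"

lemma count_letters: "count (letters l c) j = (if j < l then class_size l c j else 0)"
proof -
  have "count (letters l c) j = (\<Sum>i<l. if i = j then class_size l c i else 0)"
    unfolding letters_def count_sum by (intro sum.cong) auto
  then show ?thesis by simp
qed

lemma split_classes: "4 \<le> (l :: nat) \<Longrightarrow> {..<l} = insert 0 (insert (l - 1) (insert (l - 2) {1..<l - 2}))"
  by auto

text \<open>The number of words is a multinomial coefficient; choosing the places of the letter 0,
  that is the labels of the path, splits off the binomial factor.\<close>

lemma card_words:
  assumes l: "4 \<le> l" and S: "sum_list (entries l c) = S - l" "l \<le> S"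
  shows "card (permutations_of_multiset (letters l c)) = (S choose l) * multinomial (S - l) (entries l c)"
proof -
  let ?P = "\<Prod>k\<leftarrow>entries l c. fact k :: nat"
  have neq: "0 \<noteq> l - 1" "0 \<noteq> l - 2" "l - 1 \<noteq> l - 2" "l - 1 \<notin> {1..<l - 2}" "l - 2 \<notin> {1..<l - 2}" using l by auto
  have prod_list: "(\<Prod>k\<leftarrow>map (\<lambda>j. 2 ^ j - 1) (rev [1..<l - 2]). g k) = (\<Prod>j\<in>{1..<l - 2}. g (2 ^ j - 1))" for g :: "nat \<Rightarrow> nat"
    using prod.distinct_set_conv_list[of "[1..<l - 2]" "\<lambda>j. g (2 ^ j - 1)"]
    by (simp add: comp_def rev_map[symmetric])
  have sum_list: "(\<Sum>k\<leftarrow>map (\<lambda>j. 2 ^ j - 1) (rev [1..<l - 2]). k) = (\<Sum>j\<in>{1..<l - 2}. 2 ^ j - 1 :: nat)"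
    using sum.distinct_set_conv_list[of "[1..<l - 2]" "\<lambda>j. 2 ^ j - 1 :: nat"]
    by (simp add: comp_def rev_map[symmetric])
  have cs: "class_size l c 0 = l" "class_size l c (l - 1) = 2 ^ (l - 1) - 1 - c"
    "class_size l c (l - 2) = 2 ^ (l - 2) - 1 - c" using neq by (auto simp: class_size_def)
  have cs': "class_size l c j = 2 ^ j - 1" if "j \<in> {1..<l - 2}" for j using that by (auto simp: class_size_def)
  \<comment> \<open>A letter of multiplicity zero contributes only
    \<open>fact 0 = 1\<close>.\<close>
  have "(\<Prod>x\<in>set_mset (letters l c). fact (count (letters l c) x) :: nat) = (\<Prod>x<l. fact (count (letters l c) x))"
    by (rule prod.mono_neutral_left) (auto simp: count_letters set_mset_def not_in_iff intro!: gr0I split: if_splits)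
  also have "\<dots> = (\<Prod>x<l. fact (class_size l c x))" by (simp add: count_letters)
  also have "\<dots> = fact l * ?P"
    unfolding split_classes[OF l] entries_def using neq cs cs' prod_list[of fact] by (simp add: mult_ac)
  finally have den: "(\<Prod>x\<in>set_mset (letters l c). fact (count (letters l c) x) :: nat) = fact l * ?P" .
  have "size (letters l c) = (\<Sum>x<l. class_size l c x)" unfolding letters_def by (simp add: size_multiset_sum)
  also have "\<dots> = l + sum_list (entries l c)"
    unfolding split_classes[OF l] entries_def using neq cs cs' sum_list by simp
  finally have size: "size (letters l c) = S" using S by simp
  have "card (permutations_of_multiset (letters l c)) * (fact l * ?P) = fact S"
    using card_permutations_of_multiset_aux[of "letters l c"] unfolding den size .
  moreover have "multinomial (S - l) (entries l c) * ?P = fact (S - l)"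
    unfolding multinomial_def using prod_list_fact_dvd[of "entries l c"] S by simp
  moreover have "fact l * fact (S - l) * (S choose l) = (fact S :: nat)" by (rule binomial_fact_lemma[OF S(2)])
  ultimately have "card (permutations_of_multiset (letters l c)) * (fact l * ?P)
      = (S choose l) * multinomial (S - l) (entries l c) * (fact l * ?P)" by (metis mult.assoc mult.commute)
  moreover have "(\<Prod>k\<leftarrow>ks. fact k :: nat) > 0" for ks by (induction ks) auto
  then have "fact l * ?P > 0" by simp
  ultimately show ?thesis by simp
qed

text \<open>Exactly the conditions that are counted. The value 0 outside the tree makes a labelling
  determined by its values on the tree.\<close>

definition admissible :: "nat \<Rightarrow> nat \<Rightarrow> (vertex \<Rightarrow> nat) set" where
  "admissible l c = {f. bij_betw f (tree l) {1..2 ^ l - 1} \<and> (\<forall>u. l \<le> length u \<longrightarrow> f u = 0) \<and>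
     (\<forall>i<l - 1. if even i then f (zig i) < f (zig (Suc i)) else f (zig (Suc i)) < f (zig i)) \<and>
     (\<forall>x\<in>{1..c}. \<exists>w. length w < l - 1 \<and> f (blk l (l - 1) @ w) = x) \<and>
     (\<forall>x\<in>{2 ^ l - c..2 ^ l - 1}. \<exists>w. length w < l - 2 \<and> f (blk l (l - 2) @ w) = x) \<and>
     (\<forall>j\<in>{1..<l}. order_pattern j (conf l f) (blk l j) \<in> order_patterns j)}"

definition class_of :: "nat \<Rightarrow> (vertex \<Rightarrow> nat) \<Rightarrow> nat \<Rightarrow> nat" where
  "class_of l f x = which l (inv_into (tree l) f x)"

definition word :: "nat \<Rightarrow> nat \<Rightarrow> (vertex \<Rightarrow> nat) \<Rightarrow> nat list" where
  "word l c f = map (class_of l f) [c + 1..<2 ^ l - c]"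

definition path_perm :: "nat \<Rightarrow> (vertex \<Rightarrow> nat) \<Rightarrow> nat \<Rightarrow> nat" where
  "path_perm l f i = (if i \<in> {1..l} then chip_rank (f ` zig ` {..<l}) (f (zig (i - 1))) else i)"

definition code :: "nat \<Rightarrow> nat \<Rightarrow> (vertex \<Rightarrow> nat) \<Rightarrow> nat list \<times> (nat \<Rightarrow> nat) \<times> (nat \<Rightarrow> config)" where
  "code l c f = (word l c f, path_perm l f, restrict (\<lambda>j. order_pattern j (conf l f) (blk l j)) {1..<l})"

lemma class_of_image:
  assumes "bij_betw f (tree l) {1..2 ^ l - 1}"
  shows "f ` {u \<in> tree l. which l u = j} = {x \<in> {1..2 ^ l - 1}. class_of l f x = j}"
    and "length u < l \<Longrightarrow> class_of l f (f u) = which l u"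
proof -
  have inj: "inj_on f (tree l)" and im: "f ` tree l = {1..2 ^ l - 1}" using assms by (auto simp: bij_betw_def)
  have cls: "class_of l f (f u) = which l u" if "length u < l" for u
    unfolding class_of_def using inv_into_f_f[OF inj, of u] that by simp
  then show "length u < l \<Longrightarrow> class_of l f (f u) = which l u" .
  show "f ` {u \<in> tree l. which l u = j} = {x \<in> {1..2 ^ l - 1}. class_of l f x = j}"
    unfolding im[symmetric] using cls by auto
qed

lemma admissible_fixed:
  assumes f: "f \<in> admissible l c" and l: "4 \<le> l"
  shows "x \<in> {1..c} \<Longrightarrow> class_of l f x = l - 1" "x \<in> {2 ^ l - c..2 ^ l - 1} \<Longrightarrow> class_of l f x = l - 2"
proof -
  have bij: "bij_betw f (tree l) {1..2 ^ l - 1}" using f by (simp add: admissible_def)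
  show "class_of l f x = l - 1" if x: "x \<in> {1..c}"
  proof -
    obtain w where w: "length w < l - 1" "f (blk l (l - 1) @ w) = x" using f x unfolding admissible_def by blast
    then show ?thesis
      using class_of_image(2)[OF bij, of "blk l (l - 1) @ w"] which_blk[of "l - 1" l w] length_blk[of "l - 1" l] l by simp
  qed
  show "class_of l f x = l - 2" if x: "x \<in> {2 ^ l - c..2 ^ l - 1}"
  proof -
    obtain w where w: "length w < l - 2" "f (blk l (l - 2) @ w) = x" using f x unfolding admissible_def by blast
    then show ?thesis
      using class_of_image(2)[OF bij, of "blk l (l - 2) @ w"] which_blk[of "l - 2" l w] length_blk[of "l - 2" l] l by simp
  qed
qed

lemma word_letters:
  assumes f: "f \<in> admissible l c" and l: "4 \<le> l" and c: "2 * c < 2 ^ l"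
  shows "mset (word l c f) = letters l c"
proof (rule multiset_eqI)
  fix j
  have bij: "bij_betw f (tree l) {1..2 ^ l - 1}" using f by (simp add: admissible_def)
  note fx = admissible_fixed[OF f l]
  let ?All = "{x \<in> {1..2 ^ l - 1}. class_of l f x = j}"
  let ?Mid = "{x \<in> {c + 1..<2 ^ l - c}. class_of l f x = j}"
  let ?Lo = "if j = l - 1 then {1..c} else {}" let ?Hi = "if j = l - 2 then {2 ^ l - c..2 ^ l - 1} else {}"
  have All: "?All = ?Mid \<union> (?Lo \<union> ?Hi)"
  proof (rule set_eqI)
    fix x
    consider "x \<in> {1..c}" | "x \<in> {2 ^ l - c..2 ^ l - 1}" | "x \<in> {c + 1..<2 ^ l - c}" | "x \<notin> {1..2 ^ l - 1}"
      using c by fastforce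
    then show "x \<in> ?All \<longleftrightarrow> x \<in> ?Mid \<union> (?Lo \<union> ?Hi)"
    proof cases
      case 1
      then have "x < 2 ^ l - c" "1 \<le> x" "x \<le> c" using c by auto
      then show ?thesis using fx(1)[OF 1] by auto
    next
      case 2
      then have "\<not> x < 2 ^ l - c" "1 \<le> x" "x \<le> 2 ^ l - 1" "\<not> x \<le> c" using c by auto
      then show ?thesis using fx(2)[OF 2] by auto
    next
      case 3
      then have "x < 2 ^ l - c" "1 \<le> x" "x \<le> 2 ^ l - 1" "\<not> x \<le> c" by auto
      then show ?thesis by auto
    next
      case 4
      then have "\<not> (1 \<le> x \<and> x \<le> 2 ^ l - 1)" by simp
      then have "x \<notin> {1..c}" "x \<notin> {2 ^ l - c..2 ^ l - 1}" "x \<notin> {c + 1..<2 ^ l - c}" using c by auto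
      then show ?thesis using 4 by auto
    qed
  qed
  have disj: "?Mid \<inter> (?Lo \<union> ?Hi) = {}" by auto
  have LH: "card (?Lo \<union> ?Hi) = (if j = l - 1 \<or> j = l - 2 then c else 0)"
  proof -
    have "card {2 ^ l - c..2 ^ l - 1} = c" using c by (cases "c = 0") auto
    moreover have "l - 1 \<noteq> l - 2" using l by simp
    ultimately show ?thesis by simp
  qed
  have sum: "card ?All = card ?Mid + card (?Lo \<union> ?Hi)"
    unfolding All by (rule card_Un_disjoint) (use disj in auto)
  have All': "card ?All = card {u \<in> tree l. which l u = j}"
    unfolding class_of_image(1)[OF bij, symmetric]
    by (rule card_image, rule inj_on_subset[of _ "tree l"]) (use bij in \<open>auto simp: bij_betw_def\<close>)
  have W: "card {u \<in> tree l. which l u = j} = (if j = 0 then l else if j < l then 2 ^ j - 1 else 0)"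
  proof -
    have "{u \<in> tree l. which l u = j} = {}" if "\<not> j < l" using that which_less by auto
    then have "card {u \<in> tree l. which l u = j} = 0" if "\<not> j < l" using that by (metis card.empty)
    then show ?thesis using card_path[of l] card_block[of j l] by (cases "j = 0"; cases "j < l") simp_all
  qed
  have "card ?Mid = (if j = 0 then l else if j < l then 2 ^ j - 1 else 0) - (if j = l - 1 \<or> j = l - 2 then c else 0)"
    using sum LH All' W by linarith
  then have mid: "card ?Mid = (if j < l then class_size l c j else 0)"
    using l by (cases "j < l"; cases "j = 0"; cases "j = l - 1"; cases "j = l - 2") (simp_all add: class_size_def)
  have "count (mset (word l c f)) j = card {i. i < length (word l c f) \<and> word l c f ! i = j}"
    unfolding count_mset by (simp add: count_list_eq_length_filter length_filter_conv_card eq_commute)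
  also have "\<dots> = card ?Mid"
  proof (rule bij_betw_same_card[of "\<lambda>i. c + 1 + i"])
    show "bij_betw (\<lambda>i. c + 1 + i) {i. i < length (word l c f) \<and> word l c f ! i = j} ?Mid"
      by (rule bij_betw_byWitness[where f' = "\<lambda>x. x - (c + 1)"]) (auto simp: word_def)
  qed
  finally show "count (mset (word l c f)) j = count (letters l c) j" using mid by (simp add: count_letters)
qed

lemma path_perm_zigzag:
  assumes f: "f \<in> admissible l c"
  shows "path_perm l f \<in> zigzags l"
proof -
  let ?S = "f ` zig ` {..<l}"
  have bij: "bij_betw f (tree l) {1..2 ^ l - 1}" using f by (simp add: admissible_def)
  have fin: "finite ?S" by simp
  have inj: "inj_on (\<lambda>i. f (zig i)) {..<l}"
  proof (rule inj_onI)
    fix i j assume "i \<in> {..<l}" "j \<in> {..<l}" "f (zig i) = f (zig j)"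
    then have "zig i = zig j" using inj_onD[OF bij_betw_imp_inj_on[OF bij], of "zig i" "zig j"] by simp
    then show "i = j" by (metis length_zig)
  qed
  have im: "(\<lambda>i. f (zig (i - 1))) ` {1..l} = ?S"
  proof (intro equalityI subsetI)
    fix x assume "x \<in> ?S"
    then obtain i where "i < l" "x = f (zig i)" by auto
    then show "x \<in> (\<lambda>i. f (zig (i - 1))) ` {1..l}" by (intro image_eqI[of _ _ "Suc i"]) auto
  qed auto
  have inj': "inj_on (\<lambda>i. f (zig (i - 1))) {1..l}"
  proof (rule inj_onI)
    fix i j assume ij: "i \<in> {1..l}" "j \<in> {1..l}" "f (zig (i - 1)) = f (zig (j - 1))"
    have "i - 1 \<in> {..<l}" "j - 1 \<in> {..<l}" using ij(1,2) by auto
    then have "i - 1 = j - 1" using inj_onD[OF inj ij(3)] by blast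
    moreover have "1 \<le> i" "1 \<le> j" using ij(1,2) by auto
    ultimately show "i = j" by linarith
  qed
  have "card ?S = l" using card_image[OF inj'] im by simp
  then have b2: "bij_betw (chip_rank ?S) ?S {1..l}" using chip_rank_bij[OF fin] by simp
  have b1: "bij_betw (\<lambda>i. f (zig (i - 1))) {1..l} ?S" using inj' im by (rule bij_betw_imageI)
  have "path_perm l f i = (chip_rank ?S \<circ> (\<lambda>i. f (zig (i - 1)))) i" if "i \<in> {1..l}" for i
    using that by (simp add: path_perm_def)
  then have "bij_betw (path_perm l f) {1..l} {1..l}"
    using bij_betw_trans[OF b1 b2] by (rule iffD2[OF bij_betw_cong])
  then have "path_perm l f permutes {1..l}" by (rule bij_imp_permutes) (auto simp: path_perm_def)
  moreover have "if odd i then path_perm l f i < path_perm l f (i + 1) else path_perm l f i > path_perm l f (i + 1)"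
    if i: "i \<in> {1..<l}" for i
  proof -
    have pp: "path_perm l f i = chip_rank ?S (f (zig (i - 1)))" "path_perm l f (i + 1) = chip_rank ?S (f (zig i))"
      using i by (auto simp: path_perm_def)
    have mem: "f (zig (i - 1)) \<in> ?S" "f (zig i) \<in> ?S" using i by auto
    have all: "\<forall>i<l - 1. if even i then f (zig i) < f (zig (Suc i)) else f (zig (Suc i)) < f (zig i)"
      using f unfolding admissible_def by blast
    have i1: "i - 1 < l - 1" and i2: "Suc (i - 1) = i" and i3: "even (i - 1) \<longleftrightarrow> odd i" using i by auto
    have alt: "if odd i then f (zig (i - 1)) < f (zig i) else f (zig i) < f (zig (i - 1))"
      using all[rule_format, OF i1] by (simp only: i2 i3)
    show ?thesis
    proof (cases "odd i")
      case True
      then show ?thesis using alt chip_rank_less[OF fin mem] unfolding pp by simp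
    next
      case False
      then show ?thesis using alt chip_rank_less[OF fin mem(2,1)] unfolding pp by simp
    qed
  qed
  ultimately show ?thesis unfolding zigzags_def by blast
qed

text \<open>The word and the forced labels determine the label set of each class. Within a known set
  a label is determined by its rank, which the path permutation and the patterns record.\<close>

lemma code_inj:
  assumes l: "4 \<le> l"
  shows "inj_on (code l c) (admissible l c)"
proof (rule inj_onI)
  fix f g assume f: "f \<in> admissible l c" and g: "g \<in> admissible l c" and eq: "code l c f = code l c g"
  have bf: "bij_betw f (tree l) {1..2 ^ l - 1}" and bg: "bij_betw g (tree l) {1..2 ^ l - 1}"
    using f g by (auto simp: admissible_def)
  have word: "word l c f = word l c g" and perm: "path_perm l f = path_perm l g"
    and rest: "restrict (\<lambda>j. order_pattern j (conf l f) (blk l j)) {1..<l} = restrict (\<lambda>j. order_pattern j (conf l g) (blk l j)) {1..<l}"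
    using eq unfolding code_def prod.inject by blast+
  have pat: "order_pattern j (conf l f) (blk l j) = order_pattern j (conf l g) (blk l j)" if "1 \<le> j" "j < l" for j
    using fun_cong[OF rest, of j] that by simp
  have cls: "class_of l f x = class_of l g x" if x: "x \<in> {1..2 ^ l - 1}" for x
  proof -
    consider "x \<in> {c + 1..<2 ^ l - c}" | "x \<in> {1..c}" | "x \<in> {2 ^ l - c..2 ^ l - 1}" using x by fastforce
    then show ?thesis
    proof cases
      case 1
      then show ?thesis using word unfolding word_def map_eq_conv set_upt by blast
    next
      case 2
      then show ?thesis using admissible_fixed(1)[OF f l 2] admissible_fixed(1)[OF g l 2] by simp
    next
      case 3
      then show ?thesis using admissible_fixed(2)[OF f l 3] admissible_fixed(2)[OF g l 3] by simp
    qed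
  qed
  have same: "f ` {u \<in> tree l. which l u = j} = g ` {u \<in> tree l. which l u = j}" for j
    unfolding class_of_image(1)[OF bf] class_of_image(1)[OF bg] by (rule Collect_cong, rule conj_cong[OF refl]) (simp only: cls)
  show "f = g"
  proof (rule ext)
    fix u
    show "f u = g u"
    proof (cases "length u < l")
      case False
      then have "f u = 0" "g u = 0" using f g unfolding admissible_def by (auto simp: not_less)
      then show ?thesis by simp
    next
      case True
      then show ?thesis
      proof (cases u l rule: which_tree_cases)
        case (1 i)
        let ?S = "f ` zig ` {..<l}"
        have S: "?S = g ` zig ` {..<l}" using same[of 0] unfolding path_positions .
        have "path_perm l f (Suc i) = chip_rank ?S (f (zig i))" "path_perm l g (Suc i) = chip_rank ?S (g (zig i))"
          unfolding S path_perm_def[of l g] using 1(1) by (simp_all add: path_perm_def S)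
        then have rank: "chip_rank ?S (f (zig i)) = chip_rank ?S (g (zig i))" using perm by simp
        have f_in: "f (zig i) \<in> ?S" using 1(1) by blast
        have g_in: "g (zig i) \<in> ?S" unfolding S using 1(1) by blast
        have fin: "finite ?S" by simp
        show ?thesis unfolding 1(2) by (rule inj_onD[OF chip_rank_inj[OF fin] rank f_in g_in])
      next
        case (2 j w)
        let ?b = "blk l j" let ?S = "(\<lambda>w. f (?b @ w)) ` tree j"
        have S: "?S = (\<lambda>w. g (?b @ w)) ` tree j"
          using same[of j] unfolding block_positions[OF 2(1,2)] image_image .
        have lb: "length ?b + j \<le> l" using length_blk[OF 2(1,2)] by simp
        have "conf j (\<lambda>w. chip_rank ?S (f (?b @ w))) w = conf j (\<lambda>w. chip_rank ?S (g (?b @ w))) w"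
          using pat[OF 2(1,2)] unfolding order_pattern_conf[OF lb] S by (rule fun_cong)
        then have rank: "chip_rank ?S (f u) = chip_rank ?S (g u)" using 2(3) unfolding 2(4) by (simp add: conf_def)
        have f_in: "f u \<in> ?S" unfolding 2(4) using 2(3) by blast
        have g_in: "g u \<in> ?S" unfolding S unfolding 2(4) using 2(3) by blast
        have fin: "finite ?S" using finite_tree by simp
        show ?thesis by (rule inj_onD[OF chip_rank_inj[OF fin] rank f_in g_in])
      qed
    qed
  qed
qed

lemma card_admissible:
  assumes l: "4 \<le> l" and c: "2 * c < 2 ^ l" and S: "sum_list (entries l c) = S - l" "l \<le> S"
  shows "finite (admissible l c)"
    "card (admissible l c) \<le> euler_zigzag l * (S choose l) * multinomial (S - l) (entries l c) * (\<Prod>j=1..<l. T j)"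
proof -
  let ?Y = "permutations_of_multiset (letters l c) \<times> zigzags l \<times> (PiE {1..<l} order_patterns)"
  have finZ: "finite (zigzags l)"
    by (rule finite_subset[OF _ finite_permutations[of "{1..l}"]]) (auto simp: zigzags_def)
  have finP: "finite (PiE {1..<l} order_patterns)" by (intro finite_PiE) (auto simp: finite_order_patterns)
  have finY: "finite ?Y" using finZ finP by simp
  have sub: "code l c ` admissible l c \<subseteq> ?Y"
  proof
    fix y assume "y \<in> code l c ` admissible l c"
    then obtain f where f: "f \<in> admissible l c" "y = code l c f" by auto
    have "word l c f \<in> permutations_of_multiset (letters l c)"
      using word_letters[OF f(1) l c] by (simp add: permutations_of_multiset_def)
    moreover have "restrict (\<lambda>j. order_pattern j (conf l f) (blk l j)) {1..<l} \<in> PiE {1..<l} order_patterns"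
      using f(1) by (auto simp: admissible_def)
    ultimately show "y \<in> ?Y" using f(2) path_perm_zigzag[OF f(1)] by (simp add: code_def)
  qed
  show "finite (admissible l c)" using inj_on_finite[OF code_inj[OF l] sub finY] .
  have "card (admissible l c) \<le> card ?Y" by (rule card_inj_on_le[OF code_inj[OF l] sub finY])
  also have "\<dots> = ((S choose l) * multinomial (S - l) (entries l c)) * (euler_zigzag l * (\<Prod>j=1..<l. T j))"
    using card_words[OF l S] by (simp add: card_cartesian_product card_PiE euler_zigzag_def zigzags_def T_def)
  finally show "card (admissible l c) \<le> euler_zigzag l * (S choose l) * multinomial (S - l) (entries l c) * (\<Prod>j=1..<l. T j)"
    by (simp add: mult_ac)
qed

section \<open>Order patterns below left children\<close>

definition side_patterns :: "side \<Rightarrow> nat \<Rightarrow> config set" where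
  "side_patterns d l = {order_pattern l C v | m C v.
     m > l \<and> C \<in> stable_configs (2 ^ m - 1) \<and> v \<noteq> [] \<and> last v = d \<and> layer v = m - l + 1}"

lemma order_patterns_sides: "order_patterns l = side_patterns L l \<union> side_patterns R l"
proof -
  have "last v = L \<or> last v = R" for v :: vertex by (cases "last v") auto
  then show ?thesis unfolding order_patterns_def side_patterns_def by blast
qed

lemma side_patternsE:
  assumes "P \<in> side_patterns d l"
  obtains m C v where "C \<in> stable_configs (2 ^ m - 1)" "length v + l = m" "v \<noteq> []" "last v = d" "P = order_pattern l C v"
proof -
  obtain m C v where "P = order_pattern l C v" "m > l" "C \<in> stable_configs (2 ^ m - 1)" "v \<noteq> []" "last v = d" "layer v = m - l + 1"
    using assms unfolding side_patterns_def by blast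
  moreover from this have "length v + l = m" by (simp add: layer_def)
  ultimately show thesis using that by blast
qed

definition lab :: "nat \<Rightarrow> config \<Rightarrow> vertex \<Rightarrow> vertex \<Rightarrow> nat" where
  "lab l C v u = (if length u < l then sub_label (chip C) l v u else 0)"

context
  fixes C :: config and m l :: nat and v :: vertex
  assumes C: "C \<in> stable_configs (2 ^ m - 1)" and len: "length v + l = m"
begin

lemma chip_inj: "inj_on (chip C) (tree m)"
  using stable_conf(2)[OF C] by (rule bij_betw_imp_inj_on)

lemma lab_bij: "bij_betw (lab l C v) (tree l) {1..2 ^ l - 1}"
proof -
  have "bij_betw (lab l C v) (tree l) S = bij_betw (sub_label (chip C) l v) (tree l) S" for S
    by (rule bij_betw_cong) (simp add: lab_def)
  then show ?thesis using sub_label(1)[OF chip_inj, of v l] len by blast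
qed

lemma lab_less: "\<lbrakk>length u < l; length w < l\<rbrakk> \<Longrightarrow> lab l C v u < lab l C v w \<longleftrightarrow> chip C (v @ u) < chip C (v @ w)"
  using sub_label(2)[OF chip_inj, of v l u w] len by (simp add: lab_def)

lemma conf_lab: "conf l (lab l C v) = conf l (sub_label (chip C) l v)"
  by (rule conf_cong) (simp add: lab_def)

lemma pattern_lab: "order_pattern l C v = conf l (lab l C v)"
proof -
  have "order_pattern l C v = order_pattern l (conf m (chip C)) v" using stable_conf(1)[OF C] by simp
  also have "\<dots> = conf l (lab l C v)"
    unfolding conf_lab using order_pattern_conf[of v l m "chip C"] len by (simp add: sub_label_def[abs_def])
  finally show ?thesis .
qed

lemma lab_sub_pattern:
  assumes "1 \<le> j" "length u + j = l" "v @ u \<noteq> []"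
  shows "order_pattern j (conf l (lab l C v)) u \<in> order_patterns j"
proof -
  have "order_pattern j (conf l (lab l C v)) u = order_pattern j (conf m (chip C)) (v @ u)"
    unfolding conf_lab using sub_label(3)[OF chip_inj, of v l u j] len assms by simp
  also have "\<dots> = order_pattern j C (v @ u)" using stable_conf(1)[OF C] by simp
  finally have "order_pattern j (conf l (lab l C v)) u = order_pattern j C (v @ u)" .
  moreover have "m > j" "layer (v @ u) = m - j + 1" using len assms by (auto simp: layer_def)
  ultimately show ?thesis unfolding order_patterns_def using C assms(3) by blast
qed

lemma lab_zigzag:
  assumes "v = [] \<or> last v = L" "i < l - 1"
  shows "if even i then lab l C v (zig i) < lab l C v (zig (Suc i)) else lab l C v (zig (Suc i)) < lab l C v (zig i)"
proof -
  have ln: "length (v @ zig i) + 1 < m" "length (zig i) < l" "length (zig (Suc i)) < l" using assms len by auto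
  have last: "v @ zig i = [] \<or> last (v @ zig i) = (if even i then L else R)"
  proof (cases i)
    case 0
    then show ?thesis using assms by (simp add: zig_0)
  next
    case (Suc j)
    then show ?thesis by (simp add: zig_Suc turn_def)
  qed
  show ?thesis
  proof (cases "even i")
    case True
    then have "chip C (v @ zig i) < chip C ((v @ zig i) @ [R])" using stable_right(1)[OF C ln(1)] last by simp
    then show ?thesis using True lab_less[OF ln(2,3)] by (simp add: zig_Suc turn_def)
  next
    case False
    then have "chip C ((v @ zig i) @ [L]) < chip C (v @ zig i)" using stable_left(1)[OF C ln(1)] last by simp
    then show ?thesis using False lab_less[OF ln(3,2)] by (simp add: zig_Suc turn_def)
  qed
qed

lemma blk_first: "blk l (l - 1) = [L]"
  by (simp add: blk_def off_def zig_0 turn_def)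

lemma blk_second: "2 \<le> l \<Longrightarrow> blk l (l - 2) = [R, R]"
  by (simp add: blk_def off_def zig_Suc zig_0 turn_def numeral_2_eq_2)

lemma lab_admissible:
  assumes l: "4 \<le> l" and v: "v = [] \<or> last v = L"
    and lo: "\<And>x. x \<in> {1..c} \<Longrightarrow> \<exists>w. length w < l - 1 \<and> lab l C v (L # w) = x"
    and hi: "\<And>x. x \<in> {2 ^ l - c..2 ^ l - 1} \<Longrightarrow> \<exists>w. length w < l - 2 \<and> lab l C v (R # R # w) = x"
  shows "lab l C v \<in> admissible l c"
proof -
  have "order_pattern j (conf l (lab l C v)) (blk l j) \<in> order_patterns j" if j: "j \<in> {1..<l}" for j
  proof (rule lab_sub_pattern)
    show "1 \<le> j" "length (blk l j) + j = l" using j length_blk[of j l] by auto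
    then show "v @ blk l j \<noteq> []" using j by auto
  qed
  moreover have "lab l C v u = 0" if "l \<le> length u" for u using that by (simp add: lab_def)
  ultimately show ?thesis
    unfolding admissible_def using lab_bij lab_zigzag[OF v] lo hi blk_first blk_second l by simp
qed

lemma lab_range: "length u < l \<Longrightarrow> lab l C v u \<in> {1..2 ^ l - 1}"
  using lab_bij unfolding bij_betw_def by auto

lemma lab_surj: "x \<in> {1..2 ^ l - 1} \<Longrightarrow> \<exists>u. length u < l \<and> lab l C v u = x"
  using lab_bij unfolding bij_betw_def by (metis (no_types, lifting) imageE mem_Collect_eq)

lemma lab_min:
  assumes "2 \<le> l" "length u < l" "lab l C v u = 1"
  shows "\<exists>w. u = L # w"
proof (rule ccontr)
  assume "\<not> ?thesis"
  then obtain z where z: "length (v @ L # z) < m" "chip C (v @ L # z) < chip C (v @ u)"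
    using stable_left(2)[OF C, of v u] assms len by auto
  then have "lab l C v (L # z) < 1" using lab_less[of "L # z" u] assms len by simp
  then show False using lab_range[of "L # z"] z len by simp
qed

lemma lab_max:
  assumes "3 \<le> l" "length u < l" "lab l C v u = 2 ^ l - 1"
  shows "\<exists>w. u = R # R # w"
proof -
  have step: "\<exists>z. w = R # z" if p: "u = p @ w" "length p \<le> 1" for p w
  proof (rule ccontr)
    assume "\<not> ?thesis"
    then obtain z where z: "length ((v @ p) @ R # z) < m" "chip C ((v @ p) @ w) < chip C ((v @ p) @ R # z)"
      using stable_right(2)[OF C, of "v @ p" w] assms len p by auto
    then have "lab l C v u < lab l C v (p @ R # z)" using lab_less[of u "p @ R # z"] assms len p by simp
    then show False using lab_range[of "p @ R # z"] z len assms by simp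
  qed
  obtain w where w: "u = R # w" using step[of "[]" u] by auto
  then obtain w' where "w = R # w'" using step[of "[R]" w] by auto
  then show ?thesis using w by simp
qed

lemma lab_admissible_1:
  assumes l: "4 \<le> l" and v: "v = [] \<or> last v = L"
  shows "lab l C v \<in> admissible l 1"
proof (rule lab_admissible[OF l v])
  have pow: "(2::nat) ^ l \<ge> 16" using power_increasing[OF l, of "2::nat"] by simp
  fix x :: nat
  show "\<exists>w. length w < l - 1 \<and> lab l C v (L # w) = x" if "x \<in> {1..1}"
  proof -
    have "x = 1" using that by simp
    then obtain u where u: "length u < l" "lab l C v u = 1" using lab_surj[of x] pow by fastforce
    then obtain w where "u = L # w" using lab_min l by fastforce
    then show ?thesis using u \<open>x = 1\<close> by (intro exI[of _ w]) auto
  qed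
  show "\<exists>w. length w < l - 2 \<and> lab l C v (R # R # w) = x" if "x \<in> {2 ^ l - 1..2 ^ l - 1}"
  proof -
    have x: "x = 2 ^ l - 1" using that by simp
    then obtain u where u: "length u < l" "lab l C v u = 2 ^ l - 1" using lab_surj[of x] pow by fastforce
    then obtain w where "u = R # R # w" using lab_max l by fastforce
    then show ?thesis using u x by (intro exI[of _ w]) auto
  qed
qed

end

lemma chip_rank_interval: "x \<in> {1..N} \<Longrightarrow> chip_rank {1..N} x = x"
proof -
  assume "x \<in> {1..N}"
  then have "{y \<in> {1..N}. y \<le> x} = {1..x}" by auto
  then show ?thesis by (simp add: chip_rank_def)
qed

text \<open>In the whole tree ranks are the chips themselves, so the placement of the two smallest
  and two largest chips applies directly and \<open>c = 2\<close> is possible.\<close>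

lemma stable_admissible:
  assumes C: "C \<in> stable_configs (2 ^ l - 1)" and l: "4 \<le> l"
  shows "lab l C [] \<in> admissible l 2" "C = conf l (lab l C [])"
proof -
  have len: "length ([] :: vertex) + l = l" by simp
  have lab: "lab l C [] u = chip C u" if "length u < l" for u
  proof -
    have "(\<lambda>u. chip C ([] @ u)) ` tree l = {1..2 ^ l - 1}" using stable_conf(2)[OF C] by (simp add: bij_betw_def)
    moreover have "chip C u \<in> {1..2 ^ l - 1}" using stable_conf(2)[OF C] that by (auto simp: bij_betw_def)
    ultimately show ?thesis using that chip_rank_interval by (simp add: lab_def sub_label_def)
  qed
  have "conf l (lab l C []) = conf l (chip C)" by (rule conf_cong) (rule lab)
  then show "C = conf l (lab l C [])" using stable_conf(1)[OF C] by simp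
  show "lab l C [] \<in> admissible l 2"
  proof (rule lab_admissible[OF C len l])
    fix x :: nat
    show "\<exists>w. length w < l - 1 \<and> lab l C [] (L # w) = x" if "x \<in> {1..2}"
    proof -
      have "x \<in> {1, 2}" using that by auto
      then obtain z where "length (L # L # z) < l" "chip C (L # L # z) = x" using stable_left(6)[OF C l] by blast
      then show ?thesis using lab[of "L # L # z"] by (intro exI[of _ "L # z"]) auto
    qed
    show "\<exists>w. length w < l - 2 \<and> lab l C [] (R # R # w) = x" if "x \<in> {2 ^ l - 2..2 ^ l - 1}"
    proof -
      have "x \<in> {2 ^ l - 2, 2 ^ l - 1}" using that by auto
      then obtain z where "length (R # R # z) < l" "chip C (R # R # z) = x" using stable_right(6)[OF C l] by blast
      then show ?thesis using lab[of "R # R # z"] by (intro exI[of _ z]) auto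
    qed
  qed simp
qed

section \<open>The exchange at the lower end of the zigzag path\<close>

definition leafy :: "nat \<Rightarrow> (vertex \<Rightarrow> nat) \<Rightarrow> bool" where
  "leafy l f \<longleftrightarrow> (if even l then f (off (l - 2)) < f (zig (l - 2)) else f (zig (l - 2)) < f (off (l - 2)))"

text \<open>The vertex \<open>zig (l - 2)\<close> is one layer above the bottom and is not the root,
  so its chip lies between those of both its children, hence also on the forced side of the child
  off the path.\<close>

lemma lab_leafy:
  assumes C: "C \<in> stable_configs (2 ^ m - 1)" and len: "length v + l = m" and l: "4 \<le> l"
  shows "leafy l (lab l C v)"
proof -
  let ?e = "l - 2" let ?y = "v @ zig (l - 2)"
  have y: "length ?y + 2 = m" "length ?y \<noteq> 0" using l len by auto
  then have y0: "?y \<noteq> []" by (metis list.size(3))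
  have ev: "even ?e \<longleftrightarrow> even l" using l by auto
  have "length (off ?e) < l" "length (zig ?e) < l" using l by auto
  note less = lab_less[OF C len this] lab_less[OF C len this(2,1)]
  have "chip C (?y @ [L]) < chip C ?y" "chip C ?y < chip C (?y @ [R])"
    using stable_left(3)[OF C _ y0] stable_right(3)[OF C _ y0] y(1) by auto
  moreover have "off ?e = zig ?e @ [if even l then L else R]" unfolding off_def turn_def ev by simp
  ultimately show ?thesis unfolding leafy_def using less by (cases "even l") simp_all
qed

definition swap_leaf :: "nat \<Rightarrow> (vertex \<Rightarrow> nat) \<Rightarrow> vertex \<Rightarrow> nat" where
  "swap_leaf l f = f \<circ> Transposition.transpose (off (l - 2)) (zig (l - 2))"

lemma off_neq_zig: "off i \<noteq> zig j"
  using which_off[of "i + 2" i "[]"] which_zig[of "i + 2" j] by auto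

lemma zig_inj: "zig i = zig j \<longleftrightarrow> i = j"
  by (metis length_zig)

lemma swap_leaf_simps:
  "swap_leaf l f (off (l - 2)) = f (zig (l - 2))"
  "swap_leaf l f (zig (l - 2)) = f (off (l - 2))"
  "\<lbrakk>u \<noteq> off (l - 2); u \<noteq> zig (l - 2)\<rbrakk> \<Longrightarrow> swap_leaf l f u = f u"
  by (simp_all add: swap_leaf_def Transposition.transpose_def)

lemma swap_leaf_block:
  assumes l: "4 \<le> l" and j: "2 \<le> j" "j < l"
  shows "swap_leaf l f (blk l j @ w) = f (blk l j @ w)"
proof (rule swap_leaf_simps(3))
  have w: "which l (blk l j @ w) = j" using which_blk[of j l w] j by simp
  show "blk l j @ w \<noteq> off (l - 2)" using w which_off[of l "l - 2" "[]"] j l by auto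
  show "blk l j @ w \<noteq> zig (l - 2)" using w which_zig[of l "l - 2"] j by auto
qed

lemma order_pattern_1: "length u + 1 \<le> l \<Longrightarrow> order_pattern 1 (conf l f) u = conf 1 (\<lambda>_. 1)"
proof -
  assume u: "length u + 1 \<le> l"
  have "chip_rank ((\<lambda>w. f (u @ w)) ` tree 1) (f (u @ w)) = 1" if "length w < 1" for w
  proof -
    have "tree 1 = {[]}" by auto
    moreover have "{y \<in> {f u}. y \<le> f u} = {f u}" by auto
    ultimately show ?thesis using that by (simp add: chip_rank_def)
  qed
  then show ?thesis unfolding order_pattern_conf[OF u] by (intro conf_cong)
qed

lemma swap_leaf_admissible:
  assumes f: "f \<in> admissible l 1" and l: "4 \<le> l" and lf: "leafy l f"
  shows "swap_leaf l f \<in> admissible l 1" "\<not> leafy l (swap_leaf l f)"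
proof -
  let ?o = "off (l - 2)" let ?z = "zig (l - 2)" let ?g = "swap_leaf l f"
  show "\<not> leafy l ?g" using lf by (auto simp: leafy_def swap_leaf_simps split: if_splits)
  have bij: "bij_betw f (tree l) {1..2 ^ l - 1}" and out: "\<And>u. l \<le> length u \<Longrightarrow> f u = 0"
    and alt: "\<And>i. i < l - 1 \<Longrightarrow> if even i then f (zig i) < f (zig (Suc i)) else f (zig (Suc i)) < f (zig i)"
    and lo: "\<And>x. x \<in> {1..1} \<Longrightarrow> \<exists>w. length w < l - 1 \<and> f (blk l (l - 1) @ w) = x"
    and hi: "\<And>x. x \<in> {2 ^ l - 1..2 ^ l - 1} \<Longrightarrow> \<exists>w. length w < l - 2 \<and> f (blk l (l - 2) @ w) = x"
    and pat: "\<And>j. j \<in> {1..<l} \<Longrightarrow> order_pattern j (conf l f) (blk l j) \<in> order_patterns j"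
    using f unfolding admissible_def by blast+
  have "bij_betw ?g (tree l) {1..2 ^ l - 1}"
    unfolding swap_leaf_def by (subst bij_betw_swap_iff) (use bij l in auto)
  moreover have "?g u = 0" if "l \<le> length u" for u
  proof -
    have "u \<noteq> ?o" "u \<noteq> ?z" using that l by auto
    then show ?thesis using out[OF that] by (simp add: swap_leaf_simps)
  qed
  moreover have "if even i then ?g (zig i) < ?g (zig (Suc i)) else ?g (zig (Suc i)) < ?g (zig i)" if i: "i < l - 1" for i
  proof -
    have other: "?g (zig k) = f (zig k)" if "k \<noteq> l - 2" for k
      using that off_neq_zig[of "l - 2" k] by (intro swap_leaf_simps(3)) (auto simp: zig_inj)
    \<comment> \<open>For even \<open>l\<close> the label at \<open>zig (l - 2)\<close> is a local
      minimum of the path and the leaf carries a smaller one; for odd \<open>l\<close> both are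
      reversed. So the exchange makes the extremum more extreme and keeps both comparisons.\<close>
    consider "i = l - 2" | "Suc i = l - 2" | "i \<noteq> l - 2" "Suc i \<noteq> l - 2" by blast
    then show ?thesis
    proof cases
      case 1
      moreover have "even (l - 2) \<longleftrightarrow> even l" using l by auto
      ultimately show ?thesis using alt[OF i] lf other[of "Suc i"] l
        by (auto simp: leafy_def swap_leaf_simps split: if_splits)
    next
      case 2
      moreover have "even i \<longleftrightarrow> odd l" using 2 l by presburger
      ultimately show ?thesis using alt[OF i] lf other[of i] l
        by (auto simp: leafy_def swap_leaf_simps split: if_splits)
    next
      case 3
      then show ?thesis using alt[OF i] other by simp
    qed
  qed
  moreover have "\<exists>w. length w < l - 1 \<and> ?g (blk l (l - 1) @ w) = x" if "x \<in> {1..1}" for x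
    using lo[OF that] swap_leaf_block[OF l, of "l - 1" f] l by simp
  moreover have "\<exists>w. length w < l - 2 \<and> ?g (blk l (l - 2) @ w) = x" if "x \<in> {2 ^ l - 1..2 ^ l - 1}" for x
    using hi[OF that] swap_leaf_block[OF l, of "l - 2" f] l by simp
  moreover have "order_pattern j (conf l ?g) (blk l j) \<in> order_patterns j" if j: "j \<in> {1..<l}" for j
  proof -
    have lb: "length (blk l j) + j \<le> l" using length_blk[of j l] j by simp
    have "order_pattern j (conf l ?g) (blk l j) = order_pattern j (conf l f) (blk l j)"
    \<comment> \<open>Among the hanging subtrees the exchange touches only the one that is a single
      vertex, which has just one pattern.\<close>
    proof (cases "j = 1")
      case True
      then show ?thesis using order_pattern_1[of "blk l 1" l] lb by simp
    next
      case False
      then have "?g (blk l j @ w) = f (blk l j @ w)" for w using swap_leaf_block[OF l, of j f w] j by simp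
      then show ?thesis unfolding order_pattern_conf[OF lb] by simp
    qed
    then show ?thesis using pat[OF j] by simp
  qed
  ultimately show "?g \<in> admissible l 1" unfolding admissible_def by blast
qed

text \<open>Exchanging the chip at the bottom vertex off the zigzag path with the chip at its parent on the
  path keeps a labelling admissible but violates the order that a stable configuration forces there.
  This gains the factor 2 needed to count the patterns below left and below right children together.\<close>

lemma card_left_patterns:
  assumes l: "4 \<le> l" and fin: "finite (admissible l 1)"
  shows "2 * card (side_patterns L l) \<le> card (admissible l 1)"
proof -
  let ?F = "{f \<in> admissible l 1. leafy l f}"
  have finF: "finite ?F" using fin by simp
  have "side_patterns L l \<subseteq> conf l ` ?F"
  proof
    fix P assume "P \<in> side_patterns L l"
    then obtain m C v where C: "C \<in> stable_configs (2 ^ m - 1)" "length v + l = m" "last v = L" "P = order_pattern l C v"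
      by (rule side_patternsE)
    then have "lab l C v \<in> ?F" using lab_admissible_1[OF C(1,2) l] lab_leafy[OF C(1,2) l] by simp
    moreover have "P = conf l (lab l C v)" using pattern_lab[OF C(1,2)] C(4) by simp
    ultimately show "P \<in> conf l ` ?F" by blast
  qed
  then have le: "card (side_patterns L l) \<le> card ?F"
    by (rule surj_card_le[OF finF])
  have inj: "inj_on (swap_leaf l) ?F"
  proof (rule inj_onI)
    fix f g assume eq: "swap_leaf l f = swap_leaf l g"
    have inv: "swap_leaf l (swap_leaf l h) = h" for h by (simp add: swap_leaf_def comp_assoc)
    show "f = g" using arg_cong[OF eq, of "swap_leaf l"] by (simp add: inv)
  qed
  have "card ?F + card (swap_leaf l ` ?F) = card (?F \<union> swap_leaf l ` ?F)"
    by (rule card_Un_disjoint[symmetric]) (use finF swap_leaf_admissible(2)[OF _ l] in auto)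
  also have "\<dots> \<le> card (admissible l 1)"
    by (rule card_mono[OF fin]) (use swap_leaf_admissible(1)[OF _ l] in auto)
  finally have "card ?F + card ?F \<le> card (admissible l 1)" unfolding card_image[OF inj] .
  then show ?thesis using le by simp
qed

section \<open>Patterns below right children by reflection\<close>

lemma chip_rank_reverse:
  assumes "finite S" "S \<subseteq> {..<K}" "x \<in> S"
  shows "chip_rank ((\<lambda>x. K - x) ` S) (K - x) = card S + 1 - chip_rank S x"
proof -
  have inj: "inj_on (\<lambda>x. K - x) S" using assms(2) by (auto simp: inj_on_def)
  have "{y \<in> (\<lambda>x. K - x) ` S. y \<le> K - x} = (\<lambda>x. K - x) ` {y \<in> S. x \<le> y}" using assms by auto
  then have "chip_rank ((\<lambda>x. K - x) ` S) (K - x) = card {y \<in> S. x \<le> y}"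
    unfolding chip_rank_def using card_image[OF inj_on_subset[OF inj], of "{y \<in> S. x \<le> y}"] by simp
  moreover have "card S + 1 = card {y \<in> S. y \<le> x} + card {y \<in> S. x \<le> y}"
  proof -
    have "S = {y \<in> S. y \<le> x} \<union> {y \<in> S. x \<le> y}" "{y \<in> S. y \<le> x} \<inter> {y \<in> S. x \<le> y} = {x}" using assms by auto
    then show ?thesis using card_Un_Int[of "{y \<in> S. y \<le> x}" "{y \<in> S. x \<le> y}"] assms(1) by simp
  qed
  ultimately show ?thesis by (simp add: chip_rank_def)
qed

lemma lab_mirror:
  assumes C: "C \<in> stable_configs (2 ^ m - 1)" and len: "length v + l = m" and u: "length u < l"
  shows "lab l (mirror (2 ^ m - 1) C) (map flip v) (map flip u) = 2 ^ l - lab l C v u"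
proof -
  let ?M = "mirror (2 ^ m - 1) C" let ?S = "(\<lambda>u. chip C (v @ u)) ` tree l"
  have ch: "chip ?M (map flip v @ map flip w) = 2 ^ m - chip C (v @ w)" if "length w < l" for w
    using chip_mirror(1)[OF C, of "map flip (v @ w)"] that len by simp
  have tree: "map flip ` tree l = tree l"
  proof (intro equalityI subsetI)
    fix w assume "w \<in> tree l"
    then show "w \<in> map flip ` tree l" by (intro image_eqI[of _ _ "map flip w"]) auto
  qed auto
  have "(\<lambda>w. chip ?M (map flip v @ w)) ` tree l = (\<lambda>w. chip ?M (map flip v @ w)) ` map flip ` tree l"
    by (simp only: tree)
  also have "\<dots> = (\<lambda>w. 2 ^ m - chip C (v @ w)) ` tree l"
    unfolding image_image by (rule image_cong) (use ch in auto)
  also have "\<dots> = (\<lambda>x. 2 ^ m - x) ` ?S" by (simp only: image_image)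
  finally have S': "(\<lambda>w. chip ?M (map flip v @ w)) ` tree l = (\<lambda>x. 2 ^ m - x) ` ?S" .
  have fin: "finite ?S" using finite_tree by simp
  have inj: "inj_on (\<lambda>u. chip C (v @ u)) (tree l)"
  proof (rule inj_onI)
    fix x y assume "x \<in> tree l" "y \<in> tree l" "chip C (v @ x) = chip C (v @ y)"
    then have "v @ x = v @ y" using inj_onD[OF chip_inj[OF C len], of "v @ x" "v @ y"] len by simp
    then show "x = y" by simp
  qed
  have "?S \<subseteq> {..<2 ^ m}"
  proof
    fix x assume "x \<in> ?S"
    then obtain w where "x = chip C (v @ w)" "length w < l" by auto
    then have "x \<in> {1..2 ^ m - 1}" using chip_mirror(2)[OF C, of "v @ w"] len by simp
    then show "x \<in> {..<2 ^ m}" by (simp add: Suc_le_eq[symmetric]) linarith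
  qed
  then have "chip_rank ((\<lambda>x. 2 ^ m - x) ` ?S) (2 ^ m - chip C (v @ u)) = card ?S + 1 - chip_rank ?S (chip C (v @ u))"
    by (intro chip_rank_reverse[OF fin]) (use u in auto)
  moreover have "card ?S + 1 = 2 ^ l" using card_image[OF inj] card_tree[of l] by simp
  ultimately show ?thesis using u ch[OF u] S' by (simp add: lab_def sub_label_def)
qed

lemma finite_side_patterns: "finite (side_patterns d l)"
  by (rule finite_subset[OF _ finite_order_patterns[of l]]) (cases d; auto simp: order_patterns_sides)

lemma card_right_patterns: "card (side_patterns R l) \<le> card (side_patterns L l)"
proof -
  let ?G = "\<lambda>P. conf l (\<lambda>u. 2 ^ l - chip P (map flip u))"
  have "side_patterns R l \<subseteq> ?G ` side_patterns L l"
  proof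
    fix P assume "P \<in> side_patterns R l"
    then obtain m C v where C: "C \<in> stable_configs (2 ^ m - 1)" "length v + l = m" "v \<noteq> []" "last v = R" "P = order_pattern l C v"
      by (rule side_patternsE)
    let ?M = "mirror (2 ^ m - 1) C" let ?v = "map flip v"
    have M: "?M \<in> stable_configs (2 ^ m - 1)" "length ?v + l = m" using mirror_stable[OF C(1)] C(2) by auto
    have "l < m" "layer ?v = m - l + 1" "?v \<noteq> []" "last ?v = L" using C by (auto simp: layer_def last_map)
    then have Q: "order_pattern l ?M ?v \<in> side_patterns L l" unfolding side_patterns_def using M(1) by blast
    have "2 ^ l - chip (order_pattern l ?M ?v) (map flip u) = lab l C v u" if u: "length u < l" for u
      using lab_mirror[OF C(1,2) u] lab_range[OF C(1,2) u] u unfolding pattern_lab[OF M] by (auto simp: chip_conf)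
    then have "?G (order_pattern l ?M ?v) = conf l (lab l C v)" by (intro conf_cong)
    then have "P = ?G (order_pattern l ?M ?v)" using C(5) pattern_lab[OF C(1,2)] by simp
    then show "P \<in> ?G ` side_patterns L l" using Q by blast
  qed
  then have "card (side_patterns R l) \<le> card (?G ` side_patterns L l)"
    by (intro card_mono finite_imageI finite_side_patterns)
  also have "\<dots> \<le> card (side_patterns L l)" by (rule card_image_le[OF finite_side_patterns])
  finally show ?thesis .
qed

lemma T_le_admissible:
  assumes "4 \<le> l" "finite (admissible l 1)"
  shows "T l \<le> card (admissible l 1)"
  using card_Un_le[of "side_patterns L l" "side_patterns R l"] card_right_patterns[of l] card_left_patterns[OF assms]
  unfolding T_def order_patterns_sides by linarith

lemma Z_le_admissible:
  assumes l: "4 \<le> l" and fin: "finite (admissible l 2)"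
  shows "Z l \<le> card (admissible l 2)"
proof -
  have "stable_configs (2 ^ l - 1) \<subseteq> conf l ` admissible l 2"
    using stable_admissible[OF _ l] by blast
  then have "card (stable_configs (2 ^ l - 1)) \<le> card (conf l ` admissible l 2)" using fin by (intro card_mono) auto
  also have "\<dots> \<le> card (admissible l 2)" by (rule card_image_le[OF fin])
  finally show ?thesis by (simp add: Z_def)
qed

section \<open>Patterns of size at most three\<close>

lemma order_patternsE:
  assumes "P \<in> order_patterns l"
  obtains m C v where "C \<in> stable_configs (2 ^ m - 1)" "length v + l = m" "v \<noteq> []" "P = conf l (lab l C v)"
proof -
  obtain d where "P \<in> side_patterns d l" using assms unfolding order_patterns_sides by blast
  then obtain m C v where C: "C \<in> stable_configs (2 ^ m - 1)" "length v + l = m" "v \<noteq> []" "P = order_pattern l C v"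
    by (rule side_patternsE)
  then show thesis using that pattern_lab[OF C(1,2)] by simp
qed

lemma T_1: "T 1 \<le> 1"
proof -
  have "order_patterns 1 \<subseteq> {conf 1 (\<lambda>_. 1)}"
  proof
    fix P assume "P \<in> order_patterns 1"
    then obtain m C v where C: "C \<in> stable_configs (2 ^ m - 1)" "length v + 1 = m" "P = conf 1 (lab 1 C v)"
      by (rule order_patternsE)
    have "lab 1 C v u = 1" if "length u < 1" for u using lab_range[OF C(1,2) that] by simp
    then show "P \<in> {conf 1 (\<lambda>_. 1)}" using C(3) conf_cong[of 1 "lab 1 C v" "\<lambda>_. 1"] by simp
  qed
  then show ?thesis unfolding T_def using card_mono[of "{conf 1 (\<lambda>_. 1)}"] by fastforce
qed

lemma T_2: "T 2 \<le> 1"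
proof -
  let ?f = "\<lambda>u :: vertex. if u = [] then 2 else if u = [L] then 1 else 3"
  have "order_patterns 2 \<subseteq> {conf 2 ?f}"
  proof
    fix P assume "P \<in> order_patterns 2"
    then obtain m C v where C: "C \<in> stable_configs (2 ^ m - 1)" "length v + 2 = m" "v \<noteq> []" "P = conf 2 (lab 2 C v)"
      by (rule order_patternsE)
    have "chip C (v @ [L]) < chip C v" "chip C v < chip C (v @ [R])"
      using stable_left(3)[OF C(1) _ C(3)] stable_right(3)[OF C(1) _ C(3)] C(2) by auto
    then have "lab 2 C v [L] < lab 2 C v []" "lab 2 C v [] < lab 2 C v [R]"
      using lab_less[OF C(1,2), of "[L]" "[]"] lab_less[OF C(1,2), of "[]" "[R]"] by auto
    moreover have "lab 2 C v [L] \<in> {1..3}" "lab 2 C v [R] \<in> {1..3}"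
      using lab_range[OF C(1,2), of "[L]"] lab_range[OF C(1,2), of "[R]"] by auto
    ultimately have val: "lab 2 C v [] = 2" "lab 2 C v [L] = 1" "lab 2 C v [R] = 3" by auto
    have "lab 2 C v u = ?f u" if "length u < 2" for u
    proof (cases u)
      case (Cons d w)
      then have "w = []" using that by simp
      then show ?thesis using Cons val by (cases d) auto
    qed (use val in simp)
    then show "P \<in> {conf 2 ?f}" using C(4) conf_cong[of 2 "lab 2 C v" ?f] by simp
  qed
  then show ?thesis unfolding T_def using card_mono[of "{conf 2 ?f}"] by fastforce
qed

text \<open>The conditions \<open>a < r < b\<close>, \<open>a < x\<close>, \<open>y < b\<close> have
  eleven linear extensions: three gaps of the chain for each of \<open>x\<close> and
  \<open>y\<close>, and two orders in each of the two gaps open to both. The final disjunction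
  removes only \<open>y < a < r < b < x\<close>.\<close>

lemma three_orders_check:
  "list_all (\<lambda>r. list_all (\<lambda>a. list_all (\<lambda>b. list_all (\<lambda>x. list_all (\<lambda>y.
     a < r \<and> r < b \<and> a < x \<and> y < b \<and> distinct [r, a, b, x, y] \<and> (a < y \<or> x < b) \<longrightarrow>
     List.member [(4,2,6,3,5),(5,2,6,4,3),(3,2,6,5,4),(5,2,6,3,4),(3,2,6,4,5),(3,2,5,6,4),(4,2,6,5,3),
       (4,2,5,6,3),(5,3,6,4,2),(4,3,6,5,2)] (r, a, b, x, y))
     [2..<7]) [2..<7]) [2..<7]) [2..<7]) [2..<(7::nat)]"
  by code_simp

lemma three_orders:
  fixes r a b x y :: nat
  assumes "{r, a, b, x, y} \<subseteq> {2..6}" "a < r" "r < b" "a < x" "y < b" "distinct [r, a, b, x, y]" "a < y \<or> x < b"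
  shows "(r, a, b, x, y) \<in> set [(4,2,6,3,5),(5,2,6,4,3),(3,2,6,5,4),(5,2,6,3,4),(3,2,6,4,5),(3,2,5,6,4),(4,2,6,5,3),
       (4,2,5,6,3),(5,3,6,4,2),(4,3,6,5,2)]"
proof -
  have "r \<in> set [2..<7]" "a \<in> set [2..<7]" "b \<in> set [2..<7]" "x \<in> set [2..<7]" "y \<in> set [2..<7]" using assms(1) by auto
  then show ?thesis using three_orders_check assms(2-) unfolding list_all_iff List.member_iff by blast
qed

lemma T_3: "T 3 \<le> 10"
proof -
  let ?mk = "\<lambda>(r, a, b, x, y). conf 3 (\<lambda>u :: vertex. if u = [] then r else if u = [L] then a else if u = [R] then b
    else if u = [L, L] then 1 else if u = [L, R] then x else if u = [R, L] then y else (7::nat))"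
  let ?E = "[(4,2,6,3,5),(5,2,6,4,3),(3,2,6,5,4),(5,2,6,3,4),(3,2,6,4,5),(3,2,5,6,4),(4,2,6,5,3),
       (4,2,5,6,3),(5,3,6,4,2),(4,3,6,5,2)] :: (nat \<times> nat \<times> nat \<times> nat \<times> nat) list"
  have tree3: "u \<in> {[], [L], [R], [L, L], [L, R], [R, L], [R, R]}" if "length u < 3" for u :: vertex
  proof -
    have "length u = 0 \<or> length u = Suc 0 \<or> length u = Suc (Suc 0)" using that by linarith
    moreover have "d = L \<or> d = R" for d by (cases d) auto
    ultimately show ?thesis by (auto simp: length_Suc_conv)
  qed
  have "order_patterns 3 \<subseteq> ?mk ` set ?E"
  proof
    fix P assume "P \<in> order_patterns 3"
    then obtain m C v where C: "C \<in> stable_configs (2 ^ m - 1)" and len: "length v + 3 = m" and v: "v \<noteq> []"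
      and P: "P = conf 3 (lab 3 C v)"
      by (rule order_patternsE)
    let ?f = "lab 3 C v"
    have less: "?f u < ?f w \<longleftrightarrow> chip C (v @ u) < chip C (v @ w)" if "length u < 3" "length w < 3" for u w
      by (rule lab_less[OF C len that])
    have "chip C ((v @ [d]) @ [L]) < chip C (v @ [d]) \<and> chip C (v @ [d]) < chip C ((v @ [d]) @ [R])" for d
      using stable_left(3)[OF C, of "v @ [d]"] stable_right(3)[OF C, of "v @ [d]"] len by auto
    from this[of L] this[of R] have c: "?f [L, L] < ?f [L]" "?f [L] < ?f [L, R]" "?f [R, L] < ?f [R]" "?f [R] < ?f [R, R]"
      using less by auto
    have r: "?f [L] < ?f []" "?f [] < ?f [R]"
      using stable_left(3)[OF C _ v] stable_right(3)[OF C _ v] len less by auto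
    have o: "?f [L, L] < ?f [R, L]" "?f [L, R] < ?f [R, R]"
      using stable_left(4)[OF C len] stable_right(4)[OF C len] less by auto
    \<comment> \<open>Which alternative holds depends on whether \<open>v\<close> is a left or a
      right child.\<close>
    have i: "?f [L] < ?f [R, L] \<or> ?f [L, R] < ?f [R]"
    proof (cases "last v")
      case L
      then show ?thesis using stable_right(5)[OF C len v] less by auto
    next
      case R
      then show ?thesis using stable_left(5)[OF C len v] less by auto
    qed
    have range: "?f u \<in> {1..7}" if "length u < 3" for u using lab_range[OF C len that] by simp
    obtain u where u: "length u < 3" "?f u = 1" using lab_surj[OF C len, of 1] by auto
    have LL: "?f [L, L] = 1"
      using tree3[OF u(1)] u(2) c r o range[of "[L, L]"] by auto
    obtain w where w: "length w < 3" "?f w = 7" using lab_surj[OF C len, of 7] by auto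
    have RR: "?f [R, R] = 7"
      using tree3[OF w(1)] w(2) c r o range[of "[R, R]"] by auto
    have inj: "?f p \<noteq> ?f q" if "length p < 3" "length q < 3" "p \<noteq> q" for p q
      using inj_onD[OF bij_betw_imp_inj_on[OF lab_bij[OF C len]], of p q] that by auto
    have mem: "(?f [], ?f [L], ?f [R], ?f [L, R], ?f [R, L]) \<in> set ?E"
    proof (rule three_orders)
      show "{?f [], ?f [L], ?f [R], ?f [L, R], ?f [R, L]} \<subseteq> {2..6}" using LL RR c r o by auto
      show "distinct [?f [], ?f [L], ?f [R], ?f [L, R], ?f [R, L]]" using inj by auto
    qed (use c r i in auto)
    have "P = ?mk (?f [], ?f [L], ?f [R], ?f [L, R], ?f [R, L])"
      unfolding P split by (rule conf_cong) (use tree3 LL RR in fastforce)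
    then show "P \<in> ?mk ` set ?E" using mem by (rule image_eqI)
  qed
  then have "T 3 \<le> card (set ?E)" unfolding T_def by (rule surj_card_le[OF finite_set])
  also have "\<dots> \<le> length ?E" by (rule card_length)
  finally show ?thesis by simp
qed

section \<open>The bounds\<close>

lemma size_bounds:
  assumes "4 \<le> l"
  shows "l \<le> 2 ^ l - 5" "l \<le> 2 ^ l - (3::nat)" "2 * 2 < (2::nat) ^ l"
proof -
  have "l + 5 \<le> (2::nat) ^ l" using assms by (induction l rule: dec_induct) auto
  then show "l \<le> 2 ^ l - 5" "l \<le> 2 ^ l - (3::nat)" "2 * 2 < (2::nat) ^ l" using assms by linarith+
qed

lemma T_recursion:
  assumes "4 \<le> l"
  shows "T l \<le> beta l * (\<Prod>j=1..<l. T j)"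
proof -
  have "sum_list (entries l 1) = 2 ^ l - 3 - l" using beta_entries[OF assms] by (simp add: entries_def numeral_2_eq_2)
  note card = card_admissible[OF assms _ this size_bounds(2)[OF assms]]
  have "beta l = euler_zigzag l * ((2 ^ l - 3) choose l) * multinomial (2 ^ l - 3 - l) (entries l 1)"
    by (simp add: beta_def entries_def numeral_2_eq_2)
  then show ?thesis using T_le_admissible[OF assms card(1)] card(2) size_bounds(3)[OF assms] by fastforce
qed

lemma Z_recursion:
  assumes "4 \<le> l"
  shows "Z l \<le> gamma l * (\<Prod>j=1..<l. T j)"
proof -
  have "sum_list (entries l 2) = 2 ^ l - 5 - l" using gamma_entries[OF assms] by (simp add: entries_def numeral_3_eq_3)
  note card = card_admissible[OF assms size_bounds(3)[OF assms] this size_bounds(1)[OF assms]]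
  have "gamma l = euler_zigzag l * ((2 ^ l - 5) choose l) * multinomial (2 ^ l - 5 - l) (entries l 2)"
    by (simp add: gamma_def entries_def numeral_3_eq_3)
  then show ?thesis using Z_le_admissible[OF assms card(1)] card(2) by simp
qed

text \<open>If \<open>Q\<close> is the product up to size \<open>l - 1\<close>, then
  \<open>T l\<close> is at most \<open>beta l * Q\<close>, so the next product is at most
  \<open>beta l * Q * Q\<close>. Each step squares the bound, which doubles all exponents; the 10 is
  the starting value \<open>T 1 * T 2 * T 3\<close>, bounded from above.\<close>

lemma prod_T_le:
  assumes "4 \<le> l"
  shows "(\<Prod>j=1..<l. T j) \<le> 10 ^ (2 ^ (l - 4)) * (\<Prod>i=4..l - 1. beta i ^ (2 ^ (l - 1 - i)))"
  using assms
proof (induction l rule: dec_induct)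
  case base
  have "{1..<4::nat} = {1, 2, 3}" by auto
  moreover have "T 1 * (T 2 * T 3) \<le> 1 * (1 * 10)" by (intro mult_le_mono T_1 T_2 T_3)
  ultimately show ?case by simp
next
  case (step l)
  let ?Q = "\<Prod>j=1..<l. T j" let ?B = "10 ^ (2 ^ (l - 4)) * (\<Prod>i=4..l - 1. beta i ^ (2 ^ (l - 1 - i)))"
  have sq: "beta i ^ (2 ^ (l - i)) = beta i ^ (2 ^ (l - 1 - i)) * beta i ^ (2 ^ (l - 1 - i))" if "i \<in> {4..l - 1}" for i
  proof -
    have "l - i = Suc (l - 1 - i)" using that by auto
    then show ?thesis by (simp add: power_add[symmetric] mult_2)
  qed
  have "{4..Suc l - 1} = insert l {4..l - 1}" using step by auto
  moreover have "l \<notin> {4..l - 1}" using step by auto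
  ultimately have "(\<Prod>i=4..Suc l - 1. beta i ^ (2 ^ (Suc l - 1 - i))) = beta l * (\<Prod>i=4..l - 1. beta i ^ (2 ^ (l - i)))"
    by simp
  also have "(\<Prod>i=4..l - 1. beta i ^ (2 ^ (l - i)))
      = (\<Prod>i=4..l - 1. beta i ^ (2 ^ (l - 1 - i))) * (\<Prod>i=4..l - 1. beta i ^ (2 ^ (l - 1 - i)))"
    unfolding prod.distrib[symmetric] by (rule prod.cong) (use sq in auto)
  finally have prod: "(\<Prod>i=4..Suc l - 1. beta i ^ (2 ^ (Suc l - 1 - i)))
      = beta l * ((\<Prod>i=4..l - 1. beta i ^ (2 ^ (l - 1 - i))) * (\<Prod>i=4..l - 1. beta i ^ (2 ^ (l - 1 - i))))" .
  have "Suc l - 4 = Suc (l - 4)" using step by simp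
  then have "(10::nat) ^ (2 ^ (Suc l - 4)) = 10 ^ (2 ^ (l - 4)) * 10 ^ (2 ^ (l - 4))"
    by (simp add: power_add[symmetric] mult_2)
  then have rhs: "10 ^ (2 ^ (Suc l - 4)) * (\<Prod>i=4..Suc l - 1. beta i ^ (2 ^ (Suc l - 1 - i))) = ?B * (beta l * ?B)"
    unfolding prod by (simp add: mult_ac)
  have "(\<Prod>j=1..<Suc l. T j) = ?Q * T l" using step by simp
  also have "\<dots> \<le> ?B * (beta l * ?B)"
    using T_recursion[OF step(1)] step.IH by (intro mult_le_mono) (auto intro: order_trans mult_le_mono2)
  finally show ?case unfolding rhs .
qed

theorem mainTheorem7:
  fixes l :: nat
  assumes "l \<ge> 4"
  shows "T l \<le> 10 ^ (2 ^ (l - 4)) * beta l * (\<Prod>i=4..l - 1. beta i ^ (2 ^ (l - 1 - i)))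
    \<and> Z l \<le> 10 ^ (2 ^ (l - 4)) * gamma l * (\<Prod>i=4..l - 1. beta i ^ (2 ^ (l - 1 - i)))"
proof -
  let ?B = "10 ^ (2 ^ (l - 4)) * (\<Prod>i=4..l - 1. beta i ^ (2 ^ (l - 1 - i)))"
  have "T l \<le> beta l * ?B" "Z l \<le> gamma l * ?B"
    using T_recursion[OF assms] Z_recursion[OF assms] prod_T_le[OF assms]
    by (meson le_trans mult_le_mono2)+
  then show ?thesis by (simp add: mult_ac)
qed

end
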